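(* Let $\chi(a)=\left(\frac{a}{17}\right)$ denote the Legendre symbol modulo $17$. Then $\mathfrak{p}(n,-\chi)=0$ for all positive integers $n \equiv 11,15,29,33 \pmod{34}$. Equivalently, $\mathfrak{p}(n,-\chi)=0$ whenever $n$ is odd and $1-24n$ is congruent to a quadratic residue modulo $17$ that is not a quartic residue modulo $17$.
   Context: For $f:\mathbb{N}\to\{0,\pm1\}$ and a positive integer $n$, the $f$-signed partition number is \[\mathfrak{p}(n,f)=\sum_{\substack{x_1+\cdots+x_k=n\\ x_1\ge\cdots\ge x_k>0\\ k\ge1}} f(x_1)f(x_2)\cdots f(x_k),\] i.e. the sum over all partitions of $n$ of the product of the values of $f$ at the parts; equivalently $\prod_{m\ge1}(1-f(m)x^m)^{-1}=1+\sum_{n\ge1}\mathfrak{p}(n,f)x^n$ for $|x|<1$. Here $-\chi$ is the function $a\mapsto-\chi(a)$. For a prime $p>2$, $\left(\frac{a}{p}\right)$ is $1$ if $p\nmid a$ and $a$ is a square mod $p$, $-1$ if $p\nmid a$ and $a$ is not a square mod $p$, and $0$ if $p\mid a$. *)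

theory Defs
  imports "HOL-Number_Theory.Number_Theory"
begin

text \<open>
  A partition of \<open>n\<close> is its list of parts in weakly decreasing order. As in the source,
  at least one part is required (\<open>k \<ge> 1\<close>), so \<open>0\<close> has no partition here.
\<close>

definition partitions :: "nat \<Rightarrow> nat list set" where
  "partitions n =
     {xs. xs \<noteq> [] \<and> sorted_wrt (\<ge>) xs \<and> (\<forall>x\<in>set xs. x > 0) \<and> sum_list xs = n}"

lemma finite_partitions: "finite (partitions n)"
proof (rule finite_subset)
  have len: "length xs \<le> sum_list xs" if "\<forall>x\<in>set xs. x > 0" for xs :: "nat list"
    using that by (induction xs) auto
  show "partitions n \<subseteq> {xs. set xs \<subseteq> {..n} \<and> length xs \<le> n}"
    using len by (auto simp: partitions_def member_le_sum_list)
  show "finite {xs. set xs \<subseteq> {..n} \<and> length xs \<le> n}"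
    by (rule finite_lists_length_le) simp
qed

definition signed_partition_number :: "nat \<Rightarrow> (nat \<Rightarrow> int) \<Rightarrow> int" where
  "signed_partition_number n f = (\<Sum>xs\<in>partitions n. prod_list (map f xs))"

definition chi17 :: "nat \<Rightarrow> int" where
  "chi17 a = Legendre (int a) 17"

text \<open>
  Residues are taken among the units modulo \<open>p\<close>. The library's \<^const>\<open>QuadRes\<close> also
  holds for multiples of \<open>p\<close>, which are excluded here.
\<close>

definition quadratic_residue :: "int \<Rightarrow> int \<Rightarrow> bool" where
  "quadratic_residue p a \<longleftrightarrow> coprime a p \<and> QuadRes p a"

definition quartic_residue :: "int \<Rightarrow> int \<Rightarrow> bool" where
  "quartic_residue p a \<longleftrightarrow> coprime a p \<and> (\<exists>y. [y ^ 4 = a] (mod p))"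

end

theory Submission
  imports "HOL-Complex_Analysis.Complex_Analysis" "HOL-Real_Asymp.Real_Asymp" Defs
begin

text \<open>
  Put \<open>q = exp (2 \<pi> i \<tau>)\<close> and \<open>x = q\<^sup>1\<^sup>/\<^sup>3\<^sup>4\<close>. Up to the factor \<open>x\<^sup>1\<^sup>2\<close>, the generating function of the
  signed partition numbers is a quotient \<open>h\<close> of theta functions at the 34-torsion points on the line
  through \<open>(1, 0)\<close>. The analogous quotients \<open>h V\<close> for the other vectors \<open>V\<close> modulo 34 are permuted
  by the modular group, up to a factor common to all of them. The coefficients in the class \<open>R\<close> modulo
  34 are isolated by \<open>\<Sum>j. exp (- 2 \<pi> i j R / 34) h (V + j W)\<close> with \<open>V = (1, 0)\<close>, \<open>W = (0, 1)\<close>, and the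
  modular group permutes these sums for all \<open>V, W\<close> of determinant 1 modulo 34. The individual
  quotients may have poles at the cusp, but only in exponents \<open>s\<close> for which the coefficient in the sum
  is a Kloosterman-like sum over quadratic non-residues \<open>c\<close>, twisted by a sign which \<open>c \<mapsto> s / (R c)\<close>
  reverses whenever \<open>s / R\<close> is a quartic residue. Hence the sums are holomorphic and vanish at the
  cusp, and by the maximum modulus principle they are zero.
\<close>

section \<open>Theta functions and Klein forms\<close>

text \<open>For real \<open>a\<close>, \<open>b\<close>, \<open>klein a b\<close> is, up to sign, a
  Siegel function times \<open>q^(-1/12)\<close>. With four forms over eight, the absolute value of
  the common factor is therefore that of a power of \<open>q\<close>, with exponent 1/3, and a pole
  means an exponent below 1/3. The quotients start at exponent 0, 3/17, 6/17 or 9/17, depending on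
  the first coordinate modulo 34, and 6/17 clears the bound by only 1/51. What has to be removed are
  the exponents 0, 3/17 and 5/17. For 0 it suffices that \<open>R\<close> is odd. For the other two,
  arithmetic enters: modulo 17 the admissible \<open>R\<close> are 6, 7, 10, 11, and all ratios 6/R
  and 10/R are quartic residues. The exponent 4/17 could not be removed in this way, since 8 is a
  quadratic residue and \<open>R\<close> is not, but its coefficient is already zero in the
  quotients. The shape of \<open>h\<close> rests on 2 being a quadratic residue modulo 17: by
  Euler's identity, the factors \<open>1 / (1 + x^m)\<close> over the residues \<open>m\<close>
  multiply to the product of \<open>1 - x^m\<close> over the odd residues.\<close>

lemma uniform_limit_prodinf_complex:
  fixes f :: "nat \<Rightarrow> 'a::topological_space \<Rightarrow> complex"
  assumes "compact A" and cont: "\<And>n. continuous_on A (f n)"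
    and bound: "\<And>n x. x \<in> A \<Longrightarrow> norm (f n x) \<le> B n" and "summable B"
  shows "uniform_limit A (\<lambda>N x. \<Prod>n<N. 1 + f n x) (\<lambda>x. \<Prod>n. 1 + f n x) sequentially"
proof -
  have "uniformly_convergent_on A (\<lambda>N x. \<Sum>n<N. norm (f n x))"
    by (rule Weierstrass_m_test'[OF _ \<open>summable B\<close>]) (use bound in auto)
  then have "uniformly_convergent_on A (\<lambda>N x. \<Prod>n<N. 1 + f n x)"
    by (intro uniformly_convergent_on_prod cont \<open>compact A\<close>)
  then obtain g where g: "uniform_limit A (\<lambda>N x. \<Prod>n<N. 1 + f n x) g sequentially"
    by (auto simp: uniformly_convergent_on_def)
  have "g x = (\<Prod>n. 1 + f n x)" if "x \<in> A" for x
  proof -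
    have "summable (\<lambda>n. norm (f n x))"
      using bound[OF that] by (intro summable_comparison_test[OF _ \<open>summable B\<close>]) auto
    then have "convergent_prod (\<lambda>n. 1 + f n x)"
      by (intro abs_convergent_prod_imp_convergent_prod summable_imp_abs_convergent_prod) simp
    then have "(\<lambda>N. \<Prod>n\<le>N. 1 + f n x) \<longlonglongrightarrow> (\<Prod>n. 1 + f n x)"
      by (rule convergent_prod_LIMSEQ)
    then have "(\<lambda>N. \<Prod>n<N. 1 + f n x) \<longlonglongrightarrow> (\<Prod>n. 1 + f n x)"
      using LIMSEQ_lessThan_iff_atMost by blast
    then show ?thesis
      using tendsto_uniform_limitI[OF g that] LIMSEQ_unique by blast
  qed
  then show ?thesis
    using g by (simp cong: uniform_limit_cong')
qed

lemma holomorphic_prodinf: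
  fixes f :: "nat \<Rightarrow> complex \<Rightarrow> complex"
  assumes "open S" and hol: "\<And>n. f n holomorphic_on S"
    and bound: "\<And>K. compact K \<Longrightarrow> K \<subseteq> S \<Longrightarrow> \<exists>B. summable B \<and> (\<forall>n. \<forall>x\<in>K. norm (f n x) \<le> B n)"
  shows "(\<lambda>x. \<Prod>n. 1 + f n x) holomorphic_on S"
proof (rule holomorphic_uniform_sequence[OF \<open>open S\<close>])
  show "(\<lambda>x. \<Prod>n<N. 1 + f n x) holomorphic_on S" for N
    by (intro holomorphic_intros hol)
  fix x assume "x \<in> S"
  then obtain d where d: "d > 0" "cball x d \<subseteq> S"
    using \<open>open S\<close> open_contains_cball by blast
  obtain B where "summable B" "\<And>n y. y \<in> cball x d \<Longrightarrow> norm (f n y) \<le> B n"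
    using bound[OF compact_cball d(2)] by blast
  then have "uniform_limit (cball x d) (\<lambda>N x. \<Prod>n<N. 1 + f n x) (\<lambda>x. \<Prod>n. 1 + f n x) sequentially"
    by (intro uniform_limit_prodinf_complex)
      (use hol d in \<open>blast intro: holomorphic_on_imp_continuous_on holomorphic_on_subset compact_cball\<close>)+
  with d show "\<exists>d. 0 < d \<and> cball x d \<subseteq> S \<and>
      uniform_limit (cball x d) (\<lambda>N x. \<Prod>n<N. 1 + f n x) (\<lambda>x. \<Prod>n. 1 + f n x) sequentially"
    by blast
qed

section \<open>q-Pochhammer symbols and the exponential\<close>

definition qpoch :: "complex \<Rightarrow> complex \<Rightarrow> complex" where
  "qpoch z q = (\<Prod>n. 1 - z * q ^ n)"

lemma convergent_prod_qpoch:
  fixes z q :: complex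
  assumes "norm q < 1"
  shows "convergent_prod (\<lambda>n. 1 - z * q ^ n)"
proof -
  have "summable (\<lambda>n. norm (- (z * q ^ n)))"
    using summable_mult[OF summable_geometric[of "norm q"], of "norm z"] assms
    by (simp add: norm_mult norm_power)
  then have "convergent_prod (\<lambda>n. 1 + - (z * q ^ n))"
    by (intro abs_convergent_prod_imp_convergent_prod summable_imp_abs_convergent_prod) simp
  then show ?thesis by simp
qed

lemma qpoch_tendsto:
  assumes "norm q < 1"
  shows "(\<lambda>N. \<Prod>n<N. 1 - z * q ^ n) \<longlonglongrightarrow> qpoch z q"
  using convergent_prod_LIMSEQ[OF convergent_prod_qpoch[OF assms]]
  unfolding qpoch_def LIMSEQ_lessThan_iff_atMost by simp

lemma qpoch_rec:
  assumes "norm q < 1"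
  shows "qpoch z q = (1 - z) * qpoch (z * q) q"
proof -
  have "(\<lambda>n. 1 - z * q ^ n) has_prod ((\<Prod>k<1. 1 - z * q ^ k) * (\<Prod>k. 1 - z * q ^ (k + 1)))"
    by (rule has_prod_ignore_initial_segment'[OF convergent_prod_qpoch[OF assms]])
  then have "qpoch z q = (1 - z) * (\<Prod>k. 1 - z * q ^ (k + 1))"
    unfolding qpoch_def by (simp add: has_prod_iff)
  then show ?thesis
    by (simp add: qpoch_def mult_ac)
qed

lemma qpoch_nonzero:
  assumes "norm q < 1" "\<And>n. z * q ^ n \<noteq> 1"
  shows "qpoch z q \<noteq> 0"
  unfolding qpoch_def
  by (rule prodinf_nonzero[OF convergent_prod_qpoch[OF assms(1)]]) (use assms(2) in force)

lemma holomorphic_qpoch: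
  assumes "open S" and z: "z holomorphic_on S" and q: "q holomorphic_on S"
    and q1: "\<And>x. x \<in> S \<Longrightarrow> norm (q x) < 1"
  shows "(\<lambda>x. qpoch (z x) (q x)) holomorphic_on S"
proof -
  have "(\<lambda>x. \<Prod>n. 1 + - (z x * q x ^ n)) holomorphic_on S"
  proof (rule holomorphic_prodinf[OF \<open>open S\<close>])
    show "(\<lambda>x. - (z x * q x ^ n)) holomorphic_on S" for n
      by (intro holomorphic_intros z q)
    fix K assume K: "compact K" "K \<subseteq> S"
    have "compact (z ` K)" "compact (q ` K)"
      using K z q by (auto intro!: compact_continuous_image holomorphic_on_imp_continuous_on
          intro: holomorphic_on_subset)
    then have "bounded (z ` K)"
      by (simp add: compact_imp_bounded)
    then obtain M where M: "\<And>x. x \<in> K \<Longrightarrow> norm (z x) \<le> M"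
      by (auto simp: bounded_iff)
    obtain r where r: "0 \<le> r" "r < 1" "\<And>x. x \<in> K \<Longrightarrow> norm (q x) \<le> r"
    proof (cases "K = {}")
      case True then show ?thesis using that[of 0] by auto
    next
      case False
      have "continuous_on K (\<lambda>x. norm (q x))"
        using q K by (intro continuous_intros)
          (auto intro: holomorphic_on_imp_continuous_on holomorphic_on_subset)
      then obtain x0 where "x0 \<in> K" "\<And>x. x \<in> K \<Longrightarrow> norm (q x) \<le> norm (q x0)"
        using continuous_attains_sup[OF K(1) False] by blast
      then show ?thesis using that[of "norm (q x0)"] q1 K by auto
    qed
    have "norm (- (z x * q x ^ n)) \<le> \<bar>M\<bar> * r ^ n" if "x \<in> K" for x n
      using M[OF that] r(3)[OF that] r(1)
      by (auto simp: norm_mult norm_power intro!: mult_mono power_mono)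
    moreover have "summable (\<lambda>n. \<bar>M\<bar> * r ^ n)"
      using r by (intro summable_mult summable_geometric) auto
    ultimately show "\<exists>B. summable B \<and> (\<forall>n. \<forall>x\<in>K. norm (- (z x * q x ^ n)) \<le> B n)"
      by blast
  qed
  then show ?thesis by (simp add: qpoch_def)
qed

lemma qpoch_0 [simp]: "qpoch 0 q = 1"
  by (simp add: qpoch_def)

definition ee :: "complex \<Rightarrow> complex" where
  "ee t = exp (2 * of_real pi * \<i> * t)"

lemma ee_add: "ee (s + t) = ee s * ee t"
  by (simp add: ee_def ring_distribs exp_add)

lemma ee_diff: "ee (s - t) = ee s / ee t"
  by (simp add: ee_def ring_distribs exp_diff)

lemma ee_minus: "ee (- t) = inverse (ee t)"
  by (simp add: ee_def exp_minus)

lemma ee_0 [simp]: "ee 0 = 1"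
  by (simp add: ee_def)

lemma ee_neq_0 [simp]: "ee t \<noteq> 0"
  by (simp add: ee_def)

lemma ee_power: "ee t ^ n = ee (of_nat n * t)"
  by (simp add: ee_def exp_of_nat_mult [symmetric] mult_ac)

lemma ee_eq_1_iff: "ee t = 1 \<longleftrightarrow> t \<in> \<int>"
proof -
  have "ee t = 1 \<longleftrightarrow> (\<exists>n::int. t = of_int n)"
    unfolding ee_def exp_eq_1
    by (auto simp: complex_eq_iff)
  then show ?thesis by (auto simp: Ints_def)
qed

lemma ee_of_int [simp]: "ee (of_int n) = 1"
  by (simp add: ee_eq_1_iff)

lemma ee_1 [simp]: "ee 1 = 1"
  using ee_of_int[of 1] by simp

lemma ee_half: "ee (1/2) = -1"
  by (simp add: ee_def)

lemma norm_ee: "norm (ee t) = exp (- 2 * pi * Im t)"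
  by (simp add: ee_def)

lemma norm_ee_less_1: "Im t > 0 \<Longrightarrow> norm (ee t) < 1"
  by (simp add: norm_ee)

lemma holomorphic_ee [holomorphic_intros]:
  "f holomorphic_on S \<Longrightarrow> (\<lambda>x. ee (f x)) holomorphic_on S"
  unfolding ee_def by (intro holomorphic_intros)

lemma has_field_derivative_ee [derivative_intros]:
  assumes "(f has_field_derivative f') (at x within S)"
  shows "((\<lambda>x. ee (f x)) has_field_derivative ee (f x) * (2 * of_real pi * \<i> * f')) (at x within S)"
  unfolding ee_def by (auto intro!: derivative_eq_intros assms)

section \<open>The theta function: quasi-periods, zeros, uniqueness\<close>

text \<open>Jacobi's first theta function without its factors that depend on \<tau> alone; the
  factor \<open>ee (- u / 2)\<close> makes it odd.\<close>

definition theta :: "complex \<Rightarrow> complex \<Rightarrow> complex" where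
  "theta \<tau> u = ee (- u / 2) * qpoch (ee u) (ee \<tau>) * qpoch (ee (\<tau> - u)) (ee \<tau>)"

lemma theta_eq:
  assumes "Im \<tau> > 0"
  shows "theta \<tau> u = (ee (- u / 2) - ee (u / 2)) * (qpoch (ee (\<tau> + u)) (ee \<tau>) * qpoch (ee (\<tau> - u)) (ee \<tau>))"
proof -
  have "qpoch (ee u) (ee \<tau>) = (1 - ee u) * qpoch (ee u * ee \<tau>) (ee \<tau>)"
    by (rule qpoch_rec) (simp add: norm_ee_less_1 assms)
  moreover have "ee u * ee \<tau> = ee (\<tau> + u)"
    by (simp add: ee_add)
  moreover have "ee (- u / 2) * (1 - ee u) = ee (- u / 2) - ee (u / 2)"
    by (simp add: ring_distribs flip: ee_add)
  ultimately show ?thesis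
    unfolding theta_def by (simp only: mult.assoc [symmetric])
qed

lemma theta_minus:
  assumes "Im \<tau> > 0"
  shows "theta \<tau> (- u) = - theta \<tau> u"
  by (simp add: theta_eq assms algebra_simps)

lemma theta_add_1:
  "theta \<tau> (u + 1) = - theta \<tau> u"
proof -
  have "ee (- (u + 1) / 2) = - ee (- u / 2)"
    using ee_diff[of "- u / 2" "1 / 2"] by (simp add: ee_half diff_divide_distrib)
  moreover have "ee (\<tau> - (u + 1)) = ee (\<tau> - u)"
    using ee_diff[of "\<tau> - u" 1] by (simp add: diff_diff_eq)
  ultimately show ?thesis
    by (simp add: theta_def ee_add)
qed

lemma theta_add_tau:
  assumes "Im \<tau> > 0"
  shows "theta \<tau> (u + \<tau>) = - ee (- u - \<tau> / 2) * theta \<tau> u"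
proof -
  let ?q = "ee \<tau>"
  have q: "norm ?q < 1" by (simp add: norm_ee_less_1 assms)
  have r1: "qpoch (ee u) ?q = (1 - ee u) * qpoch (ee (u + \<tau>)) ?q"
    using qpoch_rec[OF q, of "ee u"] by (simp add: ee_add)
  have r2: "qpoch (ee (- u)) ?q = (1 - ee (- u)) * qpoch (ee (\<tau> - u)) ?q"
    using qpoch_rec[OF q, of "ee (- u)"] by (simp add: ee_add ee_diff ee_minus divide_inverse mult_ac)
  have "theta \<tau> (u + \<tau>) = ee (- (u + \<tau>) / 2) * qpoch (ee (u + \<tau>)) ?q * ((1 - ee (- u)) * qpoch (ee (\<tau> - u)) ?q)"
    by (simp add: theta_def r2)
  also have "\<dots> = - ee (- u - \<tau> / 2) * (ee (- u / 2) * ((1 - ee u) * qpoch (ee (u + \<tau>)) ?q) * qpoch (ee (\<tau> - u)) ?q)"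
  proof -
    have "ee (- (u + \<tau>) / 2) * (1 - ee (- u)) = - ee (- u - \<tau> / 2) * ee (- u / 2) * (1 - ee u)"
      by (simp add: ring_distribs add_divide_distrib diff_divide_distrib flip: ee_add)
    then have "ee (- (u + \<tau>) / 2) * (1 - ee (- u)) * (qpoch (ee (u + \<tau>)) ?q * qpoch (ee (\<tau> - u)) ?q) =
      - ee (- u - \<tau> / 2) * ee (- u / 2) * (1 - ee u) * (qpoch (ee (u + \<tau>)) ?q * qpoch (ee (\<tau> - u)) ?q)"
      by (rule arg_cong)
    then show ?thesis by (simp only: mult_ac)
  qed
  finally show ?thesis
    by (simp add: theta_def r1)
qed

lemma theta_0 [simp]: "Im \<tau> > 0 \<Longrightarrow> theta \<tau> 0 = 0"
  by (simp add: theta_eq)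

lemma theta_eq_0D:
  assumes "Im \<tau> > 0" "theta \<tau> u = 0"
  shows "\<exists>m n::int. u = of_int m * \<tau> + of_int n"
proof -
  have q: "norm (ee \<tau>) < 1" by (simp add: norm_ee_less_1 assms)
  from assms(2) have "qpoch (ee u) (ee \<tau>) = 0 \<or> qpoch (ee (\<tau> - u)) (ee \<tau>) = 0"
    by (simp add: theta_def)
  then show ?thesis
  proof
    assume "qpoch (ee u) (ee \<tau>) = 0"
    then obtain n where "ee u * ee \<tau> ^ n = 1"
      using qpoch_nonzero[OF q] by blast
    then have "u + of_nat n * \<tau> \<in> \<int>"
      by (simp add: ee_power ee_eq_1_iff flip: ee_add)
    then obtain k :: int where "u + of_nat n * \<tau> = of_int k"
      by (auto simp: Ints_def)
    then have "u = of_int (- int n) * \<tau> + of_int k" by (simp add: algebra_simps)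
    then show ?thesis by blast
  next
    assume "qpoch (ee (\<tau> - u)) (ee \<tau>) = 0"
    then obtain n where "ee (\<tau> - u) * ee \<tau> ^ n = 1"
      using qpoch_nonzero[OF q] by blast
    then have "\<tau> - u + of_nat n * \<tau> \<in> \<int>"
      by (simp add: ee_power ee_eq_1_iff flip: ee_add)
    then obtain k :: int where "\<tau> - u + of_nat n * \<tau> = of_int k"
      by (auto simp: Ints_def)
    then have "u = of_int (1 + int n) * \<tau> + of_int (- k)" by (simp add: algebra_simps)
    then show ?thesis by blast
  qed
qed

lemma holomorphic_theta:
  assumes "open S" "t holomorphic_on S" "u holomorphic_on S" "\<And>x. x \<in> S \<Longrightarrow> Im (t x) > 0"
  shows "(\<lambda>x. theta (t x) (u x)) holomorphic_on S"
  unfolding theta_def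
  by (intro holomorphic_intros holomorphic_qpoch assms) (auto simp: norm_ee_less_1 assms)

lemma theta_deriv_0:
  assumes "Im \<tau> > 0"
  obtains d where "d \<noteq> 0" "(theta \<tau> has_field_derivative d) (at 0)"
proof -
  define H where "H = (\<lambda>u. qpoch (ee (\<tau> + u)) (ee \<tau>) * qpoch (ee (\<tau> - u)) (ee \<tau>))"
  have "H holomorphic_on UNIV"
    unfolding H_def by (intro holomorphic_intros holomorphic_qpoch) (auto simp: norm_ee_less_1 assms)
  then obtain H' where H': "(H has_field_derivative H') (at 0)"
    by (meson UNIV_I field_differentiable_def holomorphic_on_imp_differentiable_at open_UNIV)
  have "qpoch (ee \<tau>) (ee \<tau>) \<noteq> 0"
  proof (rule qpoch_nonzero)
    show "ee \<tau> * ee \<tau> ^ n \<noteq> 1" for n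
    proof
      assume "ee \<tau> * ee \<tau> ^ n = 1"
      then have "norm (ee \<tau>) ^ Suc n = 1" by (metis norm_one norm_power power_Suc)
      then show False
        using norm_ee_less_1[OF assms] power_Suc_less_one[of "norm (ee \<tau>)" n] by (simp add: norm_ee)
    qed
  qed (simp add: norm_ee_less_1 assms)
  then have "H 0 \<noteq> 0" by (simp add: H_def)
  have "theta \<tau> = (\<lambda>u. (ee (- u / 2) - ee (u / 2)) * H u)"
    by (auto simp: theta_eq assms H_def)
  moreover have "((\<lambda>u. (ee (- u / 2) - ee (u / 2)) * H u) has_field_derivative - (2 * of_real pi * \<i>) * H 0) (at 0)"
    by (auto intro!: derivative_eq_intros H')
  ultimately show ?thesis
    using that[of "- (2 * of_real pi * \<i>) * H 0"] \<open>H 0 \<noteq> 0\<close> by simp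
qed

lemma periodic_int_shift:
  fixes f :: "complex \<Rightarrow> complex"
  assumes "\<And>u. f (u + p) = f u"
  shows "f (u + of_int m * p) = f u"
proof -
  have nat: "f (u + of_nat n * p) = f u" for n u
  proof (induction n)
    case (Suc n)
    then show ?case using assms[of "u + of_nat n * p"] by (simp add: algebra_simps)
  qed simp
  show ?thesis
  proof (cases "m \<ge> 0")
    case True
    then show ?thesis using nat[of u "nat m"] by simp
  next
    case False
    then show ?thesis using nat[of "u + of_int m * p" "nat (- m)"] by simp
  qed
qed

lemma elliptic_entire_constant:
  assumes t: "Im \<tau> > 0" and hol: "g holomorphic_on UNIV"
    and p1: "\<And>u. g (u + 1) = g u" and pt: "\<And>u. g (u + \<tau>) = g u"
  obtains C where "\<And>u. g u = C"
proof -
  define K where "K = (\<lambda>(x, y). of_real x * \<tau> + of_real y) ` ({0..1::real} \<times> {0..1::real})"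
  have "compact K" unfolding K_def
    by (intro compact_continuous_image compact_Times compact_Icc)
      (auto simp: case_prod_unfold intro!: continuous_intros)
  have "g u \<in> g ` K" for u
  proof -
    define a b where "a = Im u / Im \<tau>" and "b = Re u - a * Re \<tau>"
    have u: "u = of_real a * \<tau> + of_real b"
      using t by (simp add: complex_eq_iff a_def b_def)
    have "g u = g (of_real (frac a) * \<tau> + of_real (frac b) + of_int \<lfloor>b\<rfloor> * 1 + of_int \<lfloor>a\<rfloor> * \<tau>)"
      unfolding u by (rule arg_cong[of _ _ g]) (simp add: frac_def algebra_simps)
    also have "\<dots> = g (of_real (frac a) * \<tau> + of_real (frac b))"
      by (simp only: periodic_int_shift[of g, OF p1] periodic_int_shift[of g, OF pt])
    also have "\<dots> \<in> g ` K"
      unfolding K_def by (intro imageI) (auto intro!: image_eqI[of _ _ "(frac a, frac b)"] simp: frac_lt_1 less_imp_le)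
    finally show ?thesis .
  qed
  then have "range g \<subseteq> g ` K" by blast
  moreover have "compact (g ` K)"
    using \<open>compact K\<close> hol
    by (intro compact_continuous_image) (auto intro: holomorphic_on_imp_continuous_on holomorphic_on_subset)
  ultimately have "bounded (range g)"
    using bounded_subset compact_imp_bounded by blast
  with Liouville_theorem[OF hol] show ?thesis
    using that by (auto simp: constant_on_def)
qed

text \<open>\<open>N\<close> and \<open>theta\<close> have the same multipliers, so their quotient
  is elliptic. The zeros of \<open>theta\<close> are simple and lie on the lattice, where
  \<open>N\<close> vanishes too because \<open>N 0 = 0\<close> propagates. The quotient thus extends
  to an entire elliptic function, a constant.\<close>

lemma theta_quasi_unique:
  assumes t: "Im \<tau> > 0" and N: "N holomorphic_on UNIV" and N0: "N 0 = 0"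
    and N1: "\<And>u. N (u + 1) = - N u" and Nt: "\<And>u. N (u + \<tau>) = - ee (- u - \<tau> / 2) * N u"
  obtains C where "\<And>u. N u = C * theta \<tau> u"
proof -
  let ?\<theta> = "theta \<tau>"
  have hol\<theta>: "?\<theta> holomorphic_on UNIV"
    by (intro holomorphic_theta holomorphic_intros) (auto simp: t)
  obtain d where d: "d \<noteq> 0" "(?\<theta> has_field_derivative d) (at 0)"
    using theta_deriv_0[OF t] by blast
  obtain n where n: "(N has_field_derivative n) (at 0)"
    using N by (meson UNIV_I field_differentiable_def holomorphic_on_imp_differentiable_at open_UNIV)
  have lim\<theta>: "(\<lambda>u. ?\<theta> u / u) \<midarrow>0\<rightarrow> d" and limN: "(\<lambda>u. N u / u) \<midarrow>0\<rightarrow> n"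
    using d(2) n by (simp_all add: DERIV_def t N0)
  \<comment> \<open>\<open>n / d\<close> is the limit of the quotient at 0, read off from the
    derivatives. Periodicity carries it to every lattice point, so only the singularity at 0 has to
    be removed.\<close>
  define g where "g = (\<lambda>u. if ?\<theta> u = 0 then n / d else N u / ?\<theta> u)"
  have g1: "g (u + 1) = g u" for u
    by (simp add: g_def theta_add_1 N1)
  have gt: "g (u + \<tau>) = g u" for u
    by (simp add: g_def theta_add_tau t Nt)
  have shift: "g (u + (of_int m * \<tau> + of_int k)) = g u" for u m k
    using periodic_int_shift[of g 1 "u + of_int m * \<tau>" k, OF g1] periodic_int_shift[of g \<tau> u m, OF gt]
    by (simp add: add.assoc)
  have zero: "?\<theta> (of_int m * \<tau> + of_int k) = 0" for m k
  proof -
    \<comment> \<open>\<open>theta\<close> is only quasi-periodic, but the indicator of its zero set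
      is truly periodic.\<close>
    define z where "z = (\<lambda>u. if ?\<theta> u = 0 then 1 else 0 :: complex)"
    have "z (u + 1) = z u" "z (u + \<tau>) = z u" for u
      by (simp_all add: z_def theta_add_1 theta_add_tau t)
    then have "z (0 + of_int m * \<tau> + of_int k * 1) = z 0"
      by (simp only: periodic_int_shift[of z 1] periodic_int_shift[of z \<tau>])
    then show ?thesis by (auto simp: z_def t split: if_splits)
  qed
  have "open {u. ?\<theta> u \<noteq> 0}"
    using hol\<theta> by (intro open_Collect_neq holomorphic_on_imp_continuous_on) auto
  have "(\<lambda>u. N u / ?\<theta> u) holomorphic_on {u. ?\<theta> u \<noteq> 0}"
    using N hol\<theta> by (intro holomorphic_intros) (auto intro: holomorphic_on_subset)
  then have holg: "g holomorphic_on {u. ?\<theta> u \<noteq> 0}"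
    by (rule holomorphic_transform) (simp add: g_def)
  have "\<forall>\<^sub>F u in at 0. ?\<theta> u / u \<noteq> 0"
    using tendsto_imp_eventually_ne[OF lim\<theta> d(1)] .
  then obtain r where r: "r > 0" "\<And>u. u \<noteq> 0 \<Longrightarrow> dist u 0 < r \<Longrightarrow> ?\<theta> u \<noteq> 0"
    unfolding eventually_at by auto
  have "g \<midarrow>0\<rightarrow> n / d"
  proof (rule Lim_transform_eventually)
    show "(\<lambda>u. (N u / u) / (?\<theta> u / u)) \<midarrow>0\<rightarrow> n / d"
      by (intro tendsto_divide limN lim\<theta> d)
    show "\<forall>\<^sub>F u in at 0. N u / u / (?\<theta> u / u) = g u"
      using r unfolding eventually_at g_def by (intro exI[of _ r]) auto
  qed
  then have "isCont g 0"
    by (simp add: isCont_def g_def t)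
  have "g holomorphic_on ball 0 r"
  proof (rule no_isolated_singularity)
    show hol': "g holomorphic_on ball 0 r - {0}"
      by (rule holomorphic_on_subset[OF holg]) (use r in \<open>auto simp: dist_commute\<close>)
    have "continuous (at u) g" if "u \<in> ball 0 r" for u
    proof (cases "u = 0")
      case False
      then show ?thesis
        using hol' that by (meson Diff_iff empty_iff field_differentiable_imp_continuous_at
          holomorphic_on_imp_differentiable_at insert_iff open_ball open_delete)
    qed (use \<open>isCont g 0\<close> in simp)
    then show "continuous_on (ball 0 r) g"
      by (simp add: continuous_at_imp_continuous_on)
  qed auto
  then have g0: "g field_differentiable at 0"
    using r holomorphic_on_imp_differentiable_at by (metis centre_in_ball open_ball)
  have "g field_differentiable at u" for u
  proof (cases "?\<theta> u = 0")
    case False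
    then show ?thesis
      using holg \<open>open {u. ?\<theta> u \<noteq> 0}\<close> holomorphic_on_imp_differentiable_at by blast
  next
    case True
    then obtain m k :: int where u: "u = of_int m * \<tau> + of_int k"
      using theta_eq_0D[OF t] by blast
    have "g = g \<circ> (\<lambda>v. v - u)"
      using shift[of "v - u" m k for v] by (auto simp: u fun_eq_iff)
    moreover have "(g \<circ> (\<lambda>v. v - u)) field_differentiable at u"
      using g0 by (intro field_differentiable_compose) (auto intro!: derivative_intros)
    ultimately show ?thesis by simp
  qed
  then have "g holomorphic_on UNIV"
    by (simp add: holomorphic_on_def field_differentiable_at_within)
  then obtain C where C: "\<And>u. g u = C"
    using elliptic_entire_constant[OF t _ g1 gt] by blast
  have N_zero: "N u = 0" if z0: "?\<theta> u = 0" for u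
  proof -
    obtain m k :: int where u: "u = of_int m * \<tau> + of_int k"
      using theta_eq_0D[OF t z0] by blast
    define z where "z = (\<lambda>u. if N u = 0 then 1 else 0 :: complex)"
    have "z (u + 1) = z u" "z (u + \<tau>) = z u" for u
      by (simp_all add: z_def N1 Nt)
    then have "z (0 + of_int m * \<tau> + of_int k * 1) = z 0"
      by (simp only: periodic_int_shift[of z 1] periodic_int_shift[of z \<tau>])
    then show ?thesis by (auto simp: u z_def N0 split: if_splits)
  qed
  have "N u = C * ?\<theta> u" for u
    using C[of u] N_zero[of u] by (cases "?\<theta> u = 0") (auto simp: g_def field_simps)
  then show ?thesis using that by blast
qed

section \<open>Inversion and Klein forms\<close>

lemma Im_neg_inverse:
  assumes "Im \<tau> > 0"
  shows "Im (- 1 / \<tau>) = Im \<tau> / (norm \<tau>)\<^sup>2"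
  by (simp add: Im_divide cmod_power2)

lemma Im_neg_inverse_pos:
  assumes "Im \<tau> > 0"
  shows "Im (- 1 / \<tau>) > 0"
proof -
  have "\<tau> \<noteq> 0" using assms by auto
  then show ?thesis unfolding Im_neg_inverse[OF assms] using assms by simp
qed

text \<open>Multiplied by a Gaussian, the pulled-back theta function has the quasi-periods of
  \<open>theta \<tau>\<close> and vanishes at 0, so uniqueness applies. The value of
  \<open>C\<close> is left open; its modulus is found later from half periods.\<close>

lemma theta_inversion:
  assumes t: "Im \<tau> > 0"
  obtains C where "C \<noteq> 0" "\<And>u. theta (- 1 / \<tau>) (u / \<tau>) = C * ee (u\<^sup>2 / (2 * \<tau>)) * theta \<tau> u"
proof -
  have \<tau>0: "\<tau> \<noteq> 0" using t by auto
  define s where "s = - 1 / \<tau>"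
  have s: "Im s > 0" unfolding s_def by (rule Im_neg_inverse_pos[OF t])
  define N where "N = (\<lambda>u. theta s (u / \<tau>) * ee (- (u\<^sup>2) / (2 * \<tau>)))"
  have N: "N holomorphic_on UNIV"
    unfolding N_def by (intro holomorphic_intros holomorphic_theta) (auto simp: s \<tau>0)
  have N1: "N (u + 1) = - N u" for u
  proof -
    have "theta s (u / \<tau> - s + s) = - ee (- (u / \<tau> - s) - s / 2) * theta s (u / \<tau> - s)"
      by (rule theta_add_tau[OF s])
    moreover have "u / \<tau> - s = (u + 1) / \<tau>"
      by (simp add: s_def add_divide_distrib)
    ultimately have *: "theta s (u / \<tau>) = - ee (- ((u + 1) / \<tau>) - s / 2) * theta s ((u + 1) / \<tau>)"
      by (metis diff_add_cancel)
    have "ee (- (u\<^sup>2) / (2 * \<tau>)) * ee (- ((u + 1) / \<tau>) - s / 2) = ee (- ((u + 1)\<^sup>2) / (2 * \<tau>))"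
      unfolding ee_add[symmetric] s_def using \<tau>0
      by (intro arg_cong[of _ _ ee]) (simp add: field_simps power2_eq_square)
    then show ?thesis unfolding N_def * by (simp add: mult_ac)
  qed
  have Nt: "N (u + \<tau>) = - ee (- u - \<tau> / 2) * N u" for u
  proof -
    have "theta s ((u + \<tau>) / \<tau>) = - theta s (u / \<tau>)"
      using theta_add_1[of s "u / \<tau>"] \<tau>0 by (simp add: add_divide_distrib)
    moreover have "ee (- u - \<tau> / 2) * ee (- (u\<^sup>2) / (2 * \<tau>)) = ee (- ((u + \<tau>)\<^sup>2) / (2 * \<tau>))"
      unfolding ee_add[symmetric] using \<tau>0
      by (intro arg_cong[of _ _ ee]) (simp add: field_simps power2_eq_square)
    ultimately show ?thesis unfolding N_def by (simp add: mult_ac)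
  qed
  obtain C where C: "\<And>u. N u = C * theta \<tau> u"
    using theta_quasi_unique[OF t N _ N1 Nt] s by (auto simp: N_def)
  have *: "theta s (u / \<tau>) = C * ee (u\<^sup>2 / (2 * \<tau>)) * theta \<tau> u" for u
  proof -
    have "theta s (u / \<tau>) = ee (u\<^sup>2 / (2 * \<tau>)) * N u"
      unfolding N_def by (simp add: ee_minus)
    then show ?thesis by (simp add: C)
  qed
  \<comment> \<open>At \<open>u = \<tau> / 2\<close> the left-hand argument is 1/2, which is not a
    lattice point.\<close>
  have "C \<noteq> 0"
  proof
    assume "C = 0"
    then have "theta s (1 / 2) = 0" using *[of "\<tau> / 2"] \<tau>0 by simp
    then obtain m k :: int where mk: "1 / 2 = of_int m * s + (of_int k :: complex)"
      using theta_eq_0D[OF s] by blast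
    from arg_cong[OF mk, of Im] have "m = 0"
      using s by simp
    with mk have "of_int (2 * k) = (of_int 1 :: complex)" by (simp add: mult.commute)
    then have "2 * k = 1" by (simp only: of_int_eq_iff)
    then show False by presburger
  qed
  then show ?thesis using that[of C] * by (simp add: s_def)
qed

text \<open>
  The exponential factor makes both generators of the modular group act on \<open>(a, b)\<close> linearly and
  without roots of unity.
\<close>

definition klein :: "complex \<Rightarrow> complex \<Rightarrow> complex \<Rightarrow> complex" where
  "klein a b \<tau> = ee (a * (a * \<tau> + b) / 2) * theta \<tau> (a * \<tau> + b)"

lemma klein_minus:
  assumes "Im \<tau> > 0"
  shows "klein (- a) (- b) \<tau> = - klein a b \<tau>"
  using theta_minus[OF assms, of "a * \<tau> + b"] by (simp add: klein_def algebra_simps)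

lemma klein_add_int:
  assumes t: "Im \<tau> > 0"
  shows "klein (a + of_int m) (b + of_int n) \<tau> =
    ee ((of_int m + of_int n + of_int m * of_int n + a * of_int n - b * of_int m) / 2) * klein a b \<tau>"
proof -
  \<comment> \<open>The prefactor absorbs the multiplier of \<open>b\<close> to
    \<open>b + 1\<close>, sign included, so that \<open>f\<close> is strictly periodic in
    \<open>b\<close>; \<open>g\<close> below does the same for \<open>a\<close>.\<close>
  define f where "f = (\<lambda>a b. ee (- ((1 + a) * b / 2)) * klein a b \<tau>)"
  have "f a (b + 1) = f a b" for a b
  proof -
    have *: "theta \<tau> (a * \<tau> + (b + 1)) = - theta \<tau> (a * \<tau> + b)"
      using theta_add_1[of \<tau> "a * \<tau> + b"] by (simp add: add.assoc)
    have "ee (- ((1 + a) * (b + 1) / 2) + a * (a * \<tau> + (b + 1)) / 2) =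
        ee (- ((1 + a) * b / 2) + a * (a * \<tau> + b) / 2 - 1 / 2)"
      by (intro arg_cong[of _ _ ee]) (simp add: field_simps)
    then have "ee (- ((1 + a) * (b + 1) / 2)) * ee (a * (a * \<tau> + (b + 1)) / 2) =
        - (ee (- ((1 + a) * b / 2)) * ee (a * (a * \<tau> + b) / 2))"
      by (simp only: ee_add ee_diff ee_half) simp
    then show ?thesis
      unfolding f_def klein_def * by (simp add: mult.assoc[symmetric])
  qed
  then have fn: "f a (b + of_int n * 1) = f a b" for a b
    by (rule periodic_int_shift)
  have b: "klein a (b + of_int n) \<tau> = ee ((1 + a) * of_int n / 2) * klein a b \<tau>" for a b
  proof -
    have "klein a (b + of_int n) \<tau> = ee ((1 + a) * (b + of_int n) / 2) * f a (b + of_int n * 1)"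
      by (simp add: f_def ee_minus)
    also have "\<dots> = ee ((1 + a) * (b + of_int n) / 2 + - ((1 + a) * b / 2)) * klein a b \<tau>"
      unfolding fn unfolding f_def by (simp only: ee_add mult.assoc)
    also have "(1 + a) * (b + of_int n) / 2 + - ((1 + a) * b / 2) = (1 + a) * of_int n / 2"
      by (simp add: field_simps)
    finally show ?thesis .
  qed
  define g where "g = (\<lambda>b a. ee (- ((1 - b) * a / 2)) * klein a b \<tau>)"
  have "g b (a + 1) = g b a" for a b
  proof -
    have *: "theta \<tau> ((a + 1) * \<tau> + b) = - ee (- (a * \<tau> + b) - \<tau> / 2) * theta \<tau> (a * \<tau> + b)"
      using theta_add_tau[OF t, of "a * \<tau> + b"] by (simp add: algebra_simps)
    have "ee (- ((1 - b) * (a + 1) / 2) + (a + 1) * ((a + 1) * \<tau> + b) / 2 + (- (a * \<tau> + b) - \<tau> / 2)) =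
        ee (- ((1 - b) * a / 2) + a * (a * \<tau> + b) / 2 - 1 / 2)"
      by (intro arg_cong[of _ _ ee]) (simp add: field_simps)
    then have "ee (- ((1 - b) * (a + 1) / 2)) * ee ((a + 1) * ((a + 1) * \<tau> + b) / 2) * ee (- (a * \<tau> + b) - \<tau> / 2) =
        - (ee (- ((1 - b) * a / 2)) * ee (a * (a * \<tau> + b) / 2))"
      by (simp only: ee_add ee_diff ee_half) simp
    then show ?thesis
      unfolding g_def klein_def * by (simp add: mult.assoc[symmetric])
  qed
  then have gm: "g b (a + of_int m * 1) = g b a" for a b
    by (rule periodic_int_shift)
  have a: "klein (a + of_int m) b \<tau> = ee ((1 - b) * of_int m / 2) * klein a b \<tau>" for a b
  proof -
    have "klein (a + of_int m) b \<tau> = ee ((1 - b) * (a + of_int m) / 2) * g b (a + of_int m * 1)"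
      by (simp add: g_def ee_minus)
    also have "\<dots> = ee ((1 - b) * (a + of_int m) / 2 + - ((1 - b) * a / 2)) * klein a b \<tau>"
      unfolding gm unfolding g_def by (simp only: ee_add mult.assoc)
    also have "(1 - b) * (a + of_int m) / 2 + - ((1 - b) * a / 2) = (1 - b) * of_int m / 2"
      by (simp add: field_simps)
    finally show ?thesis .
  qed
  show ?thesis
    unfolding b a mult.assoc[symmetric] ee_add[symmetric]
    by (intro arg_cong2[of _ _ _ _ "(*)"] arg_cong[of _ _ ee] refl) (simp add: field_simps)
qed

lemma klein_T: "klein a b (\<tau> + 1) = klein a (a + b) \<tau>"
proof -
  have "ee (\<tau> + 1 - u) = ee (\<tau> - u)" "ee (\<tau> + 1) = ee \<tau>" for u
    by (simp_all add: ee_add ee_diff)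
  then show ?thesis
    by (simp add: klein_def theta_def algebra_simps)
qed

lemma klein_S:
  assumes t: "Im \<tau> > 0"
  obtains C where "C \<noteq> 0" "\<And>a b. klein a b (- 1 / \<tau>) = C * klein b (- a) \<tau>"
proof -
  have \<tau>0: "\<tau> \<noteq> 0" using t by auto
  obtain C where C: "C \<noteq> 0"
    "\<And>u. theta (- 1 / \<tau>) (u / \<tau>) = C * ee (u\<^sup>2 / (2 * \<tau>)) * theta \<tau> u"
    using theta_inversion[OF t] by blast
  have "klein a b (- 1 / \<tau>) = C * klein b (- a) \<tau>" for a b
  proof -
    have u: "a * (- 1 / \<tau>) + b = (b * \<tau> + - a) / \<tau>"
      using \<tau>0 by (simp add: field_simps)
    have "ee (a * ((b * \<tau> + - a) / \<tau>) / 2) * ee ((b * \<tau> + - a)\<^sup>2 / (2 * \<tau>)) = ee (b * (b * \<tau> + - a) / 2)"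
      unfolding ee_add[symmetric] using \<tau>0
      by (intro arg_cong[of _ _ ee]) (simp add: field_simps power2_eq_square)
    then show ?thesis
      unfolding klein_def u C(2) by (simp add: mult_ac)
  qed
  with C(1) show ?thesis using that by blast
qed

lemma klein_nonzero:
  assumes t: "Im \<tau> > 0" and "a \<in> \<real>" "b \<in> \<real>" "\<not> (a \<in> \<int> \<and> b \<in> \<int>)"
  shows "klein a b \<tau> \<noteq> 0"
proof
  assume "klein a b \<tau> = 0"
  then have "theta \<tau> (a * \<tau> + b) = 0" by (simp add: klein_def)
  then obtain m n :: int where mn: "a * \<tau> + b = of_int m * \<tau> + of_int n"
    using theta_eq_0D[OF t] by blast
  obtain x y where xy: "a = of_real x" "b = of_real y"
    using assms(2,3) by (auto elim!: Reals_cases)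
  from arg_cong[OF mn, of Im] have "x = of_int m" using t by (simp add: xy)
  moreover from arg_cong[OF mn, of Re] this have "y = of_int n" by (simp add: xy)
  ultimately show False using assms(4) by (simp add: xy)
qed

lemma holomorphic_klein: "klein a b holomorphic_on {\<tau>. Im \<tau> > 0}"
  unfolding klein_def
  by (intro holomorphic_intros holomorphic_theta open_halfspace_Im_gt) auto

section \<open>The modulus of the inversion factor\<close>

lemma qpoch_split:
  assumes q: "norm q < 1" and m: "m > 0"
  shows "qpoch z q = (\<Prod>i<m. qpoch (z * q ^ i) (q ^ m))"
proof -
  have qm: "norm (q ^ m) < 1"
    using q m by (simp add: norm_power power_less_one_iff)
  have "(\<lambda>N. \<Prod>i<m. \<Prod>n<N. 1 - z * q ^ i * (q ^ m) ^ n) \<longlonglongrightarrow> (\<Prod>i<m. qpoch (z * q ^ i) (q ^ m))"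
    by (intro tendsto_prod qpoch_tendsto qm)
  also have "(\<lambda>N. \<Prod>i<m. \<Prod>n<N. 1 - z * q ^ i * (q ^ m) ^ n) = (\<lambda>N. \<Prod>n<N*m. 1 - z * q ^ n)"
  proof
    fix N
    have "(\<Prod>n<N*m. 1 - z * q ^ n) = (\<Prod>n<N. \<Prod>i\<in>{n*m..<n*m+m}. 1 - z * q ^ i)"
      by (rule prod.nat_group[symmetric])
    also have "\<dots> = (\<Prod>n<N. \<Prod>i<m. 1 - z * q ^ i * (q ^ m) ^ n)"
    proof (rule prod.cong[OF refl])
      fix n
      show "(\<Prod>i\<in>{n*m..<n*m+m}. 1 - z * q ^ i) = (\<Prod>i<m. 1 - z * q ^ i * (q ^ m) ^ n)"
        by (rule prod.reindex_bij_witness[of _ "\<lambda>i. n * m + i" "\<lambda>i. i - n * m"])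
          (auto simp: mult_ac simp flip: power_mult power_add)
    qed
    also have "\<dots> = (\<Prod>i<m. \<Prod>n<N. 1 - z * q ^ i * (q ^ m) ^ n)"
      by (rule prod.swap)
    finally show "(\<Prod>i<m. \<Prod>n<N. 1 - z * q ^ i * (q ^ m) ^ n) = (\<Prod>n<N*m. 1 - z * q ^ n)" ..
  qed
  finally have lim: "(\<lambda>N. \<Prod>n<N*m. 1 - z * q ^ n) \<longlonglongrightarrow> (\<Prod>i<m. qpoch (z * q ^ i) (q ^ m))" .
  have "filterlim (\<lambda>N. N * m) sequentially sequentially"
    using m by (intro filterlim_subseq strict_monoI) auto
  from filterlim_compose[OF qpoch_tendsto[OF q, of z] this]
  have "(\<lambda>N. \<Prod>n<N*m. 1 - z * q ^ n) \<longlonglongrightarrow> qpoch z q" .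
  with lim show ?thesis using LIMSEQ_unique by blast
qed

lemma qpoch_mult_minus:
  assumes q: "norm q < 1"
  shows "qpoch z q * qpoch (- z) q = qpoch (z\<^sup>2) (q\<^sup>2)"
proof -
  have q2: "norm (q\<^sup>2) < 1" using q by (simp add: norm_power power_less_one_iff)
  have "(\<lambda>N. (\<Prod>n<N. 1 - z * q ^ n) * (\<Prod>n<N. 1 - (- z) * q ^ n)) \<longlonglongrightarrow> qpoch z q * qpoch (- z) q"
    by (intro tendsto_mult qpoch_tendsto q)
  also have "(\<lambda>N. (\<Prod>n<N. 1 - z * q ^ n) * (\<Prod>n<N. 1 - (- z) * q ^ n)) = (\<lambda>N. \<Prod>n<N. 1 - z\<^sup>2 * (q\<^sup>2) ^ n)"
    by (auto simp flip: prod.distrib intro!: ext prod.cong simp: algebra_simps power2_eq_square power_mult_distrib)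
  finally show ?thesis
    using qpoch_tendsto[OF q2, of "z\<^sup>2"] LIMSEQ_unique by blast
qed

lemma qpoch_power_nonzero:
  assumes q: "norm q < 1" and z: "norm z < 1"
  shows "qpoch z q \<noteq> 0"
proof (rule qpoch_nonzero[OF q])
  fix n
  have "norm (z * q ^ n) \<le> norm z * 1"
    unfolding norm_mult norm_power using q by (intro mult_left_mono power_le_one) auto
  with z show "z * q ^ n \<noteq> 1" by auto
qed

text \<open>Euler's theorem on odd and distinct parts: splitting \<open>qpoch q q\<close> by parity
  and pairing it with \<open>qpoch (- q) q\<close> both produce the nonzero factor
  \<open>qpoch (q\<^sup>2) (q\<^sup>2)\<close>, which cancels.\<close>

lemma qpoch_euler:
  assumes q: "norm q < 1"
  shows "qpoch q (q\<^sup>2) * qpoch (- q) q = 1"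
proof -
  have q2: "norm (q\<^sup>2) < 1" using q by (simp add: norm_power power_less_one_iff)
  have "qpoch q q = qpoch q (q\<^sup>2) * qpoch (q\<^sup>2) (q\<^sup>2)"
    using qpoch_split[OF q, of 2 q] by (simp add: numeral_2_eq_2)
  moreover have "qpoch q q * qpoch (- q) q = qpoch (q\<^sup>2) (q\<^sup>2)"
    by (rule qpoch_mult_minus[OF q])
  ultimately have "qpoch (q\<^sup>2) (q\<^sup>2) * (qpoch q (q\<^sup>2) * qpoch (- q) q - 1) = 0"
    by (simp add: algebra_simps)
  moreover have "qpoch (q\<^sup>2) (q\<^sup>2) \<noteq> 0"
    by (rule qpoch_power_nonzero[OF q2 q2])
  ultimately show ?thesis by simp
qed

text \<open>The infinite products of the three half periods cancel by Euler's identity, leaving a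
  pure power of \<open>q\<close>. This elementary function calibrates the unknown factor in
  \<open>klein_S\<close>.\<close>

lemma norm_klein_half_periods:
  assumes t: "Im \<tau> > 0"
  shows "norm (klein (1/2) 0 \<tau> * klein 0 (1/2) \<tau> * klein (1/2) (1/2) \<tau>) = 2 * exp (pi * Im \<tau> / 2)"
proof -
  define p where "p = ee (\<tau> / 2)"
  have p: "norm p < 1" unfolding p_def by (rule norm_ee_less_1) (use t in simp)
  then have p2: "norm (p\<^sup>2) < 1" by (simp add: norm_power power_less_one_iff)
  have q: "ee \<tau> = p\<^sup>2" by (simp add: p_def ee_power)
  have e1: "ee (\<tau> - \<tau> / 2) = p" by (simp add: p_def)
  have e2: "ee (\<tau> / 2 + 1 / 2) = - p" "ee (\<tau> - (\<tau> / 2 + 1 / 2)) = - p" "ee (\<tau> - 1 / 2) = - (p\<^sup>2)"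
    "ee (\<tau> / 2 - 1 / 2) = - p"
    by (simp_all add: p_def ee_add ee_half diff_add_eq_diff_diff_swap ee_power)
      (simp_all add: ee_diff ee_half add_divide_distrib ee_power flip: ee_add)
  have k1: "norm (klein (1/2) 0 \<tau>) = exp (pi * Im \<tau> / 4) * norm (qpoch p (p\<^sup>2)) ^ 2"
    by (simp add: klein_def theta_def norm_mult q e1 flip: p_def) (simp add: norm_ee power2_eq_square flip: exp_add)
  have k3: "norm (klein (1/2) (1/2) \<tau>) = exp (pi * Im \<tau> / 4) * norm (qpoch (- p) (p\<^sup>2)) ^ 2"
    by (simp add: klein_def theta_def norm_mult q e2) (simp add: norm_ee power2_eq_square flip: exp_add)
  have "qpoch (- 1) (p\<^sup>2) = 2 * qpoch (- (p\<^sup>2)) (p\<^sup>2)"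
    using qpoch_rec[OF p2, of "- 1"] by simp
  then have k2: "norm (klein 0 (1/2) \<tau>) = 2 * norm (qpoch (- (p\<^sup>2)) (p\<^sup>2)) ^ 2"
    by (simp add: klein_def theta_def norm_mult q e2 ee_half) (simp add: norm_ee power2_eq_square)
  have "qpoch p (p\<^sup>2) * qpoch (- p) (p\<^sup>2) * qpoch (- (p\<^sup>2)) (p\<^sup>2) = 1"
    using qpoch_mult_minus[OF p2, of p] qpoch_euler[OF p2] by simp
  then have 1: "norm (qpoch p (p\<^sup>2)) * norm (qpoch (- p) (p\<^sup>2)) * norm (qpoch (- (p\<^sup>2)) (p\<^sup>2)) = 1"
    by (metis norm_mult norm_one)
  have "norm (klein (1/2) 0 \<tau> * klein 0 (1/2) \<tau> * klein (1/2) (1/2) \<tau>) =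
    2 * (exp (pi * Im \<tau> / 4) * exp (pi * Im \<tau> / 4)) *
    (norm (qpoch p (p\<^sup>2)) * norm (qpoch (- p) (p\<^sup>2)) * norm (qpoch (- (p\<^sup>2)) (p\<^sup>2))) ^ 2"
    unfolding norm_mult k1 k2 k3 by (simp add: power_mult_distrib mult_ac)
  then show ?thesis
    unfolding 1 by (simp flip: exp_add)
qed

text \<open>Inversion permutes the three half-period forms up to factors of modulus 1, so comparing
  their products at \<tau> and at \<open>- 1 / \<tau>\<close> determines \<open>norm C ^ 3\<close>.
  The argument of \<open>C\<close> is irrelevant, since the maximum principle sees absolute values
  only.\<close>

lemma norm_klein_S_factor:
  assumes t: "Im \<tau> > 0" and C: "\<And>a b. klein a b (- 1 / \<tau>) = C * klein b (- a) \<tau>"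
  shows "norm C = exp (pi * (Im (- 1 / \<tau>) - Im \<tau>) / 6)"
proof -
  let ?s = "- 1 / \<tau>"
  have s: "Im ?s > 0" by (rule Im_neg_inverse_pos[OF t])
  have m: "norm (klein 0 (- (1/2)) \<tau>) = norm (klein 0 (1/2) \<tau>)"
    using klein_minus[OF t, of 0 "1/2"] by simp
  have m2: "norm (klein (1/2) (- (1/2)) \<tau>) = norm (klein (1/2) (1/2) \<tau>)"
    using klein_add_int[OF t, of "1/2" 0 "- (1/2)" 1] by (simp add: norm_mult norm_ee)
  have "norm C ^ 3 * (2 * exp (pi * Im \<tau> / 2)) = 2 * exp (pi * Im ?s / 2)"
    unfolding norm_klein_half_periods[OF t, symmetric] norm_klein_half_periods[OF s, symmetric]
    unfolding C norm_mult by (simp add: m m2 power3_eq_cube)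
  then have "norm C ^ 3 = exp (pi * Im ?s / 2) / exp (pi * Im \<tau> / 2)"
    by (simp add: field_simps)
  also have "\<dots> = exp (pi * (Im ?s - Im \<tau>) / 6) ^ 3"
    by (simp add: exp_diff[symmetric] exp_of_nat_mult[symmetric] field_simps)
  finally show ?thesis
    by (rule power_eq_imp_eq_base) auto
qed

section \<open>Quotients at 34-torsion points\<close>

definition klein34 :: "int \<Rightarrow> int \<Rightarrow> int \<Rightarrow> complex \<Rightarrow> complex" where
  "klein34 e c d \<tau> = klein (of_int (e * c) / 34) (of_int (e * d) / 34) \<tau>"

definition primitive34 :: "int \<Rightarrow> int \<Rightarrow> bool" where
  "primitive34 c d \<longleftrightarrow> \<not> (2 dvd c \<and> 2 dvd d) \<and> \<not> (17 dvd c \<and> 17 dvd d)"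

lemma klein34_minus: "Im \<tau> > 0 \<Longrightarrow> klein34 (- e) c d \<tau> = - klein34 e c d \<tau>"
  by (simp add: klein34_def klein_minus)

lemma klein34_scale: "klein34 e (u * c) (u * d) \<tau> = klein34 (u * e) c d \<tau>"
  by (simp add: klein34_def mult_ac)

lemma klein34_add_34:
  assumes t: "Im \<tau> > 0"
  shows "klein34 e (c + 34 * u) (d + 34 * v) \<tau> =
    ee (of_int e * of_int (u + v) / 2 + (of_int e)\<^sup>2 * (of_int (34 * u * v + c * v - d * u)) / 68) * klein34 e c d \<tau>"
proof -
  have "klein34 e (c + 34 * u) (d + 34 * v) \<tau> =
    klein (of_int (e * c) / 34 + of_int (e * u)) (of_int (e * d) / 34 + of_int (e * v)) \<tau>"
    by (simp add: klein34_def ring_distribs add_divide_distrib)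
  also have "\<dots> = ee ((of_int (e * u) + of_int (e * v) + of_int (e * u) * of_int (e * v) +
      of_int (e * c) / 34 * of_int (e * v) - of_int (e * d) / 34 * of_int (e * u)) / 2) * klein34 e c d \<tau>"
    unfolding klein_add_int[OF t] klein34_def ..
  also have "(of_int (e * u) + of_int (e * v) + of_int (e * u) * of_int (e * v) +
      of_int (e * c) / 34 * of_int (e * v) - of_int (e * d) / 34 * of_int (e * u)) / 2 =
      of_int e * of_int (u + v) / 2 + (of_int e)\<^sup>2 * (of_int (34 * u * v + c * v - d * u)) / (68 :: complex)"
    by (simp add: field_simps power2_eq_square)
  finally show ?thesis .
qed

text \<open>When \<open>c\<close> and \<open>d\<close> are not both even,
  \<open>l c + l d + l^2 c d\<close> has the parity of \<open>l\<close>. Hence indices modulo 34 may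
  be exchanged at the cost of a sign independent of the vector.\<close>

lemma klein34_shift:
  assumes t: "Im \<tau> > 0" and odd: "\<not> (even c \<and> even d)"
  shows "klein34 (e + 34 * l) c d \<tau> = (if even l then klein34 e c d \<tau> else - klein34 e c d \<tau>)"
proof -
  have "klein34 (e + 34 * l) c d \<tau> =
    klein (of_int (e * c) / 34 + of_int (l * c)) (of_int (e * d) / 34 + of_int (l * d)) \<tau>"
    by (simp add: klein34_def ring_distribs add_divide_distrib)
  then have *: "klein34 (e + 34 * l) c d \<tau> = ee (of_int (l * c + l * d + l * c * (l * d)) / 2) * klein34 e c d \<tau>"
    unfolding klein_add_int[OF t] by (simp add: klein34_def mult_ac)
  have par: "even (l * c + l * d + l * c * (l * d)) \<longleftrightarrow> even l"
    using odd by auto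
  show ?thesis
  proof (cases "even l")
    case True
    then obtain k where "l * c + l * d + l * c * (l * d) = 2 * k" using par by blast
    then show ?thesis using True unfolding * by (simp del: of_int_add of_int_mult add: of_int_mult[of 2])
  next
    case False
    then obtain k where k: "l * c + l * d + l * c * (l * d) = 2 * k + 1" using par oddE by blast
    have "ee (of_int (2 * k + 1) / 2) = ee (of_int k + 1 / 2)"
      by (intro arg_cong[of _ _ ee]) (simp add: field_simps)
    then show ?thesis using False unfolding * k by (simp add: ee_add ee_half)
  qed
qed

lemma klein34_reflect:
  assumes t: "Im \<tau> > 0" and odd: "\<not> (even c \<and> even d)"
  shows "klein34 (34 - e) c d \<tau> = klein34 e c d \<tau>"
  using klein34_shift[OF assms, of "- e" 1] klein34_minus[OF t] by simp

lemma klein34_nonzero: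
  assumes t: "Im \<tau> > 0" and "primitive34 c d" "\<not> 17 dvd e"
  shows "klein34 e c d \<tau> \<noteq> 0"
proof -
  have int: "of_int x / 34 \<in> (\<int> :: complex set) \<longleftrightarrow> 34 dvd x" for x
  proof
    assume "of_int x / 34 \<in> (\<int> :: complex set)"
    then obtain k :: int where "of_int x / 34 = (of_int k :: complex)" by (auto simp: Ints_def)
    then have "of_int x = (of_int (34 * k) :: complex)" by (simp add: field_simps)
    then have "x = 34 * k" by (simp only: of_int_eq_iff)
    then show "34 dvd x" by simp
  qed auto
  have "\<not> (34 dvd e * c \<and> 34 dvd e * d)"
  proof
    assume *: "34 dvd e * c \<and> 34 dvd e * d"
    have "17 dvd (34::int)" by simp
    with * have "17 dvd e * c" "17 dvd e * d" by (meson dvd_trans)+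
    moreover have "prime (17::int)" by simp
    ultimately show False
      using assms(2,3) unfolding primitive34_def by (metis prime_dvd_mult_iff)
  qed
  then show ?thesis
    unfolding klein34_def using t by (intro klein_nonzero) (auto simp: int simp del: of_int_mult)
qed

definition klein34_prod :: "int set \<Rightarrow> int \<Rightarrow> int \<Rightarrow> complex \<Rightarrow> complex" where
  "klein34_prod E c d \<tau> = (\<Prod>e\<in>E. klein34 e c d \<tau>)"

text \<open>
  Up to sign modulo 34, the first set represents the odd quadratic residues modulo 17 and the second
  one all non-residues.
\<close>

definition klein_quot :: "int \<Rightarrow> int \<Rightarrow> complex \<Rightarrow> complex" where
  "klein_quot c d \<tau> = klein34_prod {1, 9, 13, 15} c d \<tau> / klein34_prod {3, 5, 6, 7, 10, 11, 12, 14} c d \<tau>"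

lemma ee_sum: "finite A \<Longrightarrow> ee (sum f A) = (\<Prod>x\<in>A. ee (f x))"
  by (induction rule: finite_induct) (simp_all add: ee_add)

lemma klein34_prod_add_34:
  assumes t: "Im \<tau> > 0" and "finite E"
  shows "klein34_prod E (c + 34 * u) (d + 34 * v) \<tau> =
    ee (of_int (\<Sum>E) * of_int (u + v) / 2 + of_int (\<Sum>e\<in>E. e\<^sup>2) * (of_int (34 * u * v + c * v - d * u)) / 68) * klein34_prod E c d \<tau>"
proof -
  have "klein34_prod E (c + 34 * u) (d + 34 * v) \<tau> =
    ee (\<Sum>e\<in>E. of_int e * of_int (u + v) / 2 + (of_int e)\<^sup>2 * (of_int (34 * u * v + c * v - d * u)) / 68) * klein34_prod E c d \<tau>"
    unfolding klein34_prod_def klein34_add_34[OF t] prod.distrib ee_sum[OF \<open>finite E\<close>] ..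
  then show ?thesis
    by (simp only: sum.distrib sum_divide_distrib[symmetric] sum_distrib_right[symmetric] of_int_sum of_int_power)
qed

lemma klein_quot_add_34:
  assumes t: "Im \<tau> > 0"
  shows "klein_quot (c + 34 * u) (d + 34 * v) \<tau> = klein_quot c d \<tau>"
proof -
  define x where "x = (of_int (u + v) :: complex)"
  define y where "y = (of_int (34 * u * v + c * v - d * u) :: complex)"
  \<comment> \<open>Here 15 = (68 - 38) / 2 and 3 = (680 - 476) / 68, from the sums of the elements
    and of the squares of the two index sets. That both are integers is what makes the quotient
    depend on its vector modulo 34 only.\<close>
  define n where "n = 15 * (u + v) + 3 * (34 * u * v + c * v - d * u)"
  have "68 * x / 2 + 680 * y / 68 = 38 * x / 2 + 476 * y / 68 + of_int n"
    by (simp add: x_def y_def n_def field_simps)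
  then have "ee (68 * x / 2 + 680 * y / 68) = ee (38 * x / 2 + 476 * y / 68)"
    by (simp only: ee_add ee_of_int mult_1_right)
  moreover have "klein34_prod {1, 9, 13, 15} (c + 34 * u) (d + 34 * v) \<tau> =
      ee (38 * x / 2 + 476 * y / 68) * klein34_prod {1, 9, 13, 15} c d \<tau>"
    unfolding x_def y_def by (subst klein34_prod_add_34[OF t]) simp_all
  moreover have "klein34_prod {3, 5, 6, 7, 10, 11, 12, 14} (c + 34 * u) (d + 34 * v) \<tau> =
      ee (68 * x / 2 + 680 * y / 68) * klein34_prod {3, 5, 6, 7, 10, 11, 12, 14} c d \<tau>"
    unfolding x_def y_def by (subst klein34_prod_add_34[OF t]) simp_all
  ultimately show ?thesis
    unfolding klein_quot_def by simp
qed

lemma klein_quot_mod: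
  assumes t: "Im \<tau> > 0" and "[c = c'] (mod 34)" "[d = d'] (mod 34)"
  shows "klein_quot c d \<tau> = klein_quot c' d' \<tau>"
proof -
  obtain u v where "c' = c + 34 * u" "d' = d + 34 * v"
    using assms(2,3) by (metis cong_iff_lin)
  then show ?thesis using klein_quot_add_34[OF t] by simp
qed

text \<open>19 is the odd lift of 2 modulo 34 and generates the odd quadratic residues.
  Multiplication by it permutes both index sets up to sign modulo 34, with two sign changes in the
  numerator and five in the denominator.\<close>

lemma klein_quot_scale_19:
  assumes t: "Im \<tau> > 0" and odd: "\<not> (even c \<and> even d)"
  shows "klein_quot (19 * c) (19 * d) \<tau> = - klein_quot c d \<tau>"
proof -
  note s = klein34_shift[OF assms]
  note r = klein34_reflect[OF assms]
  have "klein34 19 c d \<tau> = klein34 15 c d \<tau>" "klein34 171 c d \<tau> = - klein34 1 c d \<tau>" "klein34 247 c d \<tau> = - klein34 9 c d \<tau>"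
    "klein34 285 c d \<tau> = klein34 13 c d \<tau>" "klein34 57 c d \<tau> = - klein34 11 c d \<tau>" "klein34 95 c d \<tau> = klein34 7 c d \<tau>"
    "klein34 114 c d \<tau> = - klein34 12 c d \<tau>" "klein34 133 c d \<tau> = - klein34 3 c d \<tau>" "klein34 190 c d \<tau> = - klein34 14 c d \<tau>"
    "klein34 209 c d \<tau> = klein34 5 c d \<tau>" "klein34 228 c d \<tau> = klein34 10 c d \<tau>" "klein34 266 c d \<tau> = - klein34 6 c d \<tau>"
    using s[of 19 0] s[of 1 5] s[of 9 7] s[of 13 8] s[of 23 1] s[of 27 2] s[of 12 3] s[of 31 3]
      s[of 20 5] s[of 5 6] s[of 24 6] s[of 28 7] r[of 15] r[of 11] r[of 7] r[of 3] r[of 14] r[of 10] r[of 6]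
    by simp_all
  then show ?thesis by (simp add: klein_quot_def klein34_prod_def klein34_scale) (simp add: mult_ac)
qed

text \<open>3 is an odd non-residue, so it exchanges residues and non-residues while preserving
  parity. Together with the odd residues it reaches all units modulo 34.\<close>

lemma klein_quot_scale_3:
  assumes t: "Im \<tau> > 0" and odd: "\<not> (even c \<and> even d)"
  shows "klein_quot (3 * c) (3 * d) \<tau> = klein34_prod {3, 5, 7, 11} c d \<tau> / klein34_prod {1, 2, 4, 8, 9, 13, 15, 16} c d \<tau>"
proof -
  note s = klein34_shift[OF assms]
  note r = klein34_reflect[OF assms]
  have "klein34 27 c d \<tau> = klein34 7 c d \<tau>" "klein34 39 c d \<tau> = - klein34 5 c d \<tau>" "klein34 45 c d \<tau> = - klein34 11 c d \<tau>"
    "klein34 18 c d \<tau> = klein34 16 c d \<tau>" "klein34 21 c d \<tau> = klein34 13 c d \<tau>" "klein34 30 c d \<tau> = klein34 4 c d \<tau>"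
    "klein34 33 c d \<tau> = klein34 1 c d \<tau>" "klein34 36 c d \<tau> = - klein34 2 c d \<tau>" "klein34 42 c d \<tau> = - klein34 8 c d \<tau>"
    using s[of 5 1] s[of 11 1] s[of 2 1] s[of 8 1] r[of 7] r[of 16] r[of 13] r[of 4] r[of 1]
    by simp_all
  then show ?thesis by (simp add: klein_quot_def klein34_prod_def klein34_scale) (simp add: mult_ac)
qed

lemma klein_quot_T: "klein_quot c d (\<tau> + 1) = klein_quot c (c + d) \<tau>"
  by (simp add: klein_quot_def klein34_prod_def klein34_def klein_T add_divide_distrib ring_distribs)

lemma klein_quot_S:
  assumes C: "\<And>a b. klein a b (- 1 / \<tau>) = C * klein b (- a) \<tau>" and "C \<noteq> 0"
  shows "klein_quot c d (- 1 / \<tau>) = klein_quot d (- c) \<tau> / C ^ 4"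
proof -
  have "klein34 e c d (- 1 / \<tau>) = C * klein34 e d (- c) \<tau>" for e
    unfolding klein34_def C by simp
  then have "klein34_prod E c d (- 1 / \<tau>) = C ^ card E * klein34_prod E d (- c) \<tau>" for E
    by (simp add: klein34_prod_def prod.distrib)
  moreover have "C ^ 8 = C ^ 4 * C ^ 4"
    by (simp flip: power_add)
  ultimately show ?thesis
    using \<open>C \<noteq> 0\<close> by (simp add: klein_quot_def) (simp add: power4_eq_xxxx)
qed

lemma holomorphic_klein34_prod: "klein34_prod E c d holomorphic_on {\<tau>. Im \<tau> > 0}"
  unfolding klein34_prod_def klein34_def by (intro holomorphic_intros holomorphic_klein)

lemma klein34_prod_nonzero:
  assumes "Im \<tau> > 0" "primitive34 c d" "finite E" "\<forall>e\<in>E. \<not> 17 dvd e"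
  shows "klein34_prod E c d \<tau> \<noteq> 0"
  unfolding klein34_prod_def using assms klein34_nonzero by auto

lemma holomorphic_klein_quot:
  assumes "primitive34 c d"
  shows "klein_quot c d holomorphic_on {\<tau>. Im \<tau> > 0}"
proof -
  have "klein34_prod {3, 5, 6, 7, 10, 11, 12, 14} c d \<tau> \<noteq> 0" if "\<tau> \<in> {\<tau>. Im \<tau> > 0}" for \<tau>
    by (rule klein34_prod_nonzero) (use that assms in auto)
  then show ?thesis
    unfolding klein_quot_def by (intro holomorphic_intros holomorphic_klein34_prod)
qed

section \<open>Expansions at the cusp\<close>

text \<open>The two Pochhammer factors of \<open>theta\<close> in the parameter
  \<open>x = q^(1/m)\<close>; \<open>x ^ f / s\<close> is \<open>q / (s x^e)\<close> when
  \<open>e + f = m\<close>. At points with first coordinate 0 the factor of exponent 0 is split off,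
  which leaves \<open>e = f = m\<close>.\<close>

definition qpair :: "nat \<Rightarrow> nat \<Rightarrow> nat \<Rightarrow> complex \<Rightarrow> complex \<Rightarrow> complex" where
  "qpair e f m s x = qpoch (s * x ^ e) (x ^ m) * qpoch (x ^ f / s) (x ^ m)"

lemma norm_power_lt_1:
  fixes x :: complex
  assumes "norm x < 1" "m > 0"
  shows "norm (x ^ m) < 1"
  using assms by (simp add: norm_power power_less_one_iff)

lemma qpair_0: "e > 0 \<Longrightarrow> f > 0 \<Longrightarrow> qpair e f m s 0 = 1"
  by (simp add: qpair_def zero_power)

lemma holomorphic_qpair:
  assumes "m > 0"
  shows "qpair e f m s holomorphic_on ball 0 1"
  unfolding qpair_def
  by (cases "s = 0") (auto intro!: holomorphic_intros holomorphic_qpoch norm_power_lt_1 assms)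

lemma qpair_nonzero:
  assumes "m > 0" "e > 0" "f > 0" "norm s = 1" "norm x < 1"
  shows "qpair e f m s x \<noteq> 0"
proof -
  have "norm (s * x ^ e) < 1" "norm (x ^ f / s) < 1"
    using norm_power_lt_1[of x e] norm_power_lt_1[of x f] assms by (simp_all add: norm_mult norm_divide)
  then show ?thesis
    unfolding qpair_def using qpoch_power_nonzero norm_power_lt_1[of x m] assms by simp
qed

lemma klein_expand:
  assumes "m > 0" "e \<le> m"
  shows "klein (of_nat e / of_nat m) b \<tau> =
    ee ((of_nat e / of_nat m - 1) * (of_nat e / of_nat m * \<tau> + b) / 2) * qpair e (m - e) m (ee b) (ee (\<tau> / of_nat m))"
proof -
  let ?u = "of_nat e / of_nat m * \<tau> + b"
  have m0: "of_nat m \<noteq> (0 :: complex)" using assms(1) by simp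
  have 1: "ee b * ee (\<tau> / of_nat m) ^ e = ee ?u"
    by (simp add: ee_power ee_add mult_ac)
  have "ee (\<tau> - ?u) = ee ((of_nat m - of_nat e) * (\<tau> / of_nat m) - b)"
    using m0 by (intro arg_cong[of _ _ ee]) (simp add: field_simps)
  then have 2: "ee (\<tau> / of_nat m) ^ (m - e) / ee b = ee (\<tau> - ?u)"
    using assms(2) by (simp add: ee_power ee_diff of_nat_diff)
  have 3: "ee (\<tau> / of_nat m) ^ m = ee \<tau>"
    using assms(1) by (simp add: ee_power)
  have "ee (of_nat e / of_nat m * ?u / 2) * ee (- ?u / 2) = ee ((of_nat e / of_nat m - 1) * ?u / 2)"
    unfolding ee_add[symmetric] using m0 by (intro arg_cong[of _ _ ee]) (simp add: field_simps)
  then show ?thesis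
    unfolding klein_def theta_def qpair_def 1 2 3 by (simp only: mult.assoc[symmetric])
qed

lemma klein_0_expand:
  assumes "Im \<tau> > 0" "m > 0"
  shows "klein 0 b \<tau> = (ee (- b / 2) - ee (b / 2)) * qpair m m m (ee b) (ee (\<tau> / of_nat m))"
proof -
  have "ee (\<tau> / of_nat m) ^ m = ee \<tau>"
    using assms(2) by (simp add: ee_power)
  then show ?thesis
    unfolding klein_def theta_eq[OF assms(1)] qpair_def by (simp add: ee_add ee_diff mult_ac)
qed

text \<open>The leading exponent of \<open>klein a b\<close> is \<open>a (a - 1) / 2\<close>; at
  \<open>a = e / 34\<close> it has denominator 2312 = 2 * 34^2.\<close>

lemma klein34_prod_1_0:
  assumes "finite E" "E \<subseteq> {1..33}"
  shows "klein34_prod (int ` E) 1 0 \<tau> = ee (((\<Sum>e\<in>E. of_nat (e\<^sup>2)) - 34 * (\<Sum>e\<in>E. of_nat e)) / 2312 * \<tau>) *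
    (\<Prod>e\<in>E. qpair e (34 - e) 34 1 (ee (\<tau> / 34)))"
proof -
  have "klein34_prod (int ` E) 1 0 \<tau> = (\<Prod>e\<in>E. klein34 (int e) 1 0 \<tau>)"
    unfolding klein34_prod_def by (subst prod.reindex) auto
  also have "\<dots> = (\<Prod>e\<in>E. ee ((of_nat (e\<^sup>2) - 34 * of_nat e) / 2312 * \<tau>) * qpair e (34 - e) 34 1 (ee (\<tau> / 34)))"
  proof (rule prod.cong[OF refl])
    fix e assume "e \<in> E"
    then have "e \<le> 34" using assms(2) by auto
    have "klein34 (int e) 1 0 \<tau> = ee ((of_nat e / 34 - 1) * (of_nat e / 34 * \<tau>) / 2) * qpair e (34 - e) 34 1 (ee (\<tau> / 34))"
      using klein_expand[of 34 e 0 \<tau>] \<open>e \<le> 34\<close> by (simp add: klein34_def)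
    also have "(of_nat e / 34 - 1) * (of_nat e / 34 * \<tau>) / 2 = (of_nat (e\<^sup>2) - 34 * of_nat e) / 2312 * \<tau>"
      by (simp add: field_simps power2_eq_square)
    finally show "klein34 (int e) 1 0 \<tau> = ee ((of_nat (e\<^sup>2) - 34 * of_nat e) / 2312 * \<tau>) * qpair e (34 - e) 34 1 (ee (\<tau> / 34))" .
  qed
  also have "\<dots> = ee (\<Sum>e\<in>E. (of_nat (e\<^sup>2) - 34 * of_nat e) / 2312 * \<tau>) * (\<Prod>e\<in>E. qpair e (34 - e) 34 1 (ee (\<tau> / 34)))"
    unfolding prod.distrib ee_sum[OF assms(1)] ..
  also have "(\<Sum>e\<in>E. (of_nat (e\<^sup>2) - 34 * of_nat e) / 2312 * \<tau>) =
      ((\<Sum>e\<in>E. of_nat (e\<^sup>2)) - 34 * (\<Sum>e\<in>E. of_nat e)) / 2312 * \<tau>"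
    unfolding sum_distrib_right[symmetric] sum_divide_distrib[symmetric] sum_subtractf sum_distrib_left[symmetric] ..
  finally show ?thesis .
qed

text \<open>The vector (2, 17) gives \<open>a = e / 17\<close> and \<open>b = e / 2\<close>. The
  exponent \<open>(a - 1) (a \<tau> + b) / 2\<close> then factors with 578 = 2 * 17^2 and 68 = 4 *
  17.\<close>

lemma klein34_prod_2_17:
  assumes "finite E" "E \<subseteq> {1..16}"
  shows "klein34_prod (int ` E) 2 17 \<tau> =
    ee (((\<Sum>e\<in>E. of_nat (e\<^sup>2)) - 17 * (\<Sum>e\<in>E. of_nat e)) * (\<tau> / 578 + 1 / 68)) *
    (\<Prod>e\<in>E. qpair e (17 - e) 17 (ee (of_nat e / 2)) (ee (\<tau> / 17)))"
proof -
  have "klein34_prod (int ` E) 2 17 \<tau> = (\<Prod>e\<in>E. klein34 (int e) 2 17 \<tau>)"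
    unfolding klein34_prod_def by (subst prod.reindex) auto
  also have "\<dots> = (\<Prod>e\<in>E. ee ((of_nat (e\<^sup>2) - 17 * of_nat e) * (\<tau> / 578 + 1 / 68)) *
      qpair e (17 - e) 17 (ee (of_nat e / 2)) (ee (\<tau> / 17)))"
  proof (rule prod.cong[OF refl])
    fix e assume "e \<in> E"
    then have "e \<le> 17" using assms(2) by auto
    have "klein34 (int e) 2 17 \<tau> = klein (of_nat e / 17) (of_nat e / 2) \<tau>"
      by (simp add: klein34_def)
    also have "\<dots> = ee ((of_nat e / 17 - 1) * (of_nat e / 17 * \<tau> + of_nat e / 2) / 2) *
        qpair e (17 - e) 17 (ee (of_nat e / 2)) (ee (\<tau> / 17))"
      using klein_expand[of 17 e "of_nat e / 2" \<tau>] \<open>e \<le> 17\<close> by simp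
    also have "(of_nat e / 17 - 1) * (of_nat e / 17 * \<tau> + of_nat e / 2) / 2 =
        (of_nat (e\<^sup>2) - 17 * of_nat e) * (\<tau> / 578 + 1 / 68)"
      by (simp add: field_simps power2_eq_square)
    finally show "klein34 (int e) 2 17 \<tau> = ee ((of_nat (e\<^sup>2) - 17 * of_nat e) * (\<tau> / 578 + 1 / 68)) *
        qpair e (17 - e) 17 (ee (of_nat e / 2)) (ee (\<tau> / 17))" .
  qed
  also have "\<dots> = ee (\<Sum>e\<in>E. (of_nat (e\<^sup>2) - 17 * of_nat e) * (\<tau> / 578 + 1 / 68)) *
      (\<Prod>e\<in>E. qpair e (17 - e) 17 (ee (of_nat e / 2)) (ee (\<tau> / 17)))"
    unfolding prod.distrib ee_sum[OF assms(1)] ..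
  also have "(\<Sum>e\<in>E. (of_nat (e\<^sup>2) - 17 * of_nat e) * (\<tau> / 578 + 1 / 68)) =
      ((\<Sum>e\<in>E. of_nat (e\<^sup>2)) - 17 * (\<Sum>e\<in>E. of_nat e)) * (\<tau> / 578 + 1 / 68)"
    unfolding sum_distrib_right[symmetric] sum_subtractf sum_distrib_left[symmetric] ..
  finally show ?thesis .
qed

definition quot34 :: "nat set \<Rightarrow> nat set \<Rightarrow> complex \<Rightarrow> complex" where
  "quot34 E F x = (\<Prod>e\<in>E. qpair e (34 - e) 34 1 x) / (\<Prod>e\<in>F. qpair e (34 - e) 34 1 x)"

definition quot17 :: "nat set \<Rightarrow> nat set \<Rightarrow> complex \<Rightarrow> complex" where
  "quot17 E F x = (\<Prod>e\<in>E. qpair e (17 - e) 17 (ee (of_nat e / 2)) x) / (\<Prod>e\<in>F. qpair e (17 - e) 17 (ee (of_nat e / 2)) x)"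

lemma klein34_prod_ratio_1_0:
  assumes E: "finite E" "E \<subseteq> {1..33}" and F: "finite F" "F \<subseteq> {1..33}"
    and n: "int (\<Sum>e\<in>E. e\<^sup>2) - 34 * int (\<Sum>E) - (int (\<Sum>e\<in>F. e\<^sup>2) - 34 * int (\<Sum>F)) = 68 * n"
  shows "klein34_prod (int ` E) 1 0 \<tau> / klein34_prod (int ` F) 1 0 \<tau> = ee (of_int n * \<tau> / 34) * quot34 E F (ee (\<tau> / 34))"
proof -
  define x where "x = (\<lambda>E. (\<Sum>e\<in>E. of_nat (e\<^sup>2)) - 34 * (\<Sum>e\<in>E. of_nat e) :: complex)"
  have "x E - x F = of_int (68 * n)"
    unfolding n[symmetric] by (simp add: x_def)
  then have "x E / 2312 * \<tau> - x F / 2312 * \<tau> = of_int n * \<tau> / 34"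
    by (simp add: field_simps)
  then have "ee (x E / 2312 * \<tau>) / ee (x F / 2312 * \<tau>) = ee (of_int n * \<tau> / 34)"
    unfolding ee_diff[symmetric] by (rule arg_cong)
  then show ?thesis
    unfolding klein34_prod_1_0[OF E] klein34_prod_1_0[OF F] quot34_def x_def
    by (simp only: times_divide_times_eq[symmetric])
qed

text \<open>The constant 1/68 contributes \<open>34 n / 68 = n / 2\<close> to the exponent; for odd
  \<open>n\<close> this is the sign in front.\<close>

lemma klein34_prod_ratio_2_17:
  assumes E: "finite E" "E \<subseteq> {1..16}" and F: "finite F" "F \<subseteq> {1..16}"
    and n: "int (\<Sum>e\<in>E. e\<^sup>2) - 17 * int (\<Sum>E) - (int (\<Sum>e\<in>F. e\<^sup>2) - 17 * int (\<Sum>F)) = 34 * n" and "odd n"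
  shows "klein34_prod (int ` E) 2 17 \<tau> / klein34_prod (int ` F) 2 17 \<tau> = - ee (of_int n * \<tau> / 17) * quot17 E F (ee (\<tau> / 17))"
proof -
  define x where "x = (\<lambda>E. (\<Sum>e\<in>E. of_nat (e\<^sup>2)) - 17 * (\<Sum>e\<in>E. of_nat e) :: complex)"
  obtain k where k: "n = 2 * k + 1" using \<open>odd n\<close> oddE by blast
  have "x E - x F = of_int (34 * n)"
    unfolding n[symmetric] by (simp add: x_def)
  then have "x E * (\<tau> / 578 + 1 / 68) - x F * (\<tau> / 578 + 1 / 68) = of_int (34 * n) * (\<tau> / 578 + 1 / 68)"
    by (simp only: left_diff_distrib[symmetric])
  also have "\<dots> = of_int n * \<tau> / 17 + of_int k + 1 / 2"
    by (simp add: k field_simps)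
  finally have "ee (x E * (\<tau> / 578 + 1 / 68)) / ee (x F * (\<tau> / 578 + 1 / 68)) = - ee (of_int n * \<tau> / 17)"
    by (simp only: ee_diff[symmetric]) (simp add: ee_add ee_half)
  then show ?thesis
    unfolding klein34_prod_2_17[OF E] klein34_prod_2_17[OF F] quot17_def x_def
    by (simp only: times_divide_times_eq[symmetric])
qed

text \<open>The exponent 12 is ((476 - 34 * 38) - (680 - 34 * 68)) / 68. It is the shift between a
  partitioned number \<open>n\<close> and the class \<open>R\<close> of \<open>n + 12\<close> modulo
  34.\<close>

lemma klein_quot_1_0: "klein_quot 1 0 \<tau> = ee (12 * \<tau> / 34) * quot34 {1, 9, 13, 15} {3, 5, 6, 7, 10, 11, 12, 14} (ee (\<tau> / 34))"
  using klein34_prod_ratio_1_0[of "{1, 9, 13, 15}" "{3, 5, 6, 7, 10, 11, 12, 14}" 12 \<tau>] by (simp add: klein_quot_def)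

lemma klein_quot_3_0:
  assumes "Im \<tau> > 0"
  shows "klein_quot 3 0 \<tau> = ee (12 * \<tau> / 34) * quot34 {3, 5, 7, 11} {1, 2, 4, 8, 9, 13, 15, 16} (ee (\<tau> / 34))"
  using klein34_prod_ratio_1_0[of "{3, 5, 7, 11}" "{1, 2, 4, 8, 9, 13, 15, 16}" 12 \<tau>] klein_quot_scale_3[OF assms, of 1 0] by simp

lemma klein_quot_2_17: "klein_quot 2 17 \<tau> = - ee (9 * \<tau> / 17) * quot17 {1, 9, 13, 15} {3, 5, 6, 7, 10, 11, 12, 14} (ee (\<tau> / 17))"
  using klein34_prod_ratio_2_17[of "{1, 9, 13, 15}" "{3, 5, 6, 7, 10, 11, 12, 14}" 9 \<tau>] by (simp add: klein_quot_def)

text \<open>Three times (2, 17) is (6, 17) modulo 34. Among the representatives with first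
  coordinate prime to 17 this is the only one whose leading exponent, 3/17, is below 1/3.\<close>

lemma klein_quot_6_17:
  assumes "Im \<tau> > 0"
  shows "klein_quot 6 17 \<tau> = - ee (3 * \<tau> / 17) * quot17 {3, 5, 7, 11} {1, 2, 4, 8, 9, 13, 15, 16} (ee (\<tau> / 17))"
  using klein34_prod_ratio_2_17[of "{3, 5, 7, 11}" "{1, 2, 4, 8, 9, 13, 15, 16}" 3 \<tau>] klein_quot_scale_3[OF assms, of 2 17]
    klein_quot_mod[OF assms, of 6 6 51 17] by (simp add: cong_def)

lemma holomorphic_quot34:
  assumes "finite F" "F \<subseteq> {1..33}"
  shows "quot34 E F holomorphic_on ball 0 1"
proof -
  have "(\<Prod>e\<in>F. qpair e (34 - e) 34 1 x) \<noteq> 0" if "x \<in> ball 0 1" for x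
  proof -
    have "qpair e (34 - e) 34 1 x \<noteq> 0" if "e \<in> F" for e
      using assms(2) that \<open>x \<in> ball 0 1\<close> by (intro qpair_nonzero) auto
    then show ?thesis using assms(1) by simp
  qed
  then show ?thesis
    unfolding quot34_def by (intro holomorphic_intros holomorphic_qpair) auto
qed

lemma holomorphic_quot17:
  assumes "finite F" "F \<subseteq> {1..16}"
  shows "quot17 E F holomorphic_on ball 0 1"
proof -
  have "(\<Prod>e\<in>F. qpair e (17 - e) 17 (ee (of_nat e / 2)) x) \<noteq> 0" if "x \<in> ball 0 1" for x
  proof -
    have "qpair e (17 - e) 17 (ee (of_nat e / 2)) x \<noteq> 0" if "e \<in> F" for e
      using assms(2) that \<open>x \<in> ball 0 1\<close> by (intro qpair_nonzero) (auto simp: norm_ee)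
    then show ?thesis using assms(1) by simp
  qed
  then show ?thesis
    unfolding quot17_def by (intro holomorphic_intros holomorphic_qpair) auto
qed

lemma quot17_0:
  assumes "E \<subseteq> {1..16}" "F \<subseteq> {1..16}"
  shows "quot17 E F 0 = 1"
proof -
  have "qpair e (17 - e) 17 (ee (of_nat e / 2)) 0 = 1" if "e \<in> E \<union> F" for e
    using assms that by (intro qpair_0) auto
  then show ?thesis
    unfolding quot17_def by simp
qed

section \<open>Vectors with first coordinate divisible by 17\<close>

text \<open>The first coordinate is \<open>e / 2\<close>. An integer translation moves it to 1/2 for
  odd \<open>e\<close> and to 0 for even \<open>e\<close>, which is why the two parities have
  different expansions.\<close>

lemma klein34_17_odd:
  assumes t: "Im \<tau> > 0" and "odd e"
  shows "klein34 (int e) 17 d \<tau> = ee ((of_nat e - 1) / 4 - of_nat (e\<^sup>2) * of_int d / 136 - \<tau> / 8) *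
    qpair 1 1 2 (ee (of_nat e * of_int d / 34)) (ee (\<tau> / 2))"
proof -
  define b where "b = (of_nat e * of_int d / 34 :: complex)"
  obtain i where i: "e = 2 * i + 1" using \<open>odd e\<close> oddE by blast
  have "klein34 (int e) 17 d \<tau> = klein (1/2 + of_int (int i)) (b + of_int 0) \<tau>"
    by (simp add: klein34_def b_def i add_divide_distrib)
  also have "\<dots> = ee ((of_nat i - b * of_nat i) / 2) * klein (1/2) b \<tau>"
    unfolding klein_add_int[OF t] by simp
  also have "klein (1/2) b \<tau> = ee ((1/2 - 1) * (1/2 * \<tau> + b) / 2) * qpair 1 1 2 (ee b) (ee (\<tau> / 2))"
    using klein_expand[of 2 1 b \<tau>] by simp
  also have "ee ((of_nat i - b * of_nat i) / 2) * (ee ((1/2 - 1) * (1/2 * \<tau> + b) / 2) * qpair 1 1 2 (ee b) (ee (\<tau> / 2))) =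
      ee ((of_nat i - b * of_nat i) / 2 + (1/2 - 1) * (1/2 * \<tau> + b) / 2) * qpair 1 1 2 (ee b) (ee (\<tau> / 2))"
    by (simp only: ee_add mult.assoc)
  also have "(of_nat i - b * of_nat i) / 2 + (1/2 - 1) * (1/2 * \<tau> + b) / 2 =
      (of_nat e - 1) / 4 - of_nat (e\<^sup>2) * of_int d / 136 - \<tau> / 8"
    by (simp add: b_def i field_simps power2_eq_square)
  finally show ?thesis unfolding b_def .
qed

lemma klein34_17_even:
  assumes t: "Im \<tau> > 0" and "even e"
  shows "klein34 (int e) 17 d \<tau> = ee (of_nat e / 4 - of_nat (e\<^sup>2) * of_int d / 136) *
    (ee (- (of_nat e * of_int d / 68)) - ee (of_nat e * of_int d / 68)) *
    qpair 2 2 2 (ee (of_nat e * of_int d / 34)) (ee (\<tau> / 2))"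
proof -
  define b where "b = (of_nat e * of_int d / 34 :: complex)"
  obtain i where i: "e = 2 * i" using \<open>even e\<close> by blast
  have "klein34 (int e) 17 d \<tau> = klein (0 + of_int (int i)) (b + of_int 0) \<tau>"
    by (simp add: klein34_def b_def i)
  also have "\<dots> = ee ((of_nat i - b * of_nat i) / 2) * klein 0 b \<tau>"
    unfolding klein_add_int[OF t] by simp
  also have "klein 0 b \<tau> = (ee (- b / 2) - ee (b / 2)) * qpair 2 2 2 (ee b) (ee (\<tau> / 2))"
    using klein_0_expand[OF t, of 2 b] by simp
  also have "(of_nat i - b * of_nat i) / 2 = of_nat e / 4 - of_nat (e\<^sup>2) * of_int d / 136"
    by (simp add: b_def i field_simps power2_eq_square)
  finally show ?thesis unfolding b_def by simp
qed

lemma klein34_0: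
  assumes t: "Im \<tau> > 0"
  shows "klein34 (int e) 0 d \<tau> = (ee (- (of_nat e * of_int d / 68)) - ee (of_nat e * of_int d / 68)) *
    qpair 2 2 2 (ee (of_nat e * of_int d / 34)) (ee (\<tau> / 2))"
  using klein_0_expand[OF t, of 2 "of_nat e * of_int d / 34"] by (simp add: klein34_def)

text \<open>This is \<open>- 2 i sin (pi e d / 34)\<close>, the factor left over when the first
  coordinate is an integer.\<close>

definition sine_diff :: "int \<Rightarrow> nat \<Rightarrow> complex" where
  "sine_diff d e = ee (- (of_nat e * of_int d / 68)) - ee (of_nat e * of_int d / 68)"

definition cusp_limit :: "int \<Rightarrow> complex" where
  "cusp_limit d = ee (3 * of_int d / 2 - 15 / 2) / (\<Prod>e\<in>{6, 10, 12, 14}. sine_diff d e)"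

definition quot2 :: "int \<Rightarrow> nat set \<Rightarrow> nat set \<Rightarrow> nat set \<Rightarrow> nat set \<Rightarrow> complex \<Rightarrow> complex" where
  "quot2 d E E' F F' x =
    (\<Prod>e\<in>E. qpair 1 1 2 (ee (of_nat e * of_int d / 34)) x) * (\<Prod>e\<in>E'. qpair 2 2 2 (ee (of_nat e * of_int d / 34)) x) /
    ((\<Prod>e\<in>F. qpair 1 1 2 (ee (of_nat e * of_int d / 34)) x) * (\<Prod>e\<in>F'. qpair 2 2 2 (ee (of_nat e * of_int d / 34)) x))"

lemma holomorphic_quot2:
  assumes "finite F" "finite F'"
  shows "quot2 d E E' F F' holomorphic_on ball 0 1"
proof -
  have "qpair e e 2 (ee (of_nat k * of_int d / 34)) x \<noteq> 0" if "x \<in> ball 0 1" "e > 0" for x k e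
    using that by (intro qpair_nonzero) (auto simp: norm_ee)
  from this[of _ 1] this[of _ 2] show ?thesis
    unfolding quot2_def using assms by (intro holomorphic_intros holomorphic_qpair) auto
qed

lemma quot2_0 [simp]: "quot2 d E E' F F' 0 = 1"
  by (simp add: quot2_def qpair_0)

lemma klein34_prod_17_odd:
  assumes t: "Im \<tau> > 0" and "finite E" "\<forall>e\<in>E. odd e"
  shows "klein34_prod (int ` E) 17 d \<tau> =
    ee ((of_nat (\<Sum>E) - of_nat (card E)) / 4 - of_nat (\<Sum>e\<in>E. e\<^sup>2) * of_int d / 136 - of_nat (card E) * \<tau> / 8) *
    (\<Prod>e\<in>E. qpair 1 1 2 (ee (of_nat e * of_int d / 34)) (ee (\<tau> / 2)))"
proof -
  have "klein34_prod (int ` E) 17 d \<tau> = (\<Prod>e\<in>E. klein34 (int e) 17 d \<tau>)"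
    unfolding klein34_prod_def by (subst prod.reindex) auto
  also have "\<dots> = (\<Prod>e\<in>E. ee ((of_nat e - 1) / 4 - of_nat (e\<^sup>2) * of_int d / 136 - \<tau> / 8) *
    qpair 1 1 2 (ee (of_nat e * of_int d / 34)) (ee (\<tau> / 2)))"
    by (intro prod.cong refl klein34_17_odd t) (use assms in auto)
  also have "\<dots> = ee (\<Sum>e\<in>E. (of_nat e - 1) / 4 - of_nat (e\<^sup>2) * of_int d / 136 - \<tau> / 8) *
    (\<Prod>e\<in>E. qpair 1 1 2 (ee (of_nat e * of_int d / 34)) (ee (\<tau> / 2)))"
    unfolding prod.distrib ee_sum[OF \<open>finite E\<close>] ..
  also have "(\<Sum>e\<in>E. (of_nat e - 1) / 4 - of_nat (e\<^sup>2) * of_int d / 136 - \<tau> / 8) =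
    (of_nat (\<Sum>E) - of_nat (card E)) / 4 - of_nat (\<Sum>e\<in>E. e\<^sup>2) * of_int d / 136 - of_nat (card E) * \<tau> / 8"
    unfolding sum_subtractf sum_distrib_right[symmetric] sum_divide_distrib[symmetric] of_nat_sum by simp
  finally show ?thesis .
qed

lemma klein34_prod_17_even:
  assumes t: "Im \<tau> > 0" and "finite E" "\<forall>e\<in>E. even e"
  shows "klein34_prod (int ` E) 17 d \<tau> =
    ee (of_nat (\<Sum>E) / 4 - of_nat (\<Sum>e\<in>E. e\<^sup>2) * of_int d / 136) * (\<Prod>e\<in>E. sine_diff d e) *
    (\<Prod>e\<in>E. qpair 2 2 2 (ee (of_nat e * of_int d / 34)) (ee (\<tau> / 2)))"
proof -
  have "klein34_prod (int ` E) 17 d \<tau> = (\<Prod>e\<in>E. klein34 (int e) 17 d \<tau>)"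
    unfolding klein34_prod_def by (subst prod.reindex) auto
  also have "\<dots> = (\<Prod>e\<in>E. ee (of_nat e / 4 - of_nat (e\<^sup>2) * of_int d / 136) * sine_diff d e *
    qpair 2 2 2 (ee (of_nat e * of_int d / 34)) (ee (\<tau> / 2)))"
    unfolding sine_diff_def by (intro prod.cong refl klein34_17_even t) (use assms in auto)
  also have "\<dots> = ee (\<Sum>e\<in>E. of_nat e / 4 - of_nat (e\<^sup>2) * of_int d / 136) * (\<Prod>e\<in>E. sine_diff d e) *
    (\<Prod>e\<in>E. qpair 2 2 2 (ee (of_nat e * of_int d / 34)) (ee (\<tau> / 2)))"
    unfolding prod.distrib ee_sum[OF \<open>finite E\<close>] ..
  also have "(\<Sum>e\<in>E. of_nat e / 4 - of_nat (e\<^sup>2) * of_int d / 136) =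
    of_nat (\<Sum>E) / 4 - of_nat (\<Sum>e\<in>E. e\<^sup>2) * of_int d / (136 :: complex)"
    unfolding sum_subtractf sum_distrib_right[symmetric] sum_divide_distrib[symmetric] of_nat_sum by simp
  finally show ?thesis .
qed

text \<open>Numerator and denominator contain four odd indices each, so the powers of
  \<open>q\<close> cancel and the limit at the cusp is finite and nonzero. The even indices
  contribute the sines in \<open>cusp_limit\<close>.\<close>

lemma klein_quot_17:
  assumes t: "Im \<tau> > 0"
  shows "klein_quot 17 d \<tau> = cusp_limit d * quot2 d {1, 9, 13, 15} {} {3, 5, 7, 11} {6, 10, 12, 14} (ee (\<tau> / 2))"
proof -
  have split: "klein34_prod {3, 5, 6, 7, 10, 11, 12, 14} 17 d \<tau> =
      klein34_prod (int ` {3, 5, 7, 11}) 17 d \<tau> * klein34_prod (int ` {6, 10, 12, 14}) 17 d \<tau>"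
    by (simp add: klein34_prod_def mult_ac)
  have num: "{1, 9, 13, 15} = int ` {1, 9, 13, 15}" by simp
  define X Y Z where "X = (38 - 4) / 4 - 476 * of_int d / 136 - 4 * \<tau> / 8"
    and "Y = (26 - 4) / 4 - 204 * of_int d / 136 - 4 * \<tau> / 8"
    and "Z = 42 / 4 - 476 * of_int d / (136 :: complex)"
  have kX: "klein34_prod (int ` {1, 9, 13, 15}) 17 d \<tau> =
      ee X * (\<Prod>e\<in>{1, 9, 13, 15}. qpair 1 1 2 (ee (of_nat e * of_int d / 34)) (ee (\<tau> / 2)))"
    using klein34_prod_17_odd[OF t, of "{1, 9, 13, 15}" d] by (simp add: X_def)
  have kY: "klein34_prod (int ` {3, 5, 7, 11}) 17 d \<tau> =
      ee Y * (\<Prod>e\<in>{3, 5, 7, 11}. qpair 1 1 2 (ee (of_nat e * of_int d / 34)) (ee (\<tau> / 2)))"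
    using klein34_prod_17_odd[OF t, of "{3, 5, 7, 11}" d] by (simp add: Y_def)
  have kZ: "klein34_prod (int ` {6, 10, 12, 14}) 17 d \<tau> = ee Z * (\<Prod>e\<in>{6, 10, 12, 14}. sine_diff d e) *
      (\<Prod>e\<in>{6, 10, 12, 14}. qpair 2 2 2 (ee (of_nat e * of_int d / 34)) (ee (\<tau> / 2)))"
    using klein34_prod_17_even[OF t, of "{6, 10, 12, 14}" d] by (simp add: Z_def)
  have "X - Y - Z = 3 * of_int d / 2 - 15 / 2"
    by (simp add: X_def Y_def Z_def field_simps)
  then have XYZ: "ee (3 * of_int d / 2 - 15 / 2) = ee X / (ee Y * ee Z)"
    by (metis ee_diff divide_divide_eq_left)
  show ?thesis
    unfolding klein_quot_def split unfolding num kX kY kZ cusp_limit_def XYZ quot2_def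
    by (simp del: prod.insert add: mult_ac)
qed

lemma klein_quot_0:
  assumes t: "Im \<tau> > 0"
  shows "klein_quot 0 d \<tau> = (\<Prod>e\<in>{1, 9, 13, 15}. sine_diff d e) / (\<Prod>e\<in>{3, 5, 6, 7, 10, 11, 12, 14}. sine_diff d e) *
    quot2 d {} {1, 9, 13, 15} {} {3, 5, 6, 7, 10, 11, 12, 14} (ee (\<tau> / 2))"
proof -
  have k: "klein34_prod (int ` E) 0 d \<tau> = (\<Prod>e\<in>E. sine_diff d e) * (\<Prod>e\<in>E. qpair 2 2 2 (ee (of_nat e * of_int d / 34)) (ee (\<tau> / 2)))"
    for E
    unfolding klein34_prod_def by (subst prod.reindex) (auto simp: klein34_0[OF t] sine_diff_def prod.distrib)
  show ?thesis
    using k[of "{1, 9, 13, 15}"] k[of "{3, 5, 6, 7, 10, 11, 12, 14}"]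
    unfolding klein_quot_def quot2_def by (simp del: prod.insert)
qed

lemma ee_of_int_half: "ee (of_int k / 2) = (if even k then 1 else - 1)"
proof (cases "even k")
  case True
  then obtain j where "k = 2 * j" by blast
  then show ?thesis by simp
next
  case False
  then obtain j where "k = 2 * j + 1" using oddE by blast
  then have "ee (of_int k / 2) = ee (of_int j + 1 / 2)"
    by (intro arg_cong[of _ _ ee]) (simp add: field_simps)
  with False show ?thesis by (simp add: ee_add ee_half)
qed

lemma ee_cong:
  assumes "[a = b] (mod m)" "m \<noteq> 0"
  shows "ee (of_int a / of_int m) = ee (of_int b / of_int m)"
proof -
  obtain k where "b = a + m * k" using assms(1) by (metis cong_iff_lin)
  then have "of_int b / of_int m = of_int a / of_int m + (of_int k :: complex)"
    using assms(2) by (simp add: field_simps)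
  then show ?thesis by (simp add: ee_add)
qed

lemma ee_eq_1_frac:
  assumes "m \<noteq> 0" "ee (of_int a / of_int m) = 1"
  shows "m dvd a"
proof -
  obtain k :: int where "of_int a / of_int m = (of_int k :: complex)"
    using assms(2) unfolding ee_eq_1_iff by (auto simp: Ints_def)
  then have "of_int a = (of_int (m * k) :: complex)"
    using assms(1) by (simp add: field_simps)
  then have "a = m * k" by (simp only: of_int_eq_iff)
  then show ?thesis by simp
qed

text \<open>Of the indices 6, 10, 12, 14 the three with odd half change the sign of their sine, and
  the exponential changes sign as well. This periodicity later lets the terms \<open>j\<close> and
  \<open>j + 17\<close> cancel.\<close>

lemma cusp_limit_add_17: "cusp_limit (d + 17) = cusp_limit d"
proof -
  have *: "sine_diff (d + 17) (2 * f) = (if even f then 1 else - 1) * sine_diff d (2 * f)" for f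
  proof -
    define k where "k = int f"
    have "ee (of_nat (2 * f) * of_int (d + 17) / 68) = ee (of_nat (2 * f) * of_int d / 68 + of_int k / 2)"
      by (intro arg_cong[of _ _ ee]) (simp add: k_def field_simps)
    moreover have "ee (- (of_nat (2 * f) * of_int (d + 17) / 68)) = ee (- (of_nat (2 * f) * of_int d / 68) + of_int (- k) / 2)"
      by (intro arg_cong[of _ _ ee]) (simp add: k_def field_simps)
    ultimately show ?thesis
      unfolding sine_diff_def ee_add ee_of_int_half by (simp add: k_def)
  qed
  have "ee (3 * of_int (d + 17) / 2 - 15 / 2) = ee (3 * of_int d / 2 - 15 / 2 + of_int 51 / 2)"
    by (intro arg_cong[of _ _ ee]) (simp add: field_simps)
  also have "\<dots> = - ee (3 * of_int d / 2 - 15 / 2)"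
    unfolding ee_add ee_of_int_half by simp
  finally show ?thesis
    unfolding cusp_limit_def using *[of 3] *[of 5] *[of 6] *[of 7] by simp
qed

text \<open>The limits at first coordinates 0 and 17 become one function of \<open>d\<close>.
  Writing \<open>e = 17 - 2 g\<close> turns a sine into a cosine, and the cosines along the doubling
  orbits of 1 and of 3 multiply to 1 by the duplication formula.\<close>

lemma cusp_limit_odd:
  assumes d: "odd d" "\<not> 17 dvd d"
  shows "(\<Prod>e\<in>{1, 9, 13, 15}. sine_diff d e) / (\<Prod>e\<in>{3, 5, 6, 7, 10, 11, 12, 14}. sine_diff d e) = cusp_limit d"
proof -
  define s c where "s = (\<lambda>g::int. ee (of_int (g * d) / 34) - ee (- (of_int (g * d) / 34)))"
    and "c = (\<lambda>g::int. ee (of_int (g * d) / 34) + ee (- (of_int (g * d) / 34)))"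
  have double: "c g * s g = s (2 * g)" for g
    by (simp add: s_def c_def algebra_simps flip: ee_add)
  have refl: "s (17 * k - g) = (if even k then - s g else s g)"
    "c (17 * k - g) = (if even k then c g else - c g)" for k g
  proof -
    have "ee (of_int ((17 * k - g) * d) / 34) = ee (of_int (k * d) / 2 + - (of_int (g * d) / 34))"
      "ee (- (of_int ((17 * k - g) * d) / 34)) = ee (of_int (- (k * d)) / 2 + of_int (g * d) / 34)"
      by (intro arg_cong[of _ _ ee]; simp add: field_simps)+
    then show "s (17 * k - g) = (if even k then - s g else s g)"
      "c (17 * k - g) = (if even k then c g else - c g)"
      unfolding s_def c_def ee_add ee_of_int_half using d by auto
  qed
  have nz: "s g \<noteq> 0" if "\<not> 17 dvd g" for g
  proof
    assume "s g = 0"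
    then have "ee (of_int (g * d) / 34 + of_int (g * d) / 34) = 1"
      unfolding ee_add by (simp add: s_def ee_minus field_simps)
    then have "ee (of_int (g * d) / of_int 17) = 1" by (simp add: mult.commute)
    then have "17 dvd g * d" using ee_eq_1_frac[of 17] by simp
    moreover have "prime (17::int)" by simp
    ultimately show False using d that by (simp add: prime_dvd_mult_iff)
  qed
  \<comment> \<open>The doubling chain 1, 2, 4, 8, 16 closes up because 16 = 17 - 1 and
    \<open>d\<close> is odd.\<close>
  have "c 8 * c 4 * c 2 * c 1 * s 1 = s 16"
    using double[of 1] double[of 2] double[of 4] double[of 8] by (simp add: mult.assoc)
  moreover have "s 16 = s 1" using refl(1)[of 1 1] by simp
  ultimately have P1: "c 8 * c 4 * c 2 * c 1 = 1" using nz[of 1] by simp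
  \<comment> \<open>The chain 3, 6, 12, 24, 48 closes up because 48 = 3 * 17 - 3; reflection then
    reduces 24 and 12 to 7 and 5.\<close>
  have "c 24 * c 12 * c 6 * c 3 * s 3 = s 48"
    using double[of 3] double[of 6] double[of 12] double[of 24] by (simp add: mult.assoc)
  moreover have "s 48 = s 3" using refl(1)[of 3 3] by simp
  moreover have "c 12 = - c 5" "c 24 = c 10" using refl(2)[of 1 5] refl(2)[of 2 10] by simp_all
  moreover have "c 10 = - c 7" using refl(2)[of 1 7] by simp
  ultimately have P2: "c 7 * c 5 * c 6 * c 3 = 1" using nz[of 3] by simp
  have sc: "sine_diff d e = - ee (of_int d / 4) * c g" if "int e = 17 - 2 * g" for e g
  proof -
    have "of_nat e = (of_int (int e) :: complex)" by simp
    then have e: "of_nat e = 17 - 2 * (of_int g :: complex)" unfolding that by simp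
    have "- (of_nat e * of_int d / 68) = of_int d / 4 + of_int (- d) / 2 + of_int (g * d) / (34 :: complex)"
      unfolding e by (simp add: field_simps)
    then have 1: "ee (- (of_nat e * of_int d / 68)) = - ee (of_int d / 4) * ee (of_int (g * d) / 34)"
      using d by (simp only: ee_add ee_of_int_half) simp
    have "of_nat e * of_int d / 68 = of_int d / 4 + - (of_int (g * d) / (34 :: complex))"
      unfolding e by (simp add: field_simps)
    then have 2: "ee (of_nat e * of_int d / 68) = ee (of_int d / 4) * ee (- (of_int (g * d) / 34))"
      by (simp only: ee_add)
    show ?thesis
      unfolding sine_diff_def c_def 1 2 by (simp only: ring_distribs) simp
  qed
  have "(\<Prod>e\<in>{1, 9, 13, 15}. sine_diff d e) = ee (of_int d / 4) ^ 4 * (c 8 * c 4 * c 2 * c 1)"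
    using sc[of 1 8] sc[of 9 4] sc[of 13 2] sc[of 15 1] by (simp add: power4_eq_xxxx)
  then have N: "(\<Prod>e\<in>{1, 9, 13, 15}. sine_diff d e) = ee (of_int d / 4) ^ 4" unfolding P1 by simp
  have "(\<Prod>e\<in>{3, 5, 7, 11}. sine_diff d e) = ee (of_int d / 4) ^ 4 * (c 7 * c 5 * c 6 * c 3)"
    using sc[of 3 7] sc[of 5 6] sc[of 7 5] sc[of 11 3] by (simp add: power4_eq_xxxx)
  then have D: "(\<Prod>e\<in>{3, 5, 7, 11}. sine_diff d e) = ee (of_int d / 4) ^ 4" unfolding P2 by simp
  have "(\<Prod>e\<in>{3, 5, 6, 7, 10, 11, 12, 14}. sine_diff d e) =
      (\<Prod>e\<in>{3, 5, 7, 11}. sine_diff d e) * (\<Prod>e\<in>{6, 10, 12, 14}. sine_diff d e)"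
    by simp
  moreover have "ee (3 * of_int d / 2 - 15 / 2) = 1"
  proof -
    have "ee (3 * of_int d / 2 - 15 / 2) = ee (of_int (3 * d - 15) / 2)"
      by (intro arg_cong[of _ _ ee]) (simp add: field_simps)
    then show ?thesis unfolding ee_of_int_half using d by simp
  qed
  ultimately show ?thesis
    unfolding cusp_limit_def N D by (simp del: prod.insert)
qed

section \<open>Reduction to representative vectors\<close>

lemma klein_quot_T_int: "klein_quot c d (\<tau> + of_int t) = klein_quot c (c * t + d) \<tau>"
proof -
  have nat: "klein_quot c d (\<tau> + of_nat n) = klein_quot c (c * int n + d) \<tau>" for n \<tau> d
  proof (induction n arbitrary: d)
    case (Suc n)
    have "klein_quot c d (\<tau> + of_nat (Suc n)) = klein_quot c d ((\<tau> + of_nat n) + 1)"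
      by (simp add: add_ac)
    also have "\<dots> = klein_quot c (c * int n + (c + d)) \<tau>"
      unfolding klein_quot_T by (rule Suc)
    finally show ?case by (simp add: algebra_simps)
  qed simp
  show ?thesis
  proof (cases "t \<ge> 0")
    case True
    then show ?thesis using nat[of d \<tau> "nat t"] by simp
  next
    case False
    then show ?thesis using nat[of "c * t + d" "\<tau> + of_int t" "nat (- t)"] by simp
  qed
qed

text \<open>On the eight odd quadratic residues modulo 34 this is the quartic residue symbol: 1, 13,
  21, 33 are 1, 13, 4, 16 modulo 17.\<close>

definition residue_sign :: "int \<Rightarrow> complex" where
  "residue_sign u = (if u \<in> {1, 13, 21, 33} then 1 else - 1)"

lemma klein_quot_scale:
  assumes t: "Im \<tau> > 0" and odd: "\<not> (even c \<and> even d)" and "u \<in> {1, 9, 13, 15, 19, 21, 25, 33}"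
  shows "klein_quot (u * c) (u * d) \<tau> = residue_sign u * klein_quot c d \<tau>"
proof -
  \<comment> \<open>The powers of 19 modulo 34 are 19, 21, 25, 33, 15, 13, 9, 1; each step costs one
    sign.\<close>
  have step: "klein_quot (19 * u * c) (19 * u * d) \<tau> = - klein_quot (u * c) (u * d) \<tau>" if "odd u" for u
    using klein_quot_scale_19[OF t, of "u * c" "u * d"] odd that by (simp add: mult.assoc)
  have red: "klein_quot (v * c) (v * d) \<tau> = klein_quot (u * c) (u * d) \<tau>" if "[v = u] (mod 34)" for u v
    using that by (intro klein_quot_mod[OF t] cong_scalar_right)
  have 19: "klein_quot (19 * c) (19 * d) \<tau> = - klein_quot c d \<tau>" using step[of 1] by simp
  have 21: "klein_quot (21 * c) (21 * d) \<tau> = klein_quot c d \<tau>" using step[of 19] red[of 361 21] 19 by (simp add: cong_def)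
  have 25: "klein_quot (25 * c) (25 * d) \<tau> = - klein_quot c d \<tau>" using step[of 21] red[of 399 25] 21 by (simp add: cong_def)
  have 33: "klein_quot (33 * c) (33 * d) \<tau> = klein_quot c d \<tau>" using step[of 25] red[of 475 33] 25 by (simp add: cong_def)
  have 15: "klein_quot (15 * c) (15 * d) \<tau> = - klein_quot c d \<tau>" using step[of 33] red[of 627 15] 33 by (simp add: cong_def)
  have 13: "klein_quot (13 * c) (13 * d) \<tau> = klein_quot c d \<tau>" using step[of 15] red[of 285 13] 15 by (simp add: cong_def)
  have 9: "klein_quot (9 * c) (9 * d) \<tau> = - klein_quot c d \<tau>" using step[of 13] red[of 247 9] 13 by (simp add: cong_def)
  show ?thesis
    using assms(3) 9 13 15 19 21 25 33 by (auto simp: residue_sign_def)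
qed

text \<open>Scaling by a residue and translating \<tau> bring every primitive vector with first
  coordinate prime to 17 to one of (1, 0), (3, 0), (2, 17), (6, 17), whose expansions are
  known.\<close>

lemma klein_quot_orbit:
  assumes t: "Im \<tau> > 0" and odd: "\<not> (even c0 \<and> even d0)" and u: "u \<in> {1, 9, 13, 15, 19, 21, 25, 33}"
    and "[c = u * c0] (mod 34)" "[d = u * (c0 * s + d0)] (mod 34)"
  shows "klein_quot c d \<tau> = residue_sign u * klein_quot c0 d0 (\<tau> + of_int s)"
proof -
  have "klein_quot c d \<tau> = klein_quot (u * c0) (u * (c0 * s + d0)) \<tau>"
    by (rule klein_quot_mod[OF t]) fact+
  also have "\<dots> = residue_sign u * klein_quot c0 (c0 * s + d0) \<tau>"
    by (rule klein_quot_scale[OF t _ u]) (use odd in auto)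
  finally show ?thesis by (simp add: klein_quot_T_int)
qed

section \<open>Orders at the cusp\<close>

text \<open>Convergence is uniform in the real part, as translation and the compactness argument of
  the maximum principle require.\<close>

definition cusp :: "complex filter" where
  "cusp = filtercomap Im at_top"

lemma eventually_cusp: "eventually P cusp \<longleftrightarrow> (\<exists>B. \<forall>\<tau>. Im \<tau> \<ge> B \<longrightarrow> P \<tau>)"
proof
  assume "eventually P cusp"
  then obtain Q where Q: "eventually Q at_top" "\<And>\<tau>. Q (Im \<tau>) \<Longrightarrow> P \<tau>"
    unfolding cusp_def eventually_filtercomap by blast
  then show "\<exists>B. \<forall>\<tau>. Im \<tau> \<ge> B \<longrightarrow> P \<tau>"
    unfolding eventually_at_top_linorder by blast
next
  assume "\<exists>B. \<forall>\<tau>. Im \<tau> \<ge> B \<longrightarrow> P \<tau>"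
  then obtain B where "\<And>\<tau>. Im \<tau> \<ge> B \<Longrightarrow> P \<tau>" by blast
  then show "eventually P cusp"
    unfolding cusp_def eventually_filtercomap
    by (intro exI[of _ "\<lambda>y. y \<ge> B"]) (auto simp: eventually_ge_at_top)
qed

definition ord_ge :: "real \<Rightarrow> (complex \<Rightarrow> complex) \<Rightarrow> bool" where
  "ord_ge r f \<longleftrightarrow> f \<in> O[cusp](\<lambda>\<tau>. ee (of_real r * \<tau>))"

lemma ord_ge_cmult: "ord_ge r f \<Longrightarrow> ord_ge r (\<lambda>\<tau>. c * f \<tau>)"
  unfolding ord_ge_def by (cases "c = 0") auto

lemma ord_ge_sum: "(\<And>i. i \<in> A \<Longrightarrow> ord_ge r (f i)) \<Longrightarrow> ord_ge r (\<lambda>\<tau>. \<Sum>i\<in>A. f i \<tau>)"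
  unfolding ord_ge_def by (rule big_sum_in_bigo)

lemma ord_ge_mult: "ord_ge r f \<Longrightarrow> ord_ge s g \<Longrightarrow> ord_ge (r + s) (\<lambda>\<tau>. f \<tau> * g \<tau>)"
  unfolding ord_ge_def using landau_o.big.mult[of f cusp _ g] by (fastforce simp: ring_distribs ee_add)

lemma ord_ge_ee: "ord_ge r (\<lambda>\<tau>. ee (of_real r * \<tau>))"
  by (simp add: ord_ge_def)

lemma ord_ge_mono:
  assumes "ord_ge s f" "r \<le> s"
  shows "ord_ge r f"
proof -
  have "(\<lambda>\<tau>. ee (of_real s * \<tau>)) \<in> O[cusp](\<lambda>\<tau>. ee (of_real r * \<tau>))"
  proof (rule landau_o.bigI[of 1])
    show "\<forall>\<^sub>F \<tau> in cusp. norm (ee (of_real s * \<tau>)) \<le> 1 * norm (ee (of_real r * \<tau>))"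
      unfolding eventually_cusp using assms(2)
      by (intro exI[of _ 0]) (auto simp: norm_ee intro!: mult_right_mono)
  qed simp
  with assms(1) show ?thesis
    unfolding ord_ge_def by (rule landau_o.big_trans)
qed

lemma ord_ge_cong:
  assumes "ord_ge r f" "\<And>\<tau>. Im \<tau> > 0 \<Longrightarrow> f \<tau> = g \<tau>"
  shows "ord_ge r g"
proof -
  have "\<forall>\<^sub>F \<tau> in cusp. f \<tau> = g \<tau>"
    unfolding eventually_cusp using assms(2) by (intro exI[of _ 1]) auto
  with assms(1) show ?thesis
    unfolding ord_ge_def using landau_o.big.in_cong by fast
qed

lemma filterlim_translate_cusp: "Im t = 0 \<Longrightarrow> filterlim (\<lambda>\<tau>. \<tau> + t) cusp cusp"
  unfolding filterlim_iff eventually_cusp by (metis add.right_neutral plus_complex.simps(2))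

lemma ord_ge_translate:
  assumes "ord_ge r f"
  shows "ord_ge r (\<lambda>\<tau>. f (\<tau> + of_int t))"
proof -
  have "(\<lambda>\<tau>. f (\<tau> + of_int t)) \<in> O[cusp](\<lambda>\<tau>. ee (of_real r * (\<tau> + of_int t)))"
    using landau_o.big.compose[OF assms[unfolded ord_ge_def] filterlim_translate_cusp[of "of_int t"]] by simp
  also have "(\<lambda>\<tau>. ee (of_real r * (\<tau> + of_int t))) = (\<lambda>\<tau>. ee (of_real r * of_int t) * ee (of_real r * \<tau>))"
    by (simp add: ring_distribs ee_add mult.commute)
  finally show ?thesis by (simp add: ord_ge_def)
qed

lemma filterlim_ee_cusp:
  assumes "m > 0"
  shows "filterlim (\<lambda>\<tau>. ee (\<tau> / of_nat m)) (nhds 0) cusp"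
proof (rule tendsto_norm_zero_cancel)
  have "((\<lambda>y. exp (- 2 * pi * (y / real m))) \<longlongrightarrow> 0) at_top"
    using assms by real_asymp
  then have "((\<lambda>\<tau>. exp (- 2 * pi * (Im \<tau> / real m))) \<longlongrightarrow> 0) cusp"
    by (rule filterlim_compose) (simp add: cusp_def filterlim_filtercomap)
  then show "((\<lambda>\<tau>. norm (ee (\<tau> / of_nat m))) \<longlongrightarrow> 0) cusp"
    by (simp add: norm_ee)
qed

lemma ord_ge_holomorphic:
  assumes "G holomorphic_on ball 0 1" "m > 0"
  shows "ord_ge 0 (\<lambda>\<tau>. G (ee (\<tau> / of_nat m)))"
proof -
  have "continuous (at 0) G"
    using assms(1) by (meson centre_in_ball continuous_on_eq_continuous_at holomorphic_on_imp_continuous_on open_ball zero_less_one)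
  then have "(G \<longlongrightarrow> G 0) (nhds 0)"
    by (simp add: continuous_at tendsto_at_iff_tendsto_nhds)
  then have "((\<lambda>\<tau>. G (ee (\<tau> / of_nat m))) \<longlongrightarrow> G 0) cusp"
    using filterlim_ee_cusp[OF assms(2)] by (rule filterlim_compose)
  then show ?thesis
    unfolding ord_ge_def by (intro bigoI_tendsto[of _ _ "G 0"]) simp_all
qed

section \<open>Taylor coefficients at the cusp\<close>

lemma norm_qpoch_minus_1_le:
  assumes q: "norm q \<le> 1 / 2" and z: "norm z \<le> 1"
  shows "norm (qpoch z q - 1) \<le> 2 * exp 2 * norm z"
proof (rule LIMSEQ_le_const2)
  show "(\<lambda>N. norm ((\<Prod>n<N. 1 - z * q ^ n) - 1)) \<longlonglongrightarrow> norm (qpoch z q - 1)"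
    by (intro tendsto_intros qpoch_tendsto) (use q in simp)
  have "norm ((\<Prod>n<N. 1 - z * q ^ n) - 1) \<le> 2 * exp 2 * norm z" for N
  proof -
    have "norm ((\<Prod>n<N. 1 - z * q ^ n) - 1) \<le> (\<Prod>n<N. 1 + norm (- (z * q ^ n))) - 1"
      using norm_prod_minus1_le_prod_minus1[of "\<lambda>n. - (z * q ^ n)" "{..<N}"] by simp
    also have "(\<Prod>n<N. 1 + norm (- (z * q ^ n))) \<le> (\<Prod>n<N. exp (norm (- (z * q ^ n))))"
      by (intro prod_mono conjI exp_ge_add_one_self) auto
    also have "\<dots> = exp (\<Sum>n<N. norm z * norm q ^ n)"
      by (simp add: exp_sum norm_mult norm_power)
    also have "(\<Sum>n<N. norm z * norm q ^ n) \<le> 2 * norm z"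
    proof -
      have "(\<Sum>n<N. norm q ^ n) \<le> (\<Sum>n. norm q ^ n)"
        by (intro sum_le_suminf summable_geometric) (use q in auto)
      also have "\<dots> = 1 / (1 - norm q)" using q by (intro suminf_geometric) auto
      also have "\<dots> \<le> 2" using q by (simp add: field_simps)
      finally have S: "(\<Sum>n<N. norm q ^ n) \<le> 2" .
      show ?thesis
        unfolding sum_distrib_left[symmetric] using mult_left_mono[OF S norm_ge_zero[of z]] by (simp add: mult.commute)
    qed
    also have "exp (2 * norm z) - 1 \<le> 2 * norm z * exp (2 * norm z)"
    proof -
      have "exp (2 * norm z) * (1 - 2 * norm z) \<le> exp (2 * norm z) * exp (- (2 * norm z))"
        using exp_ge_add_one_self[of "- (2 * norm z)"] by (intro mult_left_mono) auto
      then show ?thesis by (simp add: exp_minus field_simps)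
    qed
    also have "\<dots> \<le> 2 * norm z * exp 2"
      using z by (intro mult_left_mono) auto
    finally show ?thesis by (simp add: mult_ac)
  qed
  then show "\<exists>N. \<forall>n\<ge>N. norm ((\<Prod>n<n. 1 - z * q ^ n) - 1) \<le> 2 * exp 2 * norm z"
    by blast
qed

text \<open>Once the first factor is split off, the rest is \<open>1 + O(x^2)\<close> because
  \<open>e + m >= 2\<close>. Only \<open>1 - s x^e\<close> can contribute a linear term.\<close>

lemma has_field_derivative_qpoch_0:
  assumes e: "e > 0" and m: "m > 0" and s: "norm s = 1"
  shows "((\<lambda>x. qpoch (s * x ^ e) (x ^ m)) has_field_derivative (if e = 1 then - s else 0)) (at 0)"
proof -
  define H where "H = (\<lambda>x. qpoch (s * x ^ e * x ^ m) (x ^ m))"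
  have H0: "H 0 = 1" using e m by (simp add: H_def zero_power)
  have "(H has_field_derivative 0) (at 0)"
    unfolding DERIV_def
  proof (rule Lim_null_comparison)
    show "((\<lambda>h. 2 * exp 2 * norm h) \<longlongrightarrow> 0) (at (0::complex))"
      by (auto intro!: tendsto_eq_intros)
    have "norm ((H (0 + h) - H 0) / h) \<le> 2 * exp 2 * norm h" if h: "dist h 0 < 1 / 2" "h \<noteq> 0" for h
    proof -
      have le: "norm h ^ k \<le> norm h ^ l" if "l \<le> k" for k l :: nat
        using h that by (intro power_decreasing) auto
      have 1: "norm (h ^ m) \<le> 1 / 2" using le[of 1 m] h m by (simp add: norm_power)
      have 2: "norm (s * h ^ e * h ^ m) \<le> norm h ^ 2"
        using le[of 2 "e + m"] e m s by (simp add: norm_mult norm_power power_add)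
      have "norm h ^ 2 \<le> 1" using le[of 0 2] by simp
      with 1 2 have "norm (H h - 1) \<le> 2 * exp 2 * norm (s * h ^ e * h ^ m)"
        unfolding H_def by (intro norm_qpoch_minus_1_le) auto
      also have "\<dots> \<le> 2 * exp 2 * norm h ^ 2" using 2 by (intro mult_left_mono) auto
      finally show ?thesis using h H0 by (simp add: norm_divide field_simps power2_eq_square)
    qed
    then show "\<forall>\<^sub>F h in at 0. norm ((H (0 + h) - H 0) / h) \<le> 2 * exp 2 * norm h"
      unfolding eventually_at by (intro exI[of _ "1/2"]) auto
  qed
  moreover have "((\<lambda>x. 1 - s * x ^ e) has_field_derivative (if e = 1 then - s else 0)) (at 0)"
    using e by (auto intro!: derivative_eq_intros simp: zero_power)
  ultimately have der: "((\<lambda>x. (1 - s * x ^ e) * H x) has_field_derivative (if e = 1 then - s else 0)) (at 0)"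
    using e by (auto intro!: derivative_eq_intros simp: H0 zero_power)
  have eq: "(1 - s * x ^ e) * H x = qpoch (s * x ^ e) (x ^ m)" if "dist x 0 < 1" for x
    unfolding H_def using that norm_power_lt_1[of x m] m by (subst (2) qpoch_rec) auto
  show ?thesis
    by (rule has_field_derivative_transform_within[OF der zero_less_one UNIV_I eq])
qed

lemma has_field_derivative_qpair_0:
  assumes "e > 0" "f > 0" "m > 0" and s: "norm s = 1"
  shows "(qpair e f m s has_field_derivative (if e = 1 then - s else 0) + (if f = 1 then - inverse s else 0)) (at 0)"
proof -
  have "norm (inverse s) = 1" using s by (simp add: norm_inverse)
  from DERIV_mult[OF has_field_derivative_qpoch_0[OF assms(1,3,4)] has_field_derivative_qpoch_0[OF assms(2,3) this]]
  have "((\<lambda>x. qpoch (s * x ^ e) (x ^ m) * qpoch (inverse s * x ^ f) (x ^ m)) has_field_derivative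
      (if e = 1 then - s else 0) + (if f = 1 then - inverse s else 0)) (at 0)"
    using assms by (simp only: zero_power mult_zero_right qpoch_0 mult_1_right)
  then show ?thesis
    unfolding qpair_def[abs_def] by (simp add: divide_inverse mult.commute)
qed

lemma has_field_derivative_prod_1:
  assumes "finite E" "\<And>e. e \<in> E \<Longrightarrow> f e a = 1" "\<And>e. e \<in> E \<Longrightarrow> (f e has_field_derivative d e) (at a)"
  shows "((\<lambda>x. \<Prod>e\<in>E. f e x) has_field_derivative (\<Sum>e\<in>E. d e)) (at a)"
  using assms
proof (induction E rule: finite_induct)
  case (insert e E)
  then have "((\<lambda>x. f e x * (\<Prod>e\<in>E. f e x)) has_field_derivative d e * (\<Prod>e\<in>E. f e a) + (\<Sum>e\<in>E. d e) * f e a) (at a)"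
    by (intro DERIV_mult) auto
  then show ?case using insert by simp
qed simp

text \<open>Linear terms can come only from the indices 1 and 16. They contribute
  \<open>- ee (1/2) = 1\<close> and \<open>- 1 / ee 8 = - 1\<close>, so the exponent 4/17 does not
  occur in the expansion at (6, 17).\<close>

lemma has_field_derivative_quot17_0:
  "(quot17 {3, 5, 7, 11} {1, 2, 4, 8, 9, 13, 15, 16} has_field_derivative 0) (at 0)"
proof -
  define d where "d = (\<lambda>e::nat. (if e = 1 then - ee (of_nat e / 2) else 0) + (if 17 - e = 1 then - inverse (ee (of_nat e / 2)) else 0))"
  have E: "((\<lambda>x. \<Prod>e\<in>E. qpair e (17 - e) 17 (ee (of_nat e / 2)) x) has_field_derivative sum d E) (at 0)"
    if "finite E" "E \<subseteq> {1..16}" for E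
  proof (rule has_field_derivative_prod_1[OF that(1)])
    fix e assume "e \<in> E"
    then have "e \<ge> 1" "e \<le> 16" using that(2) by auto
    then show "qpair e (17 - e) 17 (ee (of_nat e / 2)) 0 = 1" by (simp add: qpair_0)
    show "(qpair e (17 - e) 17 (ee (of_nat e / 2)) has_field_derivative d e) (at 0)"
      unfolding d_def using \<open>e \<ge> 1\<close> \<open>e \<le> 16\<close>
      by (intro has_field_derivative_qpair_0) (auto simp: norm_ee)
  qed
  have one: "(\<Prod>e\<in>E. qpair e (17 - e) 17 (ee (of_nat e / 2)) 0) = 1" if "E \<subseteq> {1..16}" for E
    using that by (intro prod.neutral ballI qpair_0) auto
  have "sum d {3, 5, 7, 11} = 0" by (simp add: d_def)
  moreover have "sum d {1, 2, 4, 8, 9, 13, 15, 16} = 0"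
    using ee_half ee_of_int[of 8] by (simp add: d_def)
  moreover have "(quot17 A B has_field_derivative sum d A - sum d B) (at 0)"
    if A: "finite A" "A \<subseteq> {1..16}" and B: "finite B" "B \<subseteq> {1..16}" for A B
    unfolding quot17_def[abs_def]
    using DERIV_divide[OF E[OF A] E[OF B]] unfolding one[OF A(2)] one[OF B(2)] by simp
  from this[of "{3, 5, 7, 11}" "{1, 2, 4, 8, 9, 13, 15, 16}"] calculation show ?thesis
    by (simp del: sum.insert)
qed

lemma holomorphic_factor_0:
  assumes "G holomorphic_on ball 0 1"
  obtains H where "H holomorphic_on ball 0 1" "\<And>x. x \<in> ball 0 1 \<Longrightarrow> G x = G 0 + x * H x" "H 0 = deriv G 0"
proof
  let ?H = "\<lambda>x. if x = 0 then deriv G 0 else (G x - G 0) / (x - 0)"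
  show "?H holomorphic_on ball 0 1"
    using pole_lemma_open[OF assms, of 0] by simp
qed auto

lemma quot17_taylor:
  obtains \<gamma> H where "H holomorphic_on ball 0 1"
    "\<And>x. x \<in> ball 0 1 \<Longrightarrow> quot17 {3, 5, 7, 11} {1, 2, 4, 8, 9, 13, 15, 16} x = 1 + \<gamma> * x ^ 2 + x ^ 3 * H x"
proof -
  let ?G = "quot17 {3, 5, 7, 11} {1, 2, 4, 8, 9, 13, 15, 16}"
  have "?G holomorphic_on ball 0 1" by (rule holomorphic_quot17) auto
  then obtain H1 where H1: "H1 holomorphic_on ball 0 1" "\<And>x. x \<in> ball 0 1 \<Longrightarrow> ?G x = ?G 0 + x * H1 x" "H1 0 = deriv ?G 0"
    using holomorphic_factor_0 by blast
  then obtain H2 where H2: "H2 holomorphic_on ball 0 1" "\<And>x. x \<in> ball 0 1 \<Longrightarrow> H1 x = H1 0 + x * H2 x"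
    using holomorphic_factor_0 by blast
  then obtain H3 where H3: "H3 holomorphic_on ball 0 1" "\<And>x. x \<in> ball 0 1 \<Longrightarrow> H2 x = H2 0 + x * H3 x"
    using holomorphic_factor_0 by blast
  have "deriv ?G 0 = 0" by (rule DERIV_imp_deriv[OF has_field_derivative_quot17_0])
  moreover have "?G 0 = 1" by (rule quot17_0) auto
  ultimately have "?G x = 1 + H2 0 * x ^ 2 + x ^ 3 * H3 x" if "x \<in> ball 0 1" for x
    using H1(2)[OF that] H1(3) H2(2)[OF that] H3(2)[OF that]
    by (simp add: algebra_simps power2_eq_square power3_eq_cube)
  with H3(1) show ?thesis using that by blast
qed

lemma ee_cusp_in_ball: "Im \<tau> > 0 \<Longrightarrow> m > 0 \<Longrightarrow> ee (\<tau> / of_nat m) \<in> ball 0 1"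
  using norm_ee_less_1[of "\<tau> / of_nat m"] by simp

text \<open>The coefficient \<gamma> stays unspecified: it will be multiplied by a sum that
  vanishes.\<close>

lemma klein_quot_6_17_asymptotic:
  obtains \<gamma> where "ord_ge (6/17) (\<lambda>\<tau>. klein_quot 6 17 \<tau> + (ee (3 * \<tau> / 17) + \<gamma> * ee (5 * \<tau> / 17)))"
proof -
  obtain \<gamma> H where H: "H holomorphic_on ball 0 1"
    "\<And>x. x \<in> ball 0 1 \<Longrightarrow> quot17 {3, 5, 7, 11} {1, 2, 4, 8, 9, 13, 15, 16} x = 1 + \<gamma> * x ^ 2 + x ^ 3 * H x"
    using quot17_taylor by blast
  have "ord_ge (6/17 + 0) (\<lambda>\<tau>. ee (of_real (6/17) * \<tau>) * H (ee (\<tau> / of_nat 17)))"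
    by (intro ord_ge_mult ord_ge_ee ord_ge_holomorphic H) simp
  then have "ord_ge (6/17) (\<lambda>\<tau>. - 1 * (ee (of_real (6/17) * \<tau>) * H (ee (\<tau> / of_nat 17))))"
    by (intro ord_ge_cmult) simp
  then have "ord_ge (6/17) (\<lambda>\<tau>. klein_quot 6 17 \<tau> + (ee (3 * \<tau> / 17) + \<gamma> * ee (5 * \<tau> / 17)))"
  proof (rule ord_ge_cong)
    fix \<tau> :: complex assume t: "Im \<tau> > 0"
    let ?x = "ee (\<tau> / 17)"
    have x: "?x \<in> ball 0 1" using ee_cusp_in_ball[OF t, of 17] by simp
    have p: "ee (3 * \<tau> / 17) = ?x ^ 3" "ee (5 * \<tau> / 17) = ?x ^ 5" "ee (of_real (6/17) * \<tau>) = ?x ^ 6"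
      by (simp_all add: ee_power)
    show "- 1 * (ee (of_real (6/17) * \<tau>) * H (ee (\<tau> / of_nat 17))) = klein_quot 6 17 \<tau> + (ee (3 * \<tau> / 17) + \<gamma> * ee (5 * \<tau> / 17))"
      unfolding klein_quot_6_17[OF t] H(2)[OF x] p by (simp add: algebra_simps eval_nat_numeral)
  qed
  then show ?thesis using that by blast
qed

section \<open>Asymptotics of all quotients\<close>

lemma residues_mod_34:
  fixes c :: int
  assumes "\<not> 17 dvd c"
  shows "odd c \<Longrightarrow> c mod 34 \<in> {1, 3, 5, 7, 9, 11, 13, 15, 19, 21, 23, 25, 27, 29, 31, 33}"
    and "even c \<Longrightarrow> c mod 34 \<in> {2, 4, 8, 16, 18, 26, 30, 32} \<union> {6, 10, 12, 14, 20, 22, 24, 28}"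
proof -
  define r where "r = c mod 34"
  have F: "\<forall>r\<in>{0..<34::int}. r mod 17 \<noteq> 0 \<longrightarrow>
    (r mod 2 = 1 \<longrightarrow> r \<in> {1, 3, 5, 7, 9, 11, 13, 15, 19, 21, 23, 25, 27, 29, 31, 33}) \<and>
    (r mod 2 = 0 \<longrightarrow> r \<in> {2, 4, 8, 16, 18, 26, 30, 32} \<union> {6, 10, 12, 14, 20, 22, 24, 28})"
    by code_simp
  have r: "r \<in> {0..<34}" "r mod 17 = c mod 17" "r mod 2 = c mod 2"
    by (simp_all add: r_def mod_mod_cancel)
  have "c mod 17 \<noteq> 0" using assms by (simp add: dvd_eq_mod_eq_0)
  then have "(c mod 2 = 1 \<longrightarrow> r \<in> {1, 3, 5, 7, 9, 11, 13, 15, 19, 21, 23, 25, 27, 29, 31, 33}) \<and>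
    (c mod 2 = 0 \<longrightarrow> r \<in> {2, 4, 8, 16, 18, 26, 30, 32} \<union> {6, 10, 12, 14, 20, 22, 24, 28})"
    using mp[OF bspec[OF F r(1), unfolded r(2,3)]] by simp
  then show "odd c \<Longrightarrow> c mod 34 \<in> {1, 3, 5, 7, 9, 11, 13, 15, 19, 21, 23, 25, 27, 29, 31, 33}"
    "even c \<Longrightarrow> c mod 34 \<in> {2, 4, 8, 16, 18, 26, 30, 32} \<union> {6, 10, 12, 14, 20, 22, 24, 28}"
    unfolding r_def odd_iff_mod_2_eq_one even_iff_mod_2_eq_zero by (simp_all only: not_mod_2_eq_0_eq_1 simp_thms)
qed

lemma residue_orbits:
  "\<forall>r\<in>{6, 10, 12, 14, 20, 22, 24, 28::int}. \<exists>u\<in>{1, 9, 13, 15, 19, 21, 25, 33}.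
    r = u * 6 mod 34 \<and> (r \<in> {6, 10, 24, 28} \<longleftrightarrow> u \<in> {1, 13, 21, 33})"
  "\<forall>r\<in>{2, 4, 8, 16, 18, 26, 30, 32::int}. \<exists>u\<in>{1, 9, 13, 15, 19, 21, 25, 33}. r = u * 2 mod 34"
  "\<forall>r\<in>{1, 3, 5, 7, 9, 11, 13, 15, 19, 21, 23, 25, 27, 29, 31, 33::int}.
    \<exists>u\<in>{1, 9, 13, 15, 19, 21, 25, 33}. \<exists>c0\<in>{1, 3}. r = u * c0 mod 34"
  "\<forall>u\<in>{1, 9, 13, 15, 19, 21, 25, 33::int}. \<forall>c0\<in>{1, 3}. \<exists>k\<in>{0..<34}. u * c0 * k mod 34 = 1"
  by code_simp+

text \<open>Modulo 17 the two sets are the cosets of the quartic residues that make up the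
  non-residues, each given by its even lifts. The value 0 elsewhere lets the polar part be written
  uniformly for all vectors.\<close>

definition nonresidue_sign :: "int \<Rightarrow> complex" where
  "nonresidue_sign c = (if c mod 34 \<in> {6, 10, 24, 28} then 1 else if c mod 34 \<in> {12, 14, 20, 22} then - 1 else 0)"

lemma klein_quot_even_orbit:
  assumes t: "Im \<tau> > 0" and u: "u \<in> {1, 9, 13, 15, 19, 21, 25, 33}" and c: "[c = u * c0] (mod 34)" "even c0"
    and d: "odd d" "[c * s = d] (mod 17)"
  shows "klein_quot c d \<tau> = residue_sign u * klein_quot c0 17 (\<tau> + of_int s)"
proof (rule klein_quot_orbit[OF t _ u c(1)])
  have "odd u" using u by auto
  then have "[d = u * (c0 * s + 17)] (mod 2)"
    using c(2) d(1) by (auto simp: cong_def mod_2_eq_odd)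
  moreover have "[u * (c0 * s + 17) = d] (mod 17)"
  proof -
    have "[c = u * c0] (mod 17)" using c(1) by (rule cong_dvd_modulus) simp
    then have "[u * c0 * s = c * s] (mod 17)" by (intro cong_scalar_right) (simp add: cong_sym)
    then have "[u * c0 * s + 17 * u = c * s + 0] (mod 17)" by (intro cong_add) (simp_all add: cong_def)
    then have "[u * (c0 * s + 17) = c * s] (mod 17)" by (simp add: algebra_simps)
    then show ?thesis using d(2) by (rule cong_trans)
  qed
  ultimately have "[d = u * (c0 * s + 17)] (mod (2 * 17))"
    by (intro coprime_cong_mult) (simp_all add: cong_sym)
  then show "[d = u * (c0 * s + 17)] (mod 34)" by simp
qed simp

lemma klein_quot_even_nonresidue:
  assumes t: "Im \<tau> > 0" and c: "c mod 34 \<in> {6, 10, 12, 14, 20, 22, 24, 28}" and d: "odd d" "[c * s = d] (mod 17)"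
  shows "klein_quot c d \<tau> = nonresidue_sign c * klein_quot 6 17 (\<tau> + of_int s)"
proof -
  have *: "klein_quot c d \<tau> = residue_sign u * klein_quot 6 17 (\<tau> + of_int s)"
    if "u \<in> {1, 9, 13, 15, 19, 21, 25, 33}" "c mod 34 = (u * 6) mod 34" for u
    by (rule klein_quot_even_orbit[OF t that(1) _ _ d]) (simp_all add: cong_def that(2))
  obtain u where u: "u \<in> {1, 9, 13, 15, 19, 21, 25, 33}" "c mod 34 = u * 6 mod 34"
    "c mod 34 \<in> {6, 10, 24, 28} \<longleftrightarrow> u \<in> {1, 13, 21, 33}"
    using bspec[OF residue_orbits(1) c] by blast
  have "nonresidue_sign c = residue_sign u"
  proof (cases "u \<in> {1, 13, 21, 33}")
    case True
    then show ?thesis unfolding nonresidue_sign_def residue_sign_def u(3) by (simp only: if_True)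
  next
    case False
    then have "c mod 34 \<in> {12, 14, 20, 22}" using c u(3) by blast
    then show ?thesis unfolding nonresidue_sign_def residue_sign_def u(3) using False by (simp only: if_True if_False)
  qed
  then show ?thesis using *[OF u(1,2)] by simp
qed

lemma klein_quot_even_residue:
  assumes c: "c mod 34 \<in> {2, 4, 8, 16, 18, 26, 30, 32}" and d: "odd d" "[c * s = d] (mod 17)"
  shows "ord_ge (6/17) (klein_quot c d)"
proof -
  have *: "ord_ge (6/17) (klein_quot c d)"
    if u: "u \<in> {1, 9, 13, 15, 19, 21, 25, 33}" "c mod 34 = (u * 2) mod 34" for u
  proof -
    let ?G = "quot17 {1, 9, 13, 15} {3, 5, 6, 7, 10, 11, 12, 14}"
    have "ord_ge (9/17 + 0) (\<lambda>\<tau>. ee (of_real (9/17) * \<tau>) * ?G (ee (\<tau> / of_nat 17)))"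
      by (intro ord_ge_mult ord_ge_ee ord_ge_holomorphic holomorphic_quot17) auto
    then have "ord_ge (9/17) (\<lambda>\<tau>. - residue_sign u * (ee (of_real (9/17) * (\<tau> + of_int s)) * ?G (ee ((\<tau> + of_int s) / of_nat 17))))"
      by (intro ord_ge_cmult ord_ge_translate[of _ "\<lambda>\<tau>. ee (of_real (9/17) * \<tau>) * ?G (ee (\<tau> / of_nat 17))"]) simp
    then have "ord_ge (9/17) (klein_quot c d)"
    proof (rule ord_ge_cong)
      fix \<tau> :: complex assume t: "Im \<tau> > 0"
      have "klein_quot c d \<tau> = residue_sign u * klein_quot 2 17 (\<tau> + of_int s)"
        by (rule klein_quot_even_orbit[OF t u(1) _ _ d]) (simp_all add: cong_def u(2))
      then show "- residue_sign u * (ee (of_real (9/17) * (\<tau> + of_int s)) * ?G (ee ((\<tau> + of_int s) / of_nat 17))) = klein_quot c d \<tau>"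
        unfolding klein_quot_2_17 by simp
    qed
    then show ?thesis by (rule ord_ge_mono) simp
  qed
  show ?thesis
    using bspec[OF residue_orbits(2) c] * by blast
qed

lemma klein_quot_odd:
  assumes c: "odd c" "\<not> 17 dvd c"
  shows "ord_ge (6/17) (klein_quot c d)"
proof -
  have *: "ord_ge (6/17) (klein_quot c d)"
    if u: "u \<in> {1, 9, 13, 15, 19, 21, 25, 33}" "c0 \<in> {1, 3}" "c mod 34 = u * c0 mod 34" for u c0
  proof -
    \<comment> \<open>An odd first coordinate prime to 17 is invertible modulo 34, so a translation
      reaches any second coordinate from 0.\<close>
    obtain k where k: "u * c0 * k mod 34 = 1"
      using bspec[OF bspec[OF residue_orbits(4) u(1)] u(2)] by blast
    define s where "s = k * d"
    have "[u * c0 * k = 1] (mod 34)" using k by (simp add: cong_def)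
    from cong_scalar_right[OF this, of d] have s: "[d = u * (c0 * s + 0)] (mod 34)"
      by (simp add: s_def mult.assoc cong_sym)
    obtain E F where EF: "finite F" "F \<subseteq> {1..33}"
      "\<And>\<tau>. Im \<tau> > 0 \<Longrightarrow> klein_quot c0 0 \<tau> = ee (12 * \<tau> / 34) * quot34 E F (ee (\<tau> / 34))"
    proof (cases "c0 = 1")
      case True
      then show ?thesis
        using that[of "{3, 5, 6, 7, 10, 11, 12, 14}" "{1, 9, 13, 15}"] klein_quot_1_0 by auto
    next
      case False
      then show ?thesis
        using u(2) that[of "{1, 2, 4, 8, 9, 13, 15, 16}" "{3, 5, 7, 11}"] klein_quot_3_0 by auto
    qed
    have "ord_ge (12/34 + 0) (\<lambda>\<tau>. ee (of_real (12/34) * \<tau>) * quot34 E F (ee (\<tau> / of_nat 34)))"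
      by (intro ord_ge_mult ord_ge_ee ord_ge_holomorphic holomorphic_quot34 EF) auto
    then have "ord_ge (6/17) (\<lambda>\<tau>. residue_sign u * (ee (of_real (12/34) * (\<tau> + of_int s)) * quot34 E F (ee ((\<tau> + of_int s) / of_nat 34))))"
      by (intro ord_ge_cmult ord_ge_translate[of _ "\<lambda>\<tau>. ee (of_real (12/34) * \<tau>) * quot34 E F (ee (\<tau> / of_nat 34))"]) simp
    then show ?thesis
    proof (rule ord_ge_cong)
      fix \<tau> :: complex assume t: "Im \<tau> > 0"
      have A: "klein_quot c d \<tau> = residue_sign u * klein_quot c0 0 (\<tau> + of_int s)"
        by (rule klein_quot_orbit[OF t _ u(1) _ s]) (use u(2) in \<open>auto simp: cong_def u(3)\<close>)
      have B: "klein_quot c0 0 (\<tau> + of_int s) = ee (12 * (\<tau> + of_int s) / 34) * quot34 E F (ee ((\<tau> + of_int s) / 34))"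
        by (rule EF(3)) (use t in simp)
      have C: "of_real (12/34) * (\<tau> + of_int s) = 12 * (\<tau> + of_int s) / 34" by simp
      show "residue_sign u * (ee (of_real (12/34) * (\<tau> + of_int s)) * quot34 E F (ee ((\<tau> + of_int s) / of_nat 34))) = klein_quot c d \<tau>"
        unfolding A B C by simp
    qed
  qed
  show ?thesis
    using bspec[OF residue_orbits(3) residues_mod_34(1)[OF c(2,1)]] * by blast
qed

lemma ord_ge_holomorphic_diff:
  assumes "G holomorphic_on ball 0 1" "m > 0"
  shows "ord_ge (1 / real m) (\<lambda>\<tau>. G (ee (\<tau> / of_nat m)) - G 0)"
proof -
  obtain H where H: "H holomorphic_on ball 0 1" "\<And>x. x \<in> ball 0 1 \<Longrightarrow> G x = G 0 + x * H x"
    using holomorphic_factor_0[OF assms(1)] by blast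
  have "ord_ge (1 / real m + 0) (\<lambda>\<tau>. ee (of_real (1 / real m) * \<tau>) * H (ee (\<tau> / of_nat m)))"
    by (rule ord_ge_mult[OF ord_ge_ee ord_ge_holomorphic[OF H(1) assms(2)]])
  then have ord: "ord_ge (1 / real m) (\<lambda>\<tau>. ee (of_real (1 / real m) * \<tau>) * H (ee (\<tau> / of_nat m)))"
    by (simp only: add_0_right)
  show ?thesis
  proof (rule ord_ge_cong[OF ord])
    fix \<tau> :: complex assume "Im \<tau> > 0"
    from H(2)[OF ee_cusp_in_ball[OF this assms(2)]]
    have "G (ee (\<tau> / of_nat m)) - G 0 = ee (\<tau> / of_nat m) * H (ee (\<tau> / of_nat m))"
      by (simp only: add_diff_cancel_left')
    moreover have "of_real (1 / real m) * \<tau> = \<tau> / of_nat m" by simp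
    ultimately show "ee (of_real (1 / real m) * \<tau>) * H (ee (\<tau> / of_nat m)) = G (ee (\<tau> / of_nat m)) - G 0"
      by (simp only:)
  qed
qed

text \<open>These expansions run in powers of \<open>q^(1/2)\<close>, so after the constant term the
  next exponent is at least 1/2, which exceeds 6/17.\<close>

lemma klein_quot_div_17:
  assumes "primitive34 c d" "17 dvd c"
  shows "ord_ge (6/17) (\<lambda>\<tau>. klein_quot c d \<tau> - cusp_limit d)"
proof -
  have d: "\<not> 17 dvd d" using assms by (simp add: primitive34_def)
  have *: "ord_ge (6/17) (\<lambda>\<tau>. klein_quot c d \<tau> - cusp_limit d)"
    if F: "finite F" "finite F'"
      and eq: "\<And>\<tau>. Im \<tau> > 0 \<Longrightarrow> klein_quot c d \<tau> = cusp_limit d * quot2 d E E' F F' (ee (\<tau> / 2))" for E E' F F'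
  proof -
    have "ord_ge (1 / of_nat 2) (\<lambda>\<tau>. cusp_limit d * (quot2 d E E' F F' (ee (\<tau> / of_nat 2)) - quot2 d E E' F F' 0))"
      by (intro ord_ge_cmult ord_ge_holomorphic_diff holomorphic_quot2 F) simp
    then have "ord_ge (1 / of_nat 2) (\<lambda>\<tau>. klein_quot c d \<tau> - cusp_limit d)"
      by (rule ord_ge_cong) (simp add: eq algebra_simps)
    then show ?thesis by (rule ord_ge_mono) simp
  qed
  obtain k where k: "c = 17 * k" using assms(2) by blast
  show ?thesis
  proof (cases "even k")
    case False
    then obtain l where l: "k = 2 * l + 1" using oddE by blast
    have "klein_quot c d \<tau> = klein_quot 17 d \<tau>" if "Im \<tau> > 0" for \<tau>
      by (rule klein_quot_mod[OF that]) (simp_all add: k l cong_iff_dvd_diff)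
    then show ?thesis
      by (intro *[of "{3, 5, 7, 11}" "{6, 10, 12, 14}" "{1, 9, 13, 15}" "{}"]) (simp_all only: klein_quot_17 finite.intros)
  next
    case True
    then obtain l where l: "k = 2 * l" by blast
    have "odd d" using assms(1) by (auto simp: primitive34_def k l)
    have eq: "klein_quot c d \<tau> = klein_quot 0 d \<tau>" if "Im \<tau> > 0" for \<tau>
      by (rule klein_quot_mod[OF that]) (simp_all add: k l cong_iff_dvd_diff)
    have "klein_quot c d \<tau> = cusp_limit d * quot2 d {} {1, 9, 13, 15} {} {3, 5, 6, 7, 10, 11, 12, 14} (ee (\<tau> / 2))"
      if "Im \<tau> > 0" for \<tau>
      unfolding eq[OF that] klein_quot_0[OF that] cusp_limit_odd[OF \<open>odd d\<close> d] ..
    then show ?thesis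
      by (intro *[of "{}" "{3, 5, 6, 7, 10, 11, 12, 14}" "{}" "{1, 9, 13, 15}"]) (simp_all only: finite.intros)
  qed
qed

lemma nonresidue_sign_eq_0:
  assumes "17 dvd c \<or> odd c"
  shows "nonresidue_sign c = 0"
proof (rule ccontr)
  assume nz: "nonresidue_sign c \<noteq> 0"
  have "c mod 34 \<in> {6, 10, 24, 28} \<or> c mod 34 \<in> {12, 14, 20, 22}"
  proof (rule ccontr)
    assume "\<not> ?thesis"
    then have "nonresidue_sign c = 0"
      unfolding nonresidue_sign_def by (simp only: de_Morgan_disj if_False)
    with nz show False ..
  qed
  then have "c mod 34 \<in> {6, 10, 12, 14, 20, 22, 24, 28}" by blast
  then have "c mod 34 mod 17 \<noteq> 0 \<and> c mod 34 mod 2 = 0" by (elim insertE) simp_all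
  moreover have "c mod 34 mod 17 = c mod 17" "c mod 34 mod 2 = c mod 2"
    by (simp_all add: mod_mod_cancel)
  ultimately have "c mod 17 \<noteq> 0" "c mod 2 = 0" by metis+
  then show False
    using assms dvd_imp_mod_0[of 17 c] odd_iff_mod_2_eq_one[of c] by linarith
qed

text \<open>All terms below 6/17 other than constants come from translates of the single quotient at
  (6, 17). Hence one \<gamma> serves all vectors and can be taken out of the twisted sum.\<close>

lemma klein_quot_asymptotic:
  obtains \<gamma> where "\<And>c d s. primitive34 c d \<Longrightarrow> 17 dvd c \<or> [c * s = d] (mod 17) \<Longrightarrow>
    ord_ge (6/17) (\<lambda>\<tau>. klein_quot c d \<tau> - (if 17 dvd c then cusp_limit d else 0) +
      nonresidue_sign c * (ee (3 * (\<tau> + of_int s) / 17) + \<gamma> * ee (5 * (\<tau> + of_int s) / 17)))"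
proof -
  obtain \<gamma> where \<gamma>: "ord_ge (6/17) (\<lambda>\<tau>. klein_quot 6 17 \<tau> + (ee (3 * \<tau> / 17) + \<gamma> * ee (5 * \<tau> / 17)))"
    using klein_quot_6_17_asymptotic by blast
  have "ord_ge (6/17) (\<lambda>\<tau>. klein_quot c d \<tau> - (if 17 dvd c then cusp_limit d else 0) +
      nonresidue_sign c * (ee (3 * (\<tau> + of_int s) / 17) + \<gamma> * ee (5 * (\<tau> + of_int s) / 17)))"
    if primitive34: "primitive34 c d" and s: "17 dvd c \<or> [c * s = d] (mod 17)" for c d s
  proof (cases "17 dvd c")
    case True
    then show ?thesis using klein_quot_div_17[OF primitive34 True] by (simp add: nonresidue_sign_eq_0)
  next
    case c17: False
    then have s: "[c * s = d] (mod 17)" using s by blast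
    show ?thesis
    proof (cases "odd c")
      case True
      then show ?thesis using klein_quot_odd[OF True c17] c17 by (simp add: nonresidue_sign_eq_0)
    next
      case False
      then have "odd d" using primitive34 by (simp add: primitive34_def)
      consider "c mod 34 \<in> {2, 4, 8, 16, 18, 26, 30, 32}" | "c mod 34 \<in> {6, 10, 12, 14, 20, 22, 24, 28}"
        using residues_mod_34(2)[OF c17] False by blast
      then show ?thesis
      proof cases
        case 1
        then have "nonresidue_sign c = 0" unfolding nonresidue_sign_def by (elim insertE emptyE) simp_all
        then show ?thesis using klein_quot_even_residue[OF 1 \<open>odd d\<close> s] c17 by simp
      next
        case 2
        from ord_ge_cmult[OF ord_ge_translate[OF \<gamma>, of s], of "nonresidue_sign c"] show ?thesis
          by (rule ord_ge_cong)
            (simp add: klein_quot_even_nonresidue[OF _ 2 \<open>odd d\<close> s] c17 algebra_simps)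
      qed
    qed
  qed
  then show ?thesis using that by blast
qed

section \<open>Cancellation of the polar terms\<close>

definition twisted_sum :: "int \<Rightarrow> int \<Rightarrow> int \<Rightarrow> int \<Rightarrow> int \<Rightarrow> complex \<Rightarrow> complex" where
  "twisted_sum R v1 v2 w1 w2 \<tau> =
    (\<Sum>j<34::nat. ee (of_int (- int j * R) / 34) * klein_quot (v1 + int j * w1) (v2 + int j * w2) \<tau>)"

lemma primitive34_of_det:
  assumes "[v1 * w2 - v2 * w1 = 1] (mod 34)"
  shows "primitive34 (v1 + j * w1) (v2 + j * w2)"
proof -
  have det: "(v1 + j * w1) * w2 - (v2 + j * w2) * w1 = v1 * w2 - v2 * w1"
    by (simp add: algebra_simps)
  have *: "\<not> (p dvd v1 + j * w1 \<and> p dvd v2 + j * w2)" if "p dvd 34" "\<not> p dvd 1" for p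
  proof
    assume "p dvd v1 + j * w1 \<and> p dvd v2 + j * w2"
    then have "p dvd v1 * w2 - v2 * w1"
      unfolding det[symmetric] by (intro dvd_diff dvd_mult2) auto
    moreover have "[v1 * w2 - v2 * w1 = 1] (mod p)"
      using assms that(1) by (rule cong_dvd_modulus)
    ultimately show False using that(2) cong_dvd_iff by blast
  qed
  show ?thesis
    unfolding primitive34_def using *[of 2] *[of 17] by simp
qed

lemma cusp_limit_add_mult_17: "cusp_limit (d + 17 * w) = cusp_limit d"
proof -
  have nat: "cusp_limit (d + 17 * int n) = cusp_limit d" for n d
  proof (induction n)
    case (Suc n)
    then show ?case using cusp_limit_add_17[of "d + 17 * int n"] by (simp add: algebra_simps)
  qed simp
  show ?thesis
  proof (cases "w \<ge> 0")
    case True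
    then show ?thesis using nat[of d "nat w"] by simp
  next
    case False
    then show ?thesis using nat[of "d + 17 * w" "nat (- w)"] by simp
  qed
qed

lemma sum_34_halves: "(\<Sum>j<34::nat. f j) = (\<Sum>j<17. f j + f (j + 17))" for f :: "nat \<Rightarrow> complex"
proof -
  have "(\<Sum>j<34::nat. f j) = (\<Sum>j\<in>{..<17}. f j) + (\<Sum>j\<in>{17..<34}. f j)"
    by (subst sum.union_disjoint[symmetric]) (auto intro: sum.cong)
  also have "(\<Sum>j\<in>{17..<34}. f j) = (\<Sum>j<17. f (j + 17))"
    by (rule sum.reindex_bij_witness[of _ "\<lambda>j. j + 17" "\<lambda>j. j - 17"]) auto
  finally show ?thesis by (simp add: sum.distrib)
qed

lemma sum_34_parity: "(\<Sum>j<34::nat. f j) = (\<Sum>i<17. f (2 * i) + f (2 * i + 1))" for f :: "nat \<Rightarrow> complex"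
proof -
  have *: "(\<Sum>j\<in>{i * 2..<i * 2 + 2}. f j) = f (2 * i) + f (2 * i + 1)" for i
    by (simp add: numeral_2_eq_2 mult.commute)
  have "(\<Sum>j<17*2. f j) = (\<Sum>i<17. \<Sum>j\<in>{i * 2..<i * 2 + 2}. f j)"
    by (rule sum.nat_group[symmetric])
  then show ?thesis unfolding * by simp
qed

text \<open>The terms \<open>j\<close> and \<open>j + 17\<close> have the same limit at the cusp,
  while their roots of unity are opposite because \<open>R\<close> is odd.\<close>

lemma constant_terms_cancel:
  assumes "odd R"
  shows "(\<Sum>j<34::nat. ee (of_int (- int j * R) / 34) *
    (if 17 dvd v1 + int j * w1 then cusp_limit (v2 + int j * w2) else 0)) = 0"
  unfolding sum_34_halves
proof (rule sum.neutral, rule ballI)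
  fix j :: nat
  have 1: "ee (of_int (- int (j + 17) * R) / 34) = - ee (of_int (- int j * R) / 34)"
  proof -
    have "of_int (- int (j + 17) * R) / 34 = of_int (- int j * R) / 34 + (of_int (- R) / 2 :: complex)"
      by (simp add: field_simps)
    then show ?thesis using assms by (simp only: ee_add ee_of_int_half) simp
  qed
  have 2: "17 dvd v1 + int (j + 17) * w1 \<longleftrightarrow> 17 dvd v1 + int j * w1"
  proof -
    have "v1 + int (j + 17) * w1 = (v1 + int j * w1) + 17 * w1" by (simp add: algebra_simps)
    then show ?thesis by (simp only: dvd_add_left_iff dvd_triv_left)
  qed
  have 3: "cusp_limit (v2 + int (j + 17) * w2) = cusp_limit (v2 + int j * w2)"
    using cusp_limit_add_mult_17[of "v2 + int j * w2" w2] by (simp add: algebra_simps)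
  show "ee (of_int (- int j * R) / 34) * (if 17 dvd v1 + int j * w1 then cusp_limit (v2 + int j * w2) else 0) +
    ee (of_int (- int (j + 17) * R) / 34) *
      (if 17 dvd v1 + int (j + 17) * w1 then cusp_limit (v2 + int (j + 17) * w2) else 0) = 0"
    unfolding 1 2 3 by simp
qed

text \<open>By Fermat \<open>r ^ 15\<close> inverts \<open>r\<close>. In the second part,
  \<open>2 k / R\<close> is a quartic residue modulo 17, whereas the square of a non-residue is not,
  so \<open>2 k b^2\<close> cannot equal \<open>R\<close>.\<close>

lemma nonresidue_inverse:
  "\<forall>r\<in>{6, 10, 12, 14, 20, 22, 24, 28::int}. r * (r ^ 15 mod 17) mod 17 = 1"
  "\<forall>r\<in>{6, 10, 12, 14, 20, 22, 24, 28::int}. \<forall>R\<in>{7, 11, 23, 27}. \<forall>k\<in>{3, 5}.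
    (2 * k * (r ^ 15 mod 17)\<^sup>2 - R) mod 17 \<noteq> 0"
  by code_simp+

lemma nonresidue_sign_nonzeroD: "nonresidue_sign c \<noteq> 0 \<Longrightarrow> c mod 34 \<in> {6, 10, 12, 14, 20, 22, 24, 28}"
  by (auto simp: nonresidue_sign_def split: if_splits)

lemma nonresidue_sign_mod: "nonresidue_sign (c mod 34) = nonresidue_sign c"
  by (simp add: nonresidue_sign_def)

lemma ee_cong_numeral:
  "[a = b] (mod numeral m) \<Longrightarrow> ee (of_int a / numeral m) = ee (of_int b / numeral m)"
  using ee_cong[of a b "numeral m"] by simp

text \<open>
  \<open>r ^ 15\<close> is the inverse of \<open>r\<close> modulo 17; the substitution of \<open>2 k / (R r)\<close> for \<open>r\<close> fixes the
  exponent but flips the sign.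
\<close>

lemma kloosterman_vanish:
  assumes R: "R \<in> {7, 11, 23, 27}" and k: "k \<in> {3, 5}"
  shows "(\<Sum>r\<in>{0..<34::int}. nonresidue_sign r * ee (of_int (y * (R * r + 2 * k * (r ^ 15 mod 17))) / 34)) = 0"
proof -
  define z where "z = (\<lambda>n. ee (of_int (y * n) / 34))"
  have z: "z n = z (n mod 34)" for n
    unfolding z_def using ee_cong[of "y * n" "y * (n mod 34)" 34] by (simp add: cong_def mod_mult_right_eq)
  have "(\<Sum>r\<in>{0..<34::int}. nonresidue_sign r * z (R * r + 2 * k * (r ^ 15 mod 17))) =
    (\<Sum>r\<in>{6, 10, 12, 14, 20, 22, 24, 28}. nonresidue_sign r * z (R * r + 2 * k * (r ^ 15 mod 17)))"
  proof (rule sum.mono_neutral_right)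
    show "\<forall>r\<in>{0..<34} - {6, 10, 12, 14, 20, 22, 24, 28}. nonresidue_sign r * z (R * r + 2 * k * (r ^ 15 mod 17)) = 0"
      using nonresidue_sign_nonzeroD by fastforce
  qed auto
  \<comment> \<open>After reduction of the exponents modulo 34, paired terms have the same value of
    \<open>z\<close> and opposite signs, so they cancel whatever \<open>y\<close> is.\<close>
  also have "\<dots> = (\<Sum>r\<in>{6, 10, 12, 14, 20, 22, 24, 28}. nonresidue_sign r * z ((R * r + 2 * k * (r ^ 15 mod 17)) mod 34))"
    using z by (intro sum.cong refl arg_cong2[of _ _ _ _ "(*)"]) blast
  also have "\<dots> = 0"
    using R k by (elim insertE emptyE) (simp_all add: nonresidue_sign_def)
  finally show ?thesis unfolding z_def .
qed

lemma sum_roots_of_unity_17: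
  assumes "m mod 17 \<noteq> 0"
  shows "(\<Sum>i<17::nat. ee (of_int (int i * m) / 17)) = 0"
proof -
  have "ee (of_int m / 17) \<noteq> 1"
    using ee_eq_1_frac[of 17 m] assms by auto
  moreover have "ee (of_int m / 17) ^ 17 = 1" by (simp add: ee_power)
  moreover have "ee (of_int (int i * m) / 17) = ee (of_int m / 17) ^ i" for i
    by (simp add: ee_power)
  ultimately show ?thesis
    by (simp add: geometric_sum)
qed

text \<open>The cases follow the movement of the first coordinate \<open>v1 + j w1\<close> modulo
  34. For even \<open>w1\<close> it is always odd, and every sign is 0. If \<open>w1\<close> is a
  unit, it runs through all classes and the sum is a multiple of the Kloosterman-like sum. If
  \<open>w1\<close> is an odd multiple of 17, it takes one value for each parity of
  \<open>j\<close>, and what remains is a sum of 17th roots of unity.\<close>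

lemma polar_terms_cancel:
  assumes R: "R \<in> {7, 11, 23, 27}" and k: "k \<in> {3, 5}"
    and det: "[v1 * w2 - v2 * w1 = 1] (mod 34)"
    and t: "\<And>j. 17 dvd v1 + int j * w1 \<or> [(v1 + int j * w1) * t j = v2 + int j * w2] (mod 17)"
  shows "(\<Sum>j<34::nat. ee (of_int (- int j * R) / 34) * (nonresidue_sign (v1 + int j * w1) * ee (of_int (k * t j) / 17))) = 0"
    (is "sum ?F _ = 0")
proof -
  have det17: "[v1 * w2 - v2 * w1 = 1] (mod 17)" using det by (rule cong_dvd_modulus) simp
  have t': "[(v1 + int j * w1) * t j = v2 + int j * w2] (mod 17)" if "nonresidue_sign (v1 + int j * w1) \<noteq> 0" for j
    using t[of j] nonresidue_sign_eq_0[of "v1 + int j * w1"] that by auto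
  consider "even w1" | "odd w1" "\<not> 17 dvd w1" | "odd w1" "17 dvd w1" by blast
  then show ?thesis
  proof cases
    case 1
    have "odd (v1 * w2 - v2 * w1)"
      using cong_dvd_iff[OF cong_dvd_modulus[OF det, of 2]] by simp
    with 1 have "odd v1" by auto
    with 1 have "nonresidue_sign (v1 + int j * w1) = 0" for j by (intro nonresidue_sign_eq_0) auto
    then show ?thesis by simp
  next
    case 2
    have "coprime w1 2" using 2(1) by (simp add: coprime_right_2_iff_odd)
    moreover have "coprime w1 17"
      using prime_imp_coprime[of "17::int" w1] 2(2) by (simp add: coprime_commute)
    ultimately have "coprime w1 (2 * 17)" by (rule coprime_mult_right_iff[THEN iffD2, OF conjI])
    then obtain y where y: "[w1 * y = 1] (mod 34)" using cong_solve_coprime_int by auto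
    then have y17: "[w1 * y = 1] (mod 17)" by (rule cong_dvd_modulus) simp
    define A where "A = ee (of_int (v1 * y * R + 2 * k * (y * w2)) / 34)"
    define \<Phi> where "\<Phi> = (\<lambda>r. A * (nonresidue_sign r * ee (of_int (- y * (R * r + 2 * k * (r ^ 15 mod 17))) / 34)))"
    have F: "?F j = \<Phi> ((v1 + int j * w1) mod 34)" for j
    proof (cases "nonresidue_sign (v1 + int j * w1) = 0")
      case True
      then show ?thesis by (simp add: \<Phi>_def nonresidue_sign_mod)
    next
      case nz: False
      define c d where "c = v1 + int j * w1" and "d = v2 + int j * w2"
      define r where "r = c mod 34"
      define b where "b = r ^ 15 mod 17"
      have r: "r \<in> {6, 10, 12, 14, 20, 22, 24, 28}"
        using nonresidue_sign_nonzeroD nz by (simp add: r_def c_def)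
      have "r * b mod 17 = 1" unfolding b_def using bspec[OF nonresidue_inverse(1) r] .
      then have "[r * b = 1] (mod 17)" by (simp add: cong_def)
      moreover have "[c = r] (mod 17)" by (simp add: r_def cong_def mod_mod_cancel)
      ultimately have cb: "[c * b = 1] (mod 17)" by (meson cong_scalar_right cong_trans)
      have ct: "[c * t j = d] (mod 17)" using t'[OF nz] by (simp add: c_def d_def)
      have cd: "[c * w2 - d * w1 = 1] (mod 17)"
        using det17 by (simp add: c_def d_def algebra_simps)
      \<comment> \<open>Modulo 17, \<open>t j = d b\<close> and \<open>d = y (c w2 - 1)\<close>,
        hence \<open>t j = y (w2 - b)\<close>. With the congruences written as equations this
        becomes one explicit linear combination.\<close>
      obtain a1 a2 a3 a4 where eqs: "1 = c * b + 17 * a1" "d = c * t j + 17 * a2" "1 = c * w2 - d * w1 + 17 * a3" "1 = w1 * y + 17 * a4"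
        using cb ct cd y17 unfolding cong_iff_lin by blast
      have "t j - y * (w2 - b) - 17 * (t j * a1 - b * a2 + b * d * a4 + b * y * a3 - a1 * y * w2) =
          (t j - y * w2) * (1 - (c * b + 17 * a1)) - b * (d - (c * t j + 17 * a2)) +
          b * y * (1 - (c * w2 - d * w1 + 17 * a3)) + b * d * (1 - (w1 * y + 17 * a4))"
        by (simp add: algebra_simps)
      also have "\<dots> = 0"
        unfolding eqs(1,3,4)[symmetric] eqs(2)[symmetric] by simp
      finally have "t j - y * (w2 - b) = 17 * (t j * a1 - b * a2 + b * d * a4 + b * y * a3 - a1 * y * w2)" by simp
      then have tj: "[k * t j = k * (y * (w2 - b))] (mod 17)"
        by (intro cong_scalar_left) (simp add: cong_iff_dvd_diff)
      have "[r = c] (mod 34)" by (simp add: r_def cong_def)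
      then have "[(r - v1) * y = (c - v1) * y] (mod 34)" by (intro cong_scalar_right cong_diff cong_refl)
      also have "(c - v1) * y = int j * (w1 * y)" by (simp add: c_def)
      also have "[int j * (w1 * y) = int j * 1] (mod 34)" by (intro cong_scalar_left y)
      finally have "[int j = (r - v1) * y] (mod 34)" by (simp add: cong_sym)
      then have "[- int j * R = - ((r - v1) * y) * R] (mod 34)"
        by (intro cong_scalar_right) (simp add: cong_minus_minus_iff)
      then have 1: "ee (of_int (- int j * R) / 34) = ee (of_int (- ((r - v1) * y) * R) / 34)"
        by (rule ee_cong_numeral)
      have 2: "ee (of_int (k * t j) / 17) = ee (of_int (k * (y * (w2 - b))) / 17)"
        using tj by (rule ee_cong_numeral)
      have "of_int (- ((r - v1) * y) * R) / 34 + of_int (k * (y * (w2 - b))) / 17 =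
        of_int (v1 * y * R + 2 * k * (y * w2)) / 34 + (of_int (- y * (R * r + 2 * k * b)) / 34 :: complex)"
        by (simp add: field_simps)
      then have 3: "ee (of_int (- ((r - v1) * y) * R) / 34) * ee (of_int (k * (y * (w2 - b))) / 17) =
        A * ee (of_int (- y * (R * r + 2 * k * b)) / 34)"
        unfolding A_def ee_add[symmetric] by (rule arg_cong)
      have "?F j = nonresidue_sign r * (ee (of_int (- ((r - v1) * y) * R) / 34) * ee (of_int (k * (y * (w2 - b))) / 17))"
        unfolding 1 2 r_def nonresidue_sign_mod c_def by (simp only: mult_ac)
      also have "\<dots> = \<Phi> r"
        unfolding 3 unfolding \<Phi>_def b_def by (simp only: mult.left_commute)
      finally show ?thesis
        unfolding r_def c_def .
    qed
    have inj: "inj_on (\<lambda>j::nat. (v1 + int j * w1) mod 34) {..<34}"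
    proof (rule inj_onI)
      fix i j :: nat assume ij: "i \<in> {..<34}" "j \<in> {..<34}" and "(v1 + int i * w1) mod 34 = (v1 + int j * w1) mod 34"
      then have "[v1 + int i * w1 = v1 + int j * w1] (mod 34)" by (simp add: cong_def)
      then have "[int i * w1 = int j * w1] (mod 34)" by (simp add: cong_add_lcancel)
      then have "[int i * w1 * y = int j * w1 * y] (mod 34)" by (rule cong_scalar_right)
      moreover have "[int n * w1 * y = int n * 1] (mod 34)" for n
        using cong_scalar_left[OF y, of "int n"] by (simp add: mult.assoc)
      ultimately have "[int i = int j] (mod 34)" by (metis cong_sym cong_trans mult_1_right)
      then show "i = j" using ij by (simp add: cong_def)
    qed
    have "(\<lambda>j::nat. (v1 + int j * w1) mod 34) ` {..<34} = {0..<34}"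
      by (rule card_subset_eq) (use card_image[OF inj] in auto)
    then have bij: "bij_betw (\<lambda>j::nat. (v1 + int j * w1) mod 34) {..<34} {0..<34}"
      using inj by (simp add: bij_betw_def)
    have "sum ?F {..<34} = (\<Sum>r\<in>{0..<34}. \<Phi> r)"
      unfolding F by (rule sum.reindex_bij_betw[OF bij])
    also have "\<dots> = 0"
      unfolding \<Phi>_def sum_distrib_left[symmetric] kloosterman_vanish[OF R k] by simp
    finally show ?thesis .
  next
    case 3
    obtain m where m: "w1 = 17 * m" using 3(2) by blast
    with 3(1) have "odd m" by auto
    \<comment> \<open>The parity of \<open>j\<close> for which the first coordinate is even; the
      other parity has sign 0.\<close>
    define p :: nat where "p = (if even v1 then 0 else 1)"
    define c where "c = (v1 + 17 * int p) mod 34"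
    define b where "b = c ^ 15 mod 17"
    have even_case: "nonresidue_sign (v1 + int (2 * i + p) * w1) = nonresidue_sign c" for i
    proof -
      obtain l where l: "m = 2 * l + 1" using \<open>odd m\<close> oddE by blast
      have "v1 + int (2 * i + p) * w1 = v1 + 17 * int p + 34 * (int i * m + int p * l)"
        by (simp add: m l algebra_simps)
      then have "(v1 + int (2 * i + p) * w1) mod 34 = c" unfolding c_def by (simp only: mod_mult_self2)
      then show ?thesis by (metis nonresidue_sign_mod)
    qed
    have odd_case: "nonresidue_sign (v1 + int (2 * i + (1 - p)) * w1) = 0" for i
      by (rule nonresidue_sign_eq_0) (use 3 in \<open>auto simp: p_def\<close>)
    have "sum ?F {..<34} = (\<Sum>i<17. ?F (2 * i + p))"
    proof -
      have "?F (2 * i) + ?F (2 * i + 1) = ?F (2 * i + p)" for i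
        using odd_case[of i] by (cases "even v1") (auto simp: p_def)
      then show ?thesis unfolding sum_34_parity by (simp only:)
    qed
    also have "\<dots> = 0"
    proof (cases "nonresidue_sign c = 0")
      case True
      then show ?thesis unfolding even_case by simp
    next
      case nz: False
      have c: "c \<in> {6, 10, 12, 14, 20, 22, 24, 28}"
        using nonresidue_sign_nonzeroD[OF nz] by (simp add: c_def)
      have "c * b mod 17 = 1" unfolding b_def using bspec[OF nonresidue_inverse(1) c] .
      then have "[c * b = 1] (mod 17)" by (simp add: cong_def)
      moreover have "[v1 = c] (mod 17)"
        by (simp add: c_def cong_def mod_mod_cancel)
      ultimately have vb: "[v1 * b = 1] (mod 17)" by (meson cong_scalar_right cong_trans)
      define A where "A = nonresidue_sign c * ee (of_int (- int p * R + 2 * k * (b * v2 + int p * b\<^sup>2)) / 34)"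
      have "?F (2 * i + p) = A * ee (of_int (int i * (2 * k * b\<^sup>2 - R)) / 17)" for i
      proof -
        define j where "j = 2 * i + p"
        have "[(v1 + int j * w1) * t j = v2 + int j * w2] (mod 17)"
          unfolding j_def by (rule t') (unfold even_case, rule nz)
        then obtain a1 a2 a3 where eqs: "1 = v1 * b + 17 * a1" "v2 + int j * w2 = (v1 + int j * w1) * t j + 17 * a2"
          "1 = v1 * w2 - v2 * w1 + 17 * a3"
          using vb det17 unfolding cong_iff_lin by blast
        have "t j - (b * v2 + int j * b\<^sup>2) - 17 * (t j * a1 - b * int j * m * t j - b * a2 + int j * b * (w2 * a1 - b * a3 + b * v2 * m)) =
            (t j + int j * b * w2) * (1 - (v1 * b + 17 * a1)) -
            b * (v2 + int j * w2 - ((v1 + int j * (17 * m)) * t j + 17 * a2)) -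
            int j * b\<^sup>2 * (1 - (v1 * w2 - v2 * (17 * m) + 17 * a3))"
          by (simp add: algebra_simps power2_eq_square)
        also have "\<dots> = 0"
          unfolding m[symmetric] eqs(1,3)[symmetric] eqs(2)[symmetric] by simp
        finally have "t j - (b * v2 + int j * b\<^sup>2) = 17 * (t j * a1 - b * int j * m * t j - b * a2 + int j * b * (w2 * a1 - b * a3 + b * v2 * m))" by simp
        then have "[k * t j = k * (b * v2 + int j * b\<^sup>2)] (mod 17)"
          by (intro cong_scalar_left) (simp add: cong_iff_dvd_diff)
        then have 1: "ee (of_int (k * t j) / 17) = ee (of_int (k * (b * v2 + int j * b\<^sup>2)) / 17)"
          by (rule ee_cong_numeral)
        have "of_int (- int j * R) / 34 + of_int (k * (b * v2 + int j * b\<^sup>2)) / 17 =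
          of_int (- int p * R + 2 * k * (b * v2 + int p * b\<^sup>2)) / 34 + (of_int (int i * (2 * k * b\<^sup>2 - R)) / 17 :: complex)"
          by (simp add: j_def field_simps)
        then have "ee (of_int (- int j * R) / 34) * ee (of_int (k * (b * v2 + int j * b\<^sup>2)) / 17) =
          ee (of_int (- int p * R + 2 * k * (b * v2 + int p * b\<^sup>2)) / 34) * ee (of_int (int i * (2 * k * b\<^sup>2 - R)) / 17)"
          unfolding ee_add[symmetric] by (rule arg_cong)
        moreover have "nonresidue_sign (v1 + int j * w1) = nonresidue_sign c"
          unfolding j_def by (rule even_case)
        ultimately show ?thesis
          unfolding A_def j_def[symmetric] 1 by (simp only: mult.left_commute mult.assoc)
      qed
      moreover have "(\<Sum>i<17::nat. ee (of_int (int i * (2 * k * b\<^sup>2 - R)) / 17)) = 0"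
        using bspec[OF bspec[OF bspec[OF nonresidue_inverse(2) c] R] k]
        by (intro sum_roots_of_unity_17) (simp add: b_def)
      ultimately show ?thesis
        by (simp only: sum_distrib_left[symmetric]) simp
    qed
    finally show ?thesis .
  qed
qed

lemma twisted_sum_ord_ge:
  assumes R: "R \<in> {7, 11, 23, 27}" and det: "[v1 * w2 - v2 * w1 = 1] (mod 34)"
  shows "ord_ge (6/17) (twisted_sum R v1 v2 w1 w2)"
proof -
  obtain \<gamma> where \<gamma>: "\<And>c d s. primitive34 c d \<Longrightarrow> 17 dvd c \<or> [c * s = d] (mod 17) \<Longrightarrow>
    ord_ge (6/17) (\<lambda>\<tau>. klein_quot c d \<tau> - (if 17 dvd c then cusp_limit d else 0) +
      nonresidue_sign c * (ee (3 * (\<tau> + of_int s) / 17) + \<gamma> * ee (5 * (\<tau> + of_int s) / 17)))"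
    using klein_quot_asymptotic by blast
  define c d where "c = (\<lambda>j::nat. v1 + int j * w1)" and "d = (\<lambda>j::nat. v2 + int j * w2)"
  \<comment> \<open>If 17 divides \<open>c j\<close>, the polar sign is 0 and any translation will
    do.\<close>
  have "\<exists>s. 17 dvd c j \<or> [c j * s = d j] (mod 17)" for j
  proof (cases "17 dvd c j")
    case False
    then have "coprime (c j) 17"
      using prime_imp_coprime[of "17::int" "c j"] by (simp add: coprime_commute)
    then obtain x where "[c j * x = 1] (mod 17)" using cong_solve_coprime_int by blast
    then have "[c j * x * d j = 1 * d j] (mod 17)" by (rule cong_scalar_right)
    then show ?thesis by (intro exI[of _ "x * d j"]) (simp add: mult.assoc)
  qed auto
  then obtain t where t: "\<And>j. 17 dvd c j \<or> [c j * t j = d j] (mod 17)" by metis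
  define e where "e = (\<lambda>j::nat. ee (of_int (- int j * R) / 34))"
  define K where "K = (\<lambda>j. if 17 dvd c j then cusp_limit (d j) else 0)"
  have "ord_ge (6/17) (\<lambda>\<tau>. \<Sum>j<34. e j * (klein_quot (c j) (d j) \<tau> - K j +
      nonresidue_sign (c j) * (ee (3 * (\<tau> + of_int (t j)) / 17) + \<gamma> * ee (5 * (\<tau> + of_int (t j)) / 17))))"
    unfolding K_def using t by (intro ord_ge_sum ord_ge_cmult \<gamma>) (auto simp: c_def d_def intro!: primitive34_of_det det)
  then show ?thesis
  proof (rule ord_ge_cong)
    fix \<tau> :: complex
    define S where "S = (\<lambda>k. \<Sum>j<34. e j * (nonresidue_sign (c j) * ee (of_int (k * t j) / 17)))"
    have S: "S 3 = 0" "S 5 = 0"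
      unfolding S_def e_def c_def using t by (intro polar_terms_cancel[OF R _ det]; simp add: c_def d_def)+
    have K0: "(\<Sum>j<34. e j * K j) = 0"
      unfolding e_def K_def c_def d_def by (rule constant_terms_cancel) (use R in auto)
    have split: "ee (of_int k * (\<tau> + of_int s) / 17) = ee (of_int k * \<tau> / 17) * ee (of_int (k * s) / 17)" for k s
      unfolding ee_add[symmetric] by (intro arg_cong[of _ _ ee]) (simp add: field_simps)
    have "(\<Sum>j<34. e j * (klein_quot (c j) (d j) \<tau> - K j +
        nonresidue_sign (c j) * (ee (3 * (\<tau> + of_int (t j)) / 17) + \<gamma> * ee (5 * (\<tau> + of_int (t j)) / 17)))) =
      (\<Sum>j<34. e j * klein_quot (c j) (d j) \<tau> - e j * K j +
        (ee (3 * \<tau> / 17) * (e j * (nonresidue_sign (c j) * ee (of_int (3 * t j) / 17))) +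
        \<gamma> * ee (5 * \<tau> / 17) * (e j * (nonresidue_sign (c j) * ee (of_int (5 * t j) / 17)))))"
      using split[of 3] split[of 5] by (intro sum.cong refl) (simp add: algebra_simps)
    also have "\<dots> = (\<Sum>j<34. e j * klein_quot (c j) (d j) \<tau>) - (\<Sum>j<34. e j * K j) +
        (ee (3 * \<tau> / 17) * S 3 + \<gamma> * ee (5 * \<tau> / 17) * S 5)"
      unfolding S_def sum.distrib sum_subtractf sum_distrib_left ..
    finally show "(\<Sum>j<34. e j * (klein_quot (c j) (d j) \<tau> - K j +
        nonresidue_sign (c j) * (ee (3 * (\<tau> + of_int (t j)) / 17) + \<gamma> * ee (5 * (\<tau> + of_int (t j)) / 17)))) =
      twisted_sum R v1 v2 w1 w2 \<tau>"
      unfolding S K0 by (simp add: twisted_sum_def e_def c_def d_def)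
  qed
qed

section \<open>The maximum principle\<close>

text \<open>The base region contains the usual fundamental domain, but its lower bound 1/2 is more
  convenient: below it, an inversion after reduction of the real part at least doubles the imaginary
  part. Induction on powers of 2 then suffices.\<close>

lemma upper_half_plane_induct:
  assumes base: "\<And>\<tau>. \<bar>Re \<tau>\<bar> \<le> 1/2 \<Longrightarrow> Im \<tau> \<ge> 1/2 \<Longrightarrow> P \<tau>"
    and plus: "\<And>\<tau>. Im \<tau> > 0 \<Longrightarrow> P \<tau> \<Longrightarrow> P (\<tau> + 1)" and minus: "\<And>\<tau>. Im \<tau> > 0 \<Longrightarrow> P \<tau> \<Longrightarrow> P (\<tau> - 1)"
    and S: "\<And>\<tau>. Im \<tau> > 0 \<Longrightarrow> P \<tau> \<Longrightarrow> P (- 1 / \<tau>)"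
    and "Im \<tau> > 0"
  shows "P \<tau>"
proof -
  have shift: "P (\<tau> + of_int k)" if "P \<tau>" "Im \<tau> > 0" for \<tau> k
    using that
  proof (induction k rule: int_induct[where k = 0])
    case (step1 i)
    then show ?case using plus[of "\<tau> + of_int i"] by (simp add: add_ac)
  next
    case (step2 i)
    then show ?case using minus[of "\<tau> + of_int i"] by (simp add: add_diff_eq)
  qed simp
  have main: "P \<tau>" if "Im \<tau> \<ge> (1/2) ^ Suc n" for n \<tau>
    using that
  proof (induction n arbitrary: \<tau>)
    case 0
    define \<sigma> where "\<sigma> = \<tau> - of_int (round (Re \<tau>))"
    have "\<bar>Re \<sigma>\<bar> \<le> 1/2" using of_int_round_abs_le[of "Re \<tau>"] by (simp add: \<sigma>_def abs_minus_commute)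
    with 0 have "P \<sigma>" by (intro base) (auto simp: \<sigma>_def)
    then show ?case using shift[of \<sigma> "round (Re \<tau>)"] 0 by (simp add: \<sigma>_def)
  next
    case (Suc n)
    have pos: "Im \<tau> > 0" using Suc.prems zero_less_power[of "1/2::real" "Suc (Suc n)"] by linarith
    define \<sigma> where "\<sigma> = \<tau> - of_int (round (Re \<tau>))"
    have Re: "\<bar>Re \<sigma>\<bar> \<le> 1/2" using of_int_round_abs_le[of "Re \<tau>"] by (simp add: \<sigma>_def abs_minus_commute)
    have Im: "Im \<sigma> = Im \<tau>" by (simp add: \<sigma>_def)
    have "P \<sigma>"
    proof (cases "Im \<sigma> \<ge> 1/2")
      case True
      with Re show ?thesis by (rule base)
    next
      case False
      have "(Re \<sigma>)\<^sup>2 \<le> (1/2)\<^sup>2" using Re by (simp add: abs_le_square_iff[symmetric])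
      moreover have "(Im \<sigma>)\<^sup>2 \<le> (1/2)\<^sup>2" using False pos Im by (intro power_mono) auto
      \<comment> \<open>Both coordinates are at most 1/2 in absolute value, so inversion divides the
        imaginary part by at most 1/2.\<close>
      ultimately have N: "(norm \<sigma>)\<^sup>2 \<le> 1/2" unfolding cmod_power2 by (simp add: power2_eq_square)
      have "0 < (norm \<sigma>)\<^sup>2" using pos Im by auto
      then have "2 * Im \<sigma> \<le> Im \<sigma> / (norm \<sigma>)\<^sup>2"
        using mult_left_mono[OF N, of "2 * Im \<sigma>"] pos Im by (simp add: field_simps)
      then have "Im (- 1 / \<sigma>) \<ge> 2 * Im \<sigma>"
        using pos Im Im_neg_inverse[of \<sigma>] by (simp only:)
      also have "2 * Im \<sigma> \<ge> (1/2) ^ Suc n" using Suc.prems Im by simp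
      finally have P: "P (- 1 / \<sigma>)" by (rule Suc.IH)
      have "Im (- 1 / \<sigma>) > 0" using pos Im by (intro Im_neg_inverse_pos) simp
      from S[OF this P] show ?thesis by simp
    qed
    then show ?case using shift[of \<sigma> "round (Re \<tau>)"] pos Im by (simp add: \<sigma>_def)
  qed
  obtain n where "(1/2) ^ n < Im \<tau>"
    using real_arch_pow_inv[of "Im \<tau>" "1/2"] \<open>Im \<tau> > 0\<close> by auto
  then have "(1/2) ^ Suc n \<le> Im \<tau>" using \<open>Im \<tau> > 0\<close> by simp
  then show ?thesis by (rule main)
qed

text \<open>
  The largest absolute value in the family is attained in a fundamental domain, so the maximum
  modulus principle applies.
\<close>

lemma modular_family_zero:
  assumes "finite I" and hol: "\<And>i. i \<in> I \<Longrightarrow> F i holomorphic_on {\<tau>. Im \<tau> > 0}"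
    and T: "\<And>i. i \<in> I \<Longrightarrow> \<exists>i'\<in>I. \<forall>\<tau>. Im \<tau> > 0 \<longrightarrow> norm (F i (\<tau> + 1)) = norm (F i' \<tau>)"
    and T': "\<And>i. i \<in> I \<Longrightarrow> \<exists>i'\<in>I. \<forall>\<tau>. Im \<tau> > 0 \<longrightarrow> norm (F i (\<tau> - 1)) = norm (F i' \<tau>)"
    and S: "\<And>i. i \<in> I \<Longrightarrow> \<exists>i'\<in>I. \<forall>\<tau>. Im \<tau> > 0 \<longrightarrow> norm (F i (- 1 / \<tau>)) = norm (F i' \<tau>)"
    and lim: "\<And>i. i \<in> I \<Longrightarrow> (F i \<longlongrightarrow> 0) cusp"
    and "i \<in> I" "Im \<tau> > 0"
  shows "F i \<tau> = 0"
proof (rule ccontr)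
  assume nz: "F i \<tau> \<noteq> 0"
  let ?H = "{\<tau>. Im \<tau> > 0}"
  have reduce: "\<forall>i\<in>I. norm (F i \<tau>) \<le> B"
    if "\<And>\<tau>. \<bar>Re \<tau>\<bar> \<le> 1/2 \<Longrightarrow> Im \<tau> \<ge> 1/2 \<Longrightarrow> \<forall>i\<in>I. norm (F i \<tau>) \<le> B" "Im \<tau> > 0" for B \<tau>
    using that(1) _ _ _ that(2)
  proof (rule upper_half_plane_induct)
    fix \<tau> assume "Im \<tau> > 0" "\<forall>i\<in>I. norm (F i \<tau>) \<le> B"
    then show "\<forall>i\<in>I. norm (F i (\<tau> + 1)) \<le> B" "\<forall>i\<in>I. norm (F i (\<tau> - 1)) \<le> B"
        "\<forall>i\<in>I. norm (F i (- 1 / \<tau>)) \<le> B"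
      using T T' S by metis+
  qed
  \<comment> \<open>The reduction with bound 0 would make the whole family vanish, so some member is
    nonzero inside the strip.\<close>
  obtain i1 \<tau>1 where i1: "i1 \<in> I" "\<bar>Re \<tau>1\<bar> \<le> 1/2" "Im \<tau>1 \<ge> 1/2" "F i1 \<tau>1 \<noteq> 0"
  proof (rule ccontr)
    assume "\<not> thesis"
    then have "\<forall>i\<in>I. norm (F i \<tau>) \<le> 0" if "\<bar>Re \<tau>\<bar> \<le> 1/2" "Im \<tau> \<ge> 1/2" for \<tau>
      using that \<open>\<And>\<tau>1 i1. \<lbrakk>i1 \<in> I; \<bar>Re \<tau>1\<bar> \<le> 1/2; 1/2 \<le> Im \<tau>1; F i1 \<tau>1 \<noteq> 0\<rbrakk> \<Longrightarrow> thesis\<close> by auto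
    from reduce[OF this \<open>Im \<tau> > 0\<close>] nz \<open>i \<in> I\<close> show False by auto
  qed
  define \<delta> where "\<delta> = norm (F i1 \<tau>1)"
  have \<delta>: "\<delta> > 0" using i1(4) by (simp add: \<delta>_def)
  have "\<forall>\<^sub>F \<tau> in cusp. \<forall>i\<in>I. norm (F i \<tau>) < \<delta>"
    unfolding eventually_ball_finite_distrib[OF \<open>finite I\<close>]
  proof
    fix i assume "i \<in> I"
    from tendstoD[OF lim[OF this] \<delta>] show "\<forall>\<^sub>F \<tau> in cusp. norm (F i \<tau>) < \<delta>" by simp
  qed
  then obtain Y where Y: "\<And>\<tau> i. Im \<tau> \<ge> Y \<Longrightarrow> i \<in> I \<Longrightarrow> norm (F i \<tau>) < \<delta>"
    unfolding eventually_cusp by blast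
  \<comment> \<open>Above height \<open>Y\<close> all members are smaller than \<delta>, a value
    attained in the strip, so the maximum over the strip is attained in this compact
    rectangle.\<close>
  define K where "K = {\<tau>. \<bar>Re \<tau>\<bar> \<le> 1/2 \<and> 1/2 \<le> Im \<tau> \<and> Im \<tau> \<le> Y}"
  have "K = cbox (Complex (-1/2) (1/2)) (Complex (1/2) Y)"
    by (auto simp: K_def in_cbox_complex_iff abs_le_iff)
  then have "compact K" by simp
  have \<tau>1: "\<tau>1 \<in> K" using i1 Y[of \<tau>1 i1] by (force simp: K_def \<delta>_def)
  have "\<exists>x\<in>K. \<forall>y\<in>K. norm (F i y) \<le> norm (F i x)" if "i \<in> I" for i
  proof (rule continuous_attains_sup)
    have "K \<subseteq> ?H" by (auto simp: K_def)
    then have "continuous_on K (F i)"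
      using holomorphic_on_imp_continuous_on[OF hol[OF that]] continuous_on_subset by blast
    then show "continuous_on K (\<lambda>x. norm (F i x))" by (rule continuous_on_norm)
  qed (use \<open>compact K\<close> \<tau>1 in auto)
  then obtain x where x: "\<And>i. i \<in> I \<Longrightarrow> x i \<in> K" "\<And>i y. i \<in> I \<Longrightarrow> y \<in> K \<Longrightarrow> norm (F i y) \<le> norm (F i (x i))"
    by metis
  have "Max ((\<lambda>i. norm (F i (x i))) ` I) \<in> (\<lambda>i. norm (F i (x i))) ` I"
    using \<open>finite I\<close> \<open>i \<in> I\<close> by (intro Max_in) auto
  then obtain i0 where i0: "i0 \<in> I" "norm (F i0 (x i0)) = Max ((\<lambda>i. norm (F i (x i))) ` I)" by auto
  define B where "B = norm (F i0 (x i0))"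
  have max: "norm (F i y) \<le> B" if "i \<in> I" "y \<in> K" for i y
  proof -
    have "norm (F i y) \<le> norm (F i (x i))" using x that by blast
    also have "\<dots> \<le> B" unfolding B_def i0(2) using \<open>finite I\<close> that by (intro Max_ge) auto
    finally show ?thesis .
  qed
  have "\<delta> \<le> B" unfolding \<delta>_def using max i1(1) \<tau>1 by blast
  have bound: "\<forall>i\<in>I. norm (F i \<tau>) \<le> B" if "Im \<tau> > 0" for \<tau>
  proof (rule reduce[OF _ that])
    fix \<tau> :: complex assume \<tau>: "\<bar>Re \<tau>\<bar> \<le> 1/2" "Im \<tau> \<ge> 1/2"
    show "\<forall>i\<in>I. norm (F i \<tau>) \<le> B"
    proof (cases "Im \<tau> \<le> Y")
      case True
      then show ?thesis using max \<tau> by (simp add: K_def)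
    next
      case False
      then show ?thesis using Y[of \<tau>] \<open>\<delta> \<le> B\<close> by force
    qed
  qed
  have "F i0 constant_on ?H"
  proof (rule maximum_modulus_principle[OF hol[OF i0(1)], where U = ?H and \<xi> = "x i0"])
    show "connected ?H" by (intro convex_connected convex_halfspace_Im_gt)
    show "x i0 \<in> ?H" using x(1)[OF i0(1)] by (auto simp: K_def)
    show "norm (F i0 z) \<le> norm (F i0 (x i0))" if "z \<in> ?H" for z
      using bound[of z] that i0(1) by (simp add: B_def)
  qed (simp_all add: open_halfspace_Im_gt)
  then obtain c where c: "\<And>z. z \<in> ?H \<Longrightarrow> F i0 z = c" by (auto simp: constant_on_def)
  have "norm c = B" using c[of "x i0"] x(1)[OF i0(1)] by (auto simp: B_def K_def)
  \<comment> \<open>The constant would have modulus \<open>B >= \<delta>\<close>, which contradicts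
    the decay high up.\<close>
  moreover have "norm c < \<delta>"
    using c[of "Complex 0 (max Y 1)"] Y[of "Complex 0 (max Y 1)" i0] i0(1) by simp
  ultimately show False using \<open>\<delta> \<le> B\<close> by simp
qed

lemma twisted_sum_T: "twisted_sum R v1 v2 w1 w2 (\<tau> + 1) = twisted_sum R v1 (v1 + v2) w1 (w1 + w2) \<tau>"
  unfolding twisted_sum_def klein_quot_T by (simp add: algebra_simps)

lemma twisted_sum_S:
  assumes "\<And>a b. klein a b (- 1 / \<tau>) = C * klein b (- a) \<tau>" and "C \<noteq> 0"
  shows "twisted_sum R v1 v2 w1 w2 (- 1 / \<tau>) = twisted_sum R v2 (- v1) w2 (- w1) \<tau> / C ^ 4"
  unfolding twisted_sum_def klein_quot_S[OF assms] sum_divide_distrib by (simp add: algebra_simps)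

lemma twisted_sum_mod:
  assumes t: "Im \<tau> > 0"
  shows "twisted_sum R (v1 mod 34) (v2 mod 34) (w1 mod 34) (w2 mod 34) \<tau> = twisted_sum R v1 v2 w1 w2 \<tau>"
proof -
  have *: "[v mod 34 + int j * (w mod 34) = v + int j * w] (mod 34)" for v w :: int and j
    by (intro cong_add cong_mult) (simp_all add: cong_def)
  show ?thesis
    unfolding twisted_sum_def by (intro sum.cong refl arg_cong2[of _ _ _ _ "(*)"] klein_quot_mod[OF t] *)
qed

lemma holomorphic_twisted_sum:
  assumes "[v1 * w2 - v2 * w1 = 1] (mod 34)"
  shows "twisted_sum R v1 v2 w1 w2 holomorphic_on {\<tau>. Im \<tau> > 0}"
  unfolding twisted_sum_def by (intro holomorphic_intros holomorphic_klein_quot primitive34_of_det assms)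

lemma twisted_sum_eq_0:
  assumes R: "R \<in> {7, 11, 23, 27}" and det: "[v1 * w2 - v2 * w1 = 1] (mod 34)" and \<tau>: "Im \<tau> > 0"
  shows "twisted_sum R v1 v2 w1 w2 \<tau> = 0"
proof -
  \<comment> \<open>Four forms over eight pick up \<open>C ^ 4\<close> in the denominator under
    inversion; the factor \<open>ee (- (\<tau> / 3))\<close> compensates its modulus
    exactly.\<close>
  define F where "F = (\<lambda>(v1, v2, w1, w2) \<tau>. twisted_sum R v1 v2 w1 w2 \<tau> * ee (- (\<tau> / 3)))"
  define red :: "int \<times> int \<times> int \<times> int \<Rightarrow> int \<times> int \<times> int \<times> int"
    where "red = (\<lambda>(v1, v2, w1, w2). (v1 mod 34, v2 mod 34, w1 mod 34, w2 mod 34))"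
  \<comment> \<open>Reducing the entries modulo 34 makes the family finite without changing its
    functions, and the determinant condition is kept by both generators.\<close>
  define J where "J = {(v1, v2, w1, w2). [v1 * w2 - v2 * w1 = (1::int)] (mod 34)}"
  define I where "I = red ` J"
  have F_red: "F (red i) \<tau> = F i \<tau>" if "Im \<tau> > 0" for i \<tau>
    using twisted_sum_mod[OF that] by (simp add: F_def red_def split: prod.splits)
  have red_J: "red i \<in> J" if "i \<in> J" for i
  proof -
    obtain v1 v2 w1 w2 where i: "i = (v1, v2, w1, w2)" by (metis surj_pair)
    have "[(v1 mod 34) * (w2 mod 34) - (v2 mod 34) * (w1 mod 34) = v1 * w2 - v2 * w1] (mod 34)"
      by (intro cong_diff cong_mult) (simp_all add: cong_def)
    moreover have "[v1 * w2 - v2 * w1 = 1] (mod 34)" using that by (simp add: i J_def)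
    ultimately have "[(v1 mod 34) * (w2 mod 34) - (v2 mod 34) * (w1 mod 34) = 1] (mod 34)" by (rule cong_trans)
    then show ?thesis by (simp add: i J_def red_def)
  qed
  have "I \<subseteq> {0..<34} \<times> {0..<34} \<times> {0..<34} \<times> {0..<34}"
    by (auto simp: I_def red_def)
  then have "finite I" by (rule finite_subset) simp
  have step: "\<exists>i'\<in>I. \<forall>\<tau>. Im \<tau> > 0 \<longrightarrow> norm (F (red i) (g \<tau>)) = norm (F i' \<tau>)"
    if "\<And>\<tau>. Im \<tau> > 0 \<Longrightarrow> Im (g \<tau>) > 0" "h \<in> J"
      "\<And>\<tau>. Im \<tau> > 0 \<Longrightarrow> norm (F i (g \<tau>)) = norm (F h \<tau>)" for i g h
    using that by (intro bexI[of _ "red h"]) (auto simp: F_red I_def)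
  have norm_F: "norm (F (v1, v2, w1, w2) \<tau>) = norm (twisted_sum R v1 v2 w1 w2 \<tau>) * exp (2 * pi * Im \<tau> / 3)"
    for v1 v2 w1 w2 \<tau>
    by (simp add: F_def norm_mult norm_ee)
  have S: "norm (F (v1, v2, w1, w2) (- 1 / \<tau>)) = norm (F (v2, - v1, w2, - w1) \<tau>)" if t: "Im \<tau> > 0" for v1 v2 w1 w2 \<tau>
  proof -
    obtain C where C: "C \<noteq> 0" "\<And>a b. klein a b (- 1 / \<tau>) = C * klein b (- a) \<tau>"
      using klein_S[OF t] by blast
    have "norm C ^ 4 = exp (2 * pi * (Im (- 1 / \<tau>) - Im \<tau>) / 3)"
      unfolding norm_klein_S_factor[OF t C(2)] by (simp add: exp_of_nat_mult[symmetric] field_simps)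
    also have "\<dots> = exp (2 * pi * Im (- 1 / \<tau>) / 3) / exp (2 * pi * Im \<tau> / 3)"
      by (simp add: exp_diff[symmetric] field_simps)
    finally have "exp (2 * pi * Im (- 1 / \<tau>) / 3) = norm C ^ 4 * exp (2 * pi * Im \<tau> / 3)"
      by (simp add: field_simps)
    then show ?thesis
      unfolding norm_F twisted_sum_S[OF C(2,1)] using C(1) by (simp add: norm_divide norm_power)
  qed
  have T: "norm (F (v1, v2, w1, w2) (\<tau> + 1)) = norm (F (v1, v1 + v2, w1, w1 + w2) \<tau>)" for v1 v2 w1 w2 \<tau>
    unfolding norm_F twisted_sum_T by simp
  have T': "norm (F (v1, v2, w1, w2) (\<tau> - 1)) = norm (F (v1, v2 - v1, w1, w2 - w1) \<tau>)" for v1 v2 w1 w2 \<tau>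
    using T[of v1 "v2 - v1" w1 "w2 - w1" "\<tau> - 1"] by simp
  have "F (red (v1, v2, w1, w2)) \<tau> = 0"
  proof (rule modular_family_zero[OF \<open>finite I\<close> _ _ _ _ _ _ \<tau>])
    show "red (v1, v2, w1, w2) \<in> I" using det by (auto simp: I_def J_def)
    fix j assume "j \<in> I"
    then obtain v1 v2 w1 w2 where j: "j = red (v1, v2, w1, w2)" and J: "(v1, v2, w1, w2) \<in> J"
      by (auto simp: I_def)
    then have d: "[v1 * w2 - v2 * w1 = 1] (mod 34)" by (simp add: J_def)
    show "\<exists>i'\<in>I. \<forall>\<tau>. Im \<tau> > 0 \<longrightarrow> norm (F j (\<tau> + 1)) = norm (F i' \<tau>)"
      unfolding j by (rule step[where h = "(v1, v1 + v2, w1, w1 + w2)"])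
        (use d in \<open>simp_all add: J_def T algebra_simps\<close>)
    show "\<exists>i'\<in>I. \<forall>\<tau>. Im \<tau> > 0 \<longrightarrow> norm (F j (\<tau> - 1)) = norm (F i' \<tau>)"
      unfolding j by (rule step[where h = "(v1, v2 - v1, w1, w2 - w1)"])
        (use d T' in \<open>simp_all add: J_def algebra_simps\<close>)
    show "\<exists>i'\<in>I. \<forall>\<tau>. Im \<tau> > 0 \<longrightarrow> norm (F j (- 1 / \<tau>)) = norm (F i' \<tau>)"
      unfolding j by (rule step[where h = "(v2, - v1, w2, - w1)"])
        (use d S Im_neg_inverse_pos in \<open>simp_all add: J_def algebra_simps\<close>)
    obtain a b c e where jj: "j = (a, b, c, e)" by (metis surj_pair)
    have d': "[a * e - b * c = 1] (mod 34)" using red_J[OF J] by (simp add: jj[symmetric] j[symmetric]) (simp add: jj J_def)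
    show "F j holomorphic_on {\<tau>. Im \<tau> > 0}"
      unfolding jj F_def prod.case by (intro holomorphic_intros holomorphic_twisted_sum d') simp
    \<comment> \<open>The margin 6/17 - 1/3 = 1/51 is positive, so every member tends to 0.\<close>
    have "ord_ge (6/17 + (- (1/3))) (\<lambda>\<tau>. twisted_sum R a b c e \<tau> * ee (of_real (- (1/3)) * \<tau>))"
      by (intro ord_ge_mult ord_ge_ee twisted_sum_ord_ge R d')
    then have "F j \<in> O[cusp](\<lambda>\<tau>. ee (\<tau> / of_nat 51))"
      unfolding ord_ge_def jj F_def by simp
    then obtain B where B: "\<forall>\<^sub>F \<tau> in cusp. norm (F j \<tau>) \<le> B * norm (ee (\<tau> / of_nat 51))"
      by (elim landau_o.bigE)
    have "((\<lambda>\<tau>. ee (\<tau> / of_nat 51)) \<longlongrightarrow> 0) cusp"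
      by (rule filterlim_ee_cusp) simp
    then have "((\<lambda>\<tau>. B * norm (ee (\<tau> / of_nat 51))) \<longlongrightarrow> 0) cusp"
      by (intro tendsto_mult_right_zero tendsto_norm_zero)
    with B show "(F j \<longlongrightarrow> 0) cusp"
      by (rule Lim_null_comparison)
  qed
  then have "F (v1, v2, w1, w2) \<tau> = 0" using F_red[OF \<tau>] by simp
  then show ?thesis by (simp add: F_def)
qed

section \<open>Generating functions\<close>

text \<open>Unlike \<open>partitions\<close>, this admits the empty list for 0, which supplies the
  constant term 1 of the generating function and keeps the recursion uniform.\<close>

definition bounded_parts :: "nat \<Rightarrow> nat \<Rightarrow> nat list set" where
  "bounded_parts M n = {xs. sorted_wrt (\<ge>) xs \<and> (\<forall>x\<in>set xs. 0 < x \<and> x \<le> M) \<and> sum_list xs = n}"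

definition bounded_sum :: "(nat \<Rightarrow> int) \<Rightarrow> nat \<Rightarrow> nat \<Rightarrow> int" where
  "bounded_sum f M n = (\<Sum>xs\<in>bounded_parts M n. prod_list (map f xs))"

lemma finite_bounded_parts: "finite (bounded_parts M n)"
  by (rule finite_subset[of _ "insert [] (partitions n)"])
    (auto simp: bounded_parts_def partitions_def finite_partitions[unfolded partitions_def])

lemma bounded_parts_0: "bounded_parts 0 n = (if n = 0 then {[]} else {})"
proof (rule Set.set_eqI)
  show "xs \<in> bounded_parts 0 n \<longleftrightarrow> xs \<in> (if n = 0 then {[]} else {})" for xs
    by (cases xs) (auto simp: bounded_parts_def not_le)
qed

lemma bounded_parts_Suc:
  "bounded_parts (Suc M) n = bounded_parts M n \<union>
    (if Suc M \<le> n then (#) (Suc M) ` bounded_parts (Suc M) (n - Suc M) else {})" (is "?A = ?B \<union> ?C")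
proof (intro equalityI subsetI)
  fix xs assume xs: "xs \<in> ?A"
  show "xs \<in> ?B \<union> ?C"
  proof (cases xs)
    case Nil
    with xs show ?thesis by (auto simp: bounded_parts_def)
  next
    case (Cons y ys)
    show ?thesis
    proof (cases "y = Suc M")
      case True
      with xs Cons have "Suc M \<le> n" "ys \<in> bounded_parts (Suc M) (n - Suc M)"
        by (auto simp: bounded_parts_def)
      with True Cons show ?thesis by auto
    next
      case False
      with xs Cons have "y \<le> M" by (auto simp: bounded_parts_def)
      with xs Cons show ?thesis by (auto simp: bounded_parts_def)
    qed
  qed
next
  fix xs assume "xs \<in> ?B \<union> ?C"
  then show "xs \<in> ?A" by (auto simp: bounded_parts_def split: if_splits)
qed

lemma bounded_sum_Suc:
  "bounded_sum f (Suc M) n = bounded_sum f M n + (if Suc M \<le> n then f (Suc M) * bounded_sum f (Suc M) (n - Suc M) else 0)"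
proof -
  let ?C = "if Suc M \<le> n then (#) (Suc M) ` bounded_parts (Suc M) (n - Suc M) else {}"
  have "Suc M # ys \<notin> bounded_parts M n" for ys by (simp add: bounded_parts_def)
  then have "bounded_parts M n \<inter> ?C = {}" by auto
  then have "bounded_sum f (Suc M) n = bounded_sum f M n + (\<Sum>xs\<in>?C. prod_list (map f xs))"
    unfolding bounded_sum_def bounded_parts_Suc[of M n]
    by (intro sum.union_disjoint) (auto simp: finite_bounded_parts)
  moreover have "(\<Sum>xs\<in>(#) (Suc M) ` bounded_parts (Suc M) (n - Suc M). prod_list (map f xs)) =
      f (Suc M) * bounded_sum f (Suc M) (n - Suc M)"
    by (subst sum.reindex) (auto simp: bounded_sum_def sum_distrib_left)
  ultimately show ?thesis by simp
qed

lemma bounded_sum_eq: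
  assumes "n \<le> M"
  shows "bounded_sum f M n = (if n = 0 then 1 else signed_partition_number n f)"
proof (cases "n = 0")
  case True
  have "bounded_parts M 0 = {[]}"
  proof -
    have "xs = []" if "\<forall>x\<in>set xs. 0 < x \<and> x \<le> M" "sum_list xs = 0" for xs :: "nat list"
      using that by (cases xs) auto
    then show ?thesis by (auto simp: bounded_parts_def)
  qed
  with True show ?thesis by (simp add: bounded_sum_def)
next
  case False
  have "x \<le> M" if "x \<in> set xs" "sum_list xs = n" for x :: nat and xs
    using that assms member_le_sum_list[of x xs] by simp
  then have "bounded_parts M n = partitions n"
    using False by (auto simp: bounded_parts_def partitions_def)
  with False show ?thesis by (simp add: bounded_sum_def signed_partition_number_def)
qed

definition bounded_fps :: "(nat \<Rightarrow> int) \<Rightarrow> nat \<Rightarrow> complex fps" where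
  "bounded_fps f M = Abs_fps (\<lambda>n. of_int (bounded_sum f M n))"

lemma bounded_fps_product:
  "bounded_fps f M * (\<Prod>m=1..M. 1 - fps_const (of_int (f m)) * fps_X ^ m) = 1"
proof (induction M)
  case 0
  have "bounded_fps f 0 = 1"
    by (rule fps_ext) (simp add: bounded_fps_def bounded_sum_def bounded_parts_0)
  then show ?case by simp
next
  case (Suc M)
  let ?A = "bounded_fps f (Suc M)"
  have "?A * (1 - fps_const (of_int (f (Suc M))) * fps_X ^ Suc M) = bounded_fps f M"
  proof (rule fps_ext)
    fix n
    have "?A * (1 - fps_const (of_int (f (Suc M))) * fps_X ^ Suc M) =
        ?A - fps_const (of_int (f (Suc M))) * (?A * fps_X ^ Suc M)"
      by (simp only: right_diff_distrib mult_1_right mult.left_commute)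
    then show "fps_nth (?A * (1 - fps_const (of_int (f (Suc M))) * fps_X ^ Suc M)) n = fps_nth (bounded_fps f M) n"
      by (simp only: fps_sub_nth fps_mult_left_const_nth fps_X_power_mult_right_nth)
        (auto simp: bounded_fps_def bounded_sum_Suc[of f M n])
  qed
  moreover have "(\<Prod>m=1..Suc M. 1 - fps_const (of_int (f m)) * fps_X ^ m) =
      (1 - fps_const (of_int (f (Suc M))) * fps_X ^ Suc M) * (\<Prod>m=1..M. 1 - fps_const (of_int (f m) :: complex) * fps_X ^ m)"
    by (simp only: prod.nat_ivl_Suc' One_nat_def)
  ultimately show ?case
    using Suc by (simp only: mult.assoc[symmetric])
qed

definition partition_fps :: "(nat \<Rightarrow> int) \<Rightarrow> complex fps" where
  "partition_fps f = Abs_fps (\<lambda>n. if n = 0 then 1 else of_int (signed_partition_number n f))"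

text \<open>Coefficients of the finite products converge by uniform convergence of holomorphic
  functions, and those of \<open>bounded_fps\<close> are eventually constant. Passing to the limit
  in the finite identity involves no convergence of the partition series itself.\<close>

lemma partition_fps_inverse:
  assumes ul: "uniform_limit (ball 0 r) (\<lambda>M x. \<Prod>m=1..M. 1 - of_int (f m) * x ^ m) H sequentially"
    and "r > 0" and P: "H has_fps_expansion P"
  shows "P * partition_fps f = 1"
proof (rule fps_ext)
  fix n
  let ?PM = "\<lambda>M. (\<Prod>m=1..M. 1 - fps_const (of_int (f m)) * fps_X ^ m) :: complex fps"
  have PM: "(\<lambda>x. \<Prod>m=1..M. 1 - of_int (f m) * x ^ m) has_fps_expansion ?PM M" for M
    by (intro fps_expansion_intros)
  have lim: "(\<lambda>M. fps_nth (?PM M) i) \<longlonglongrightarrow> fps_nth P i" for i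
    unfolding fps_nth_fps_expansion[OF PM] fps_nth_fps_expansion[OF P]
    by (intro tendsto_divide tendsto_const higher_deriv_complex_uniform_limit[OF ul])
      (use \<open>r > 0\<close> in \<open>auto intro!: always_eventually holomorphic_intros\<close>)
  have lim2: "(\<lambda>M. fps_nth (bounded_fps f M) i) \<longlonglongrightarrow> fps_nth (partition_fps f) i" for i
  proof (rule tendsto_eventually)
    show "\<forall>\<^sub>F M in sequentially. fps_nth (bounded_fps f M) i = fps_nth (partition_fps f) i"
      using eventually_ge_at_top[of i]
      by eventually_elim (simp add: bounded_fps_def partition_fps_def bounded_sum_eq)
  qed
  have "(\<lambda>M. fps_nth (?PM M * bounded_fps f M) n) \<longlonglongrightarrow> fps_nth (P * partition_fps f) n"
    unfolding fps_mult_nth by (intro tendsto_sum tendsto_mult lim lim2)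
  moreover have "?PM M * bounded_fps f M = 1" for M
    using bounded_fps_product[of f M] by (simp only: mult.commute)
  ultimately show "fps_nth (P * partition_fps f) n = fps_nth 1 n"
    by (simp add: LIMSEQ_const_iff)
qed

section \<open>Residues modulo 17\<close>

lemma residue_17_cases:
  fixes a :: int
  obtains "a mod 17 = 0" | "a mod 17 = 1" | "a mod 17 = 2" | "a mod 17 = 3" | "a mod 17 = 4" | "a mod 17 = 5"
  | "a mod 17 = 6" | "a mod 17 = 7" | "a mod 17 = 8" | "a mod 17 = 9" | "a mod 17 = 10" | "a mod 17 = 11"
  | "a mod 17 = 12" | "a mod 17 = 13" | "a mod 17 = 14" | "a mod 17 = 15" | "a mod 17 = 16"
proof -
  have "a mod 17 = 0 \<or> a mod 17 = 1 \<or> a mod 17 = 2 \<or> a mod 17 = 3 \<or> a mod 17 = 4 \<or> a mod 17 = 5 \<or>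
    a mod 17 = 6 \<or> a mod 17 = 7 \<or> a mod 17 = 8 \<or> a mod 17 = 9 \<or> a mod 17 = 10 \<or> a mod 17 = 11 \<or>
    a mod 17 = 12 \<or> a mod 17 = 13 \<or> a mod 17 = 14 \<or> a mod 17 = 15 \<or> a mod 17 = 16"
    by presburger
  then show ?thesis by (elim disjE) (fact that)+
qed

lemma QuadRes_17: "QuadRes 17 a \<longleftrightarrow> a mod 17 \<in> {0, 1, 2, 4, 8, 9, 13, 15, 16}"
proof
  assume "QuadRes 17 a"
  then obtain y where "[y\<^sup>2 = a] (mod 17)" by (auto simp: QuadRes_def)
  then have a: "a mod 17 = (y mod 17)\<^sup>2 mod 17" by (simp add: cong_def power_mod)
  show "a mod 17 \<in> {0, 1, 2, 4, 8, 9, 13, 15, 16}"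
    unfolding a by (cases y rule: residue_17_cases) simp_all
next
  have *: "QuadRes 17 a" if "y\<^sup>2 mod 17 = a mod 17" for y
    using that unfolding QuadRes_def by (intro exI[of _ y]) (simp add: cong_def)
  assume "a mod 17 \<in> {0, 1, 2, 4, 8, 9, 13, 15, 16}"
  then show "QuadRes 17 a"
    using *[of 0] *[of 1] *[of 6] *[of 2] *[of 5] *[of 3] *[of 8] *[of 7] *[of 4] by auto
qed

lemma fourth_power_17: "(\<exists>y. [y ^ 4 = a] (mod 17)) \<longleftrightarrow> a mod 17 \<in> {0, 1, 4, 13, 16 :: int}"
proof
  assume "\<exists>y. [y ^ 4 = a] (mod 17)"
  then obtain y where "[y ^ 4 = a] (mod 17)" by blast
  then have a: "a mod 17 = (y mod 17) ^ 4 mod 17" by (simp add: cong_def power_mod)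
  show "a mod 17 \<in> {0, 1, 4, 13, 16}"
    unfolding a by (cases y rule: residue_17_cases) simp_all
next
  have *: "\<exists>y. [y ^ 4 = a] (mod 17)" if "y ^ 4 mod 17 = a mod 17" for y
    using that by (intro exI[of _ y]) (simp add: cong_def)
  assume "a mod 17 \<in> {0, 1, 4, 13, 16}"
  then show "\<exists>y. [y ^ 4 = a] (mod 17)"
    using *[of 0] *[of 1] *[of 6] *[of 3] *[of 2] by auto
qed

lemma coprime_17: "coprime a 17 \<longleftrightarrow> a mod 17 \<noteq> (0::int)"
  using prime_imp_coprime[of "17::int" a] by (auto simp: coprime_commute dvd_eq_mod_eq_0 coprime_absorb_left)

lemma chi17_eq:
  "chi17 a = (if a mod 17 = 0 then 0 else if a mod 17 \<in> {1, 2, 4, 8, 9, 13, 15, 16} then 1 else - 1)"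
proof -
  have m: "int a mod 17 = int (a mod 17)" by (simp add: zmod_int)
  have "[int a = 0] (mod 17) \<longleftrightarrow> a mod 17 = 0" by (simp add: cong_def m)
  moreover have "QuadRes 17 (int a) \<longleftrightarrow> a mod 17 = 0 \<or> a mod 17 \<in> {1, 2, 4, 8, 9, 13, 15, 16}"
    unfolding QuadRes_17 m by (simp only: insert_iff empty_iff) presburger
  ultimately show ?thesis unfolding chi17_def Legendre_def by auto
qed

text \<open>With \<open>R = n + 12\<close>, \<open>1 - 24 n = 289 - 24 R\<close>, which is
  \<open>10 R\<close> modulo 17. The residue condition thus says that \<open>R\<close> lies in the
  coset 6, 7, 10, 11 of the quartic residues.\<close>

lemma residue_classes:
  assumes "n > 0"
  shows "n mod 34 \<in> {11, 15, 29, 33} \<longleftrightarrow>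
    odd n \<and> quadratic_residue 17 (1 - 24 * int n) \<and> \<not> quartic_residue 17 (1 - 24 * int n)"
proof -
  define r where "r = int n mod 34"
  have rn: "r = int (n mod 34)" by (simp add: r_def zmod_int)
  have "\<forall>r\<in>{0..<34::int}. r \<in> {11, 15, 29, 33} \<longleftrightarrow> r mod 2 = 1 \<and>
    ((1 - 24 * r) mod 17 \<noteq> 0 \<and> (1 - 24 * r) mod 17 \<in> {0, 1, 2, 4, 8, 9, 13, 15, 16}) \<and>
    \<not> ((1 - 24 * r) mod 17 \<noteq> 0 \<and> (1 - 24 * r) mod 17 \<in> {0, 1, 4, 13, 16})"
    by code_simp
  moreover have "r \<in> {0..<34}" by (simp add: r_def)
  ultimately have *: "r \<in> {11, 15, 29, 33} \<longleftrightarrow> r mod 2 = 1 \<and>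
    ((1 - 24 * r) mod 17 \<noteq> 0 \<and> (1 - 24 * r) mod 17 \<in> {0, 1, 2, 4, 8, 9, 13, 15, 16}) \<and>
    \<not> ((1 - 24 * r) mod 17 \<noteq> 0 \<and> (1 - 24 * r) mod 17 \<in> {0, 1, 4, 13, 16})" by (rule bspec)
  have "[r = int n] (mod 17)" by (simp add: r_def cong_def mod_mod_cancel)
  then have "[1 - 24 * r = 1 - 24 * int n] (mod 17)" by (intro cong_diff cong_mult) simp_all
  then have m17: "(1 - 24 * r) mod 17 = (1 - 24 * int n) mod 17" by (simp add: cong_def)
  have "r mod 2 = int n mod 2" by (simp add: r_def mod_mod_cancel)
  then have odd: "r mod 2 = 1 \<longleftrightarrow> odd n" by presburger
  have B: "r \<in> {11, 15, 29, 33} \<longleftrightarrow> n mod 34 \<in> {11, 15, 29, 33}"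
    unfolding rn by (simp only: insert_iff empty_iff) presburger
  show ?thesis
    using * unfolding quadratic_residue_def quartic_residue_def QuadRes_17 fourth_power_17 coprime_17 m17 odd B .
qed

section \<open>The generating function as a theta quotient\<close>

text \<open>Along the multiples of \<open>m\<close> the partial products regroup exactly by residue
  class; a subsequence suffices because the limit is assumed to exist.\<close>

lemma limit_periodic_product:
  fixes c :: "nat \<Rightarrow> complex"
  assumes x: "norm x < 1" and m: "m > 0" and per: "\<And>n. c (n + m) = c n"
    and lim: "(\<lambda>N. \<Prod>n<N. 1 - c (Suc n) * x ^ Suc n) \<longlonglongrightarrow> L"
  shows "L = (\<Prod>i<m. qpoch (c (Suc i) * x ^ Suc i) (x ^ m))"
proof (rule LIMSEQ_unique)
  have per': "c (i + n * m) = c i" for i n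
  proof (induction n)
    case (Suc n)
    then show ?case using per[of "i + n * m"] by (simp add: add_ac)
  qed simp
  have "filterlim (\<lambda>N. N * m) sequentially sequentially"
    using m by (intro filterlim_subseq strict_monoI) auto
  from filterlim_compose[OF lim this] show "(\<lambda>N. \<Prod>n<N*m. 1 - c (Suc n) * x ^ Suc n) \<longlonglongrightarrow> L" .
  have "(\<Prod>n<N*m. 1 - c (Suc n) * x ^ Suc n) = (\<Prod>i<m. \<Prod>n<N. 1 - c (Suc i) * x ^ Suc i * (x ^ m) ^ n)" for N
  proof -
    have "(\<Prod>n<N*m. 1 - c (Suc n) * x ^ Suc n) = (\<Prod>n<N. \<Prod>i\<in>{n*m..<n*m+m}. 1 - c (Suc i) * x ^ Suc i)"
      by (rule prod.nat_group[symmetric])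
    also have "\<dots> = (\<Prod>n<N. \<Prod>i<m. 1 - c (Suc i) * x ^ Suc i * (x ^ m) ^ n)"
    proof (rule prod.cong[OF refl])
      fix n
      have "(\<Prod>i\<in>{n*m..<n*m+m}. 1 - c (Suc i) * x ^ Suc i) = (\<Prod>i<m. 1 - c (Suc (i + n * m)) * x ^ Suc (i + n * m))"
        by (rule prod.reindex_bij_witness[of _ "\<lambda>i. i + n * m" "\<lambda>i. i - n * m"]) auto
      also have "\<dots> = (\<Prod>i<m. 1 - c (Suc i) * x ^ Suc i * (x ^ m) ^ n)"
      proof (rule prod.cong[OF refl])
        fix i
        have "c (Suc (i + n * m)) = c (Suc i)" using per'[of "Suc i" n] by simp
        moreover have "x ^ Suc (i + n * m) = x ^ Suc i * (x ^ m) ^ n"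
          by (simp add: power_add mult_ac flip: power_mult)
        ultimately show "1 - c (Suc (i + n * m)) * x ^ Suc (i + n * m) = 1 - c (Suc i) * x ^ Suc i * (x ^ m) ^ n"
          by (simp only: mult.assoc)
      qed
      finally show "(\<Prod>i\<in>{n*m..<n*m+m}. 1 - c (Suc i) * x ^ Suc i) = (\<Prod>i<m. 1 - c (Suc i) * x ^ Suc i * (x ^ m) ^ n)" .
    qed
    also have "\<dots> = (\<Prod>i<m. \<Prod>n<N. 1 - c (Suc i) * x ^ Suc i * (x ^ m) ^ n)"
      by (rule prod.swap)
    finally show ?thesis .
  qed
  then show "(\<lambda>N. \<Prod>n<N*m. 1 - c (Suc n) * x ^ Suc n) \<longlonglongrightarrow> (\<Prod>i<m. qpoch (c (Suc i) * x ^ Suc i) (x ^ m))"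
    using x m by (simp only:) (intro tendsto_prod qpoch_tendsto norm_power_lt_1)
qed

definition chi_quot :: "complex \<Rightarrow> complex" where
  "chi_quot = quot34 {1, 9, 13, 15} {3, 5, 6, 7, 10, 11, 12, 14}"

text \<open>Euler's identity restricted to residues. Since 2 is a quadratic residue modulo 17,
  doubling maps the residue classes modulo 34 onto the even residue classes modulo 68, so the
  product over even residues cancels on both sides.\<close>

lemma residue_product_euler:
  fixes x :: complex
  assumes x: "norm x < 1"
  shows "(\<Prod>r\<in>{1, 2, 4, 8, 9, 13, 15, 16, 18, 19, 21, 25, 26, 30, 32, 33}. qpoch (- (x ^ r)) (x ^ 34)) *
    (\<Prod>r\<in>{1, 9, 13, 15, 19, 21, 25, 33}. qpoch (x ^ r) (x ^ 34)) = 1"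
proof -
  let ?g = "\<lambda>r. qpoch (x ^ r) (x ^ 34)" and ?m = "\<lambda>r. qpoch (- (x ^ r)) (x ^ 34)"
  let ?h = "\<lambda>r. qpoch (x ^ r) (x ^ 68)"
  have x34: "norm (x ^ 34) < 1" by (rule norm_power_lt_1[OF x]) simp
  have gm: "?g r * ?m r = ?h (2 * r)" for r
    using qpoch_mult_minus[OF x34, of "x ^ r"] by (simp add: mult.commute flip: power_mult)
  have g: "?g s = ?h s * ?h (s + 34)" for s
    using qpoch_split[OF x34, of 2 "x ^ s"] by (simp add: numeral_2_eq_2 power_add flip: power_mult)
  let ?O = "{1, 9, 13, 15, 19, 21, 25, 33} :: nat set" and ?E = "{2, 4, 8, 16, 18, 26, 30, 32} :: nat set"
  have "(\<Prod>r\<in>?O \<union> ?E. ?g r) * (\<Prod>r\<in>?O \<union> ?E. ?m r) = (\<Prod>r\<in>?O \<union> ?E. ?h (2 * r))"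
    unfolding prod.distrib[symmetric] gm ..
  also have "\<dots> = (\<Prod>s\<in>?E. ?h s * ?h (s + 34))"
    by simp
  also have "\<dots> = (\<Prod>s\<in>?E. ?g s)" unfolding g ..
  finally have "(\<Prod>r\<in>?E. ?g r) * ((\<Prod>r\<in>?O \<union> ?E. ?m r) * (\<Prod>r\<in>?O. ?g r) - 1) = 0"
    by (subst (asm) prod.union_disjoint) (simp_all add: algebra_simps del: prod.insert)
  moreover have "(\<Prod>r\<in>?E. ?g r) \<noteq> 0"
  proof -
    have "?g r \<noteq> 0" if "r \<in> ?E" for r
      using that by (intro qpoch_power_nonzero[OF x34] norm_power_lt_1[OF x]) auto
    then show ?thesis by (simp del: prod.insert)
  qed
  moreover have "?O \<union> ?E = {1, 2, 4, 8, 9, 13, 15, 16, 18, 19, 21, 25, 26, 30, 32, 33}" by auto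
  ultimately show ?thesis by (simp del: prod.insert)
qed

lemma chi_quot_mult_product:
  assumes x: "norm x < 1" and lim: "(\<lambda>N. \<Prod>n<N. 1 - of_int (- chi17 (Suc n)) * x ^ Suc n) \<longlonglongrightarrow> L"
  shows "L * chi_quot x = 1"
proof -
  let ?g = "\<lambda>r. qpoch (x ^ r) (x ^ 34)"
  define c where "c = (\<lambda>n. of_int (- chi17 n) :: complex)"
  let ?A = "{1, 2, 4, 8, 9, 13, 15, 16, 18, 19, 21, 25, 26, 30, 32, 33} :: nat set"
  let ?B = "{3, 5, 6, 7, 10, 11, 12, 14, 20, 22, 23, 24, 27, 28, 29, 31} :: nat set"
  have x34: "norm (x ^ 34) < 1" by (rule norm_power_lt_1[OF x]) simp
  have "chi17 (n + 34) = chi17 n" for n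
    using mod_mult_self1[of n 2 17] unfolding chi17_eq by simp
  then have "L = (\<Prod>i<34. qpoch (c (Suc i) * x ^ Suc i) (x ^ 34))"
    by (intro limit_periodic_product[OF x]) (use lim in \<open>simp_all add: c_def\<close>)
  also have "\<dots> = (\<Prod>r\<in>{1..34}. qpoch (c r * x ^ r) (x ^ 34))"
    by (rule prod.reindex_bij_witness[of _ "\<lambda>r. r - 1" Suc]) auto
  also have "{1..34} = ?A \<union> ?B \<union> {17, 34 :: nat}"
    by (simp add: set_eq_iff) presburger
  also have "(\<Prod>r\<in>?A \<union> ?B \<union> {17, 34}. qpoch (c r * x ^ r) (x ^ 34)) =
      (\<Prod>r\<in>?A. qpoch (c r * x ^ r) (x ^ 34)) * (\<Prod>r\<in>?B. qpoch (c r * x ^ r) (x ^ 34)) *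
      (\<Prod>r\<in>{17, 34}. qpoch (c r * x ^ r) (x ^ 34))"
    by (subst prod.union_disjoint, simp, simp, simp, subst prod.union_disjoint) simp_all
  also have "(\<Prod>r\<in>?A. qpoch (c r * x ^ r) (x ^ 34)) = (\<Prod>r\<in>?A. qpoch (- (x ^ r)) (x ^ 34))"
    by (rule prod.cong[OF refl], elim insertE emptyE) (simp_all add: c_def chi17_eq)
  also have "(\<Prod>r\<in>?B. qpoch (c r * x ^ r) (x ^ 34)) = (\<Prod>r\<in>?B. ?g r)"
    by (rule prod.cong[OF refl], elim insertE emptyE) (simp_all add: c_def chi17_eq)
  also have "(\<Prod>r\<in>{17, 34}. qpoch (c r * x ^ r) (x ^ 34)) = 1"
    by (simp add: c_def chi17_eq)
  finally have L: "L = (\<Prod>r\<in>?A. qpoch (- (x ^ r)) (x ^ 34)) * (\<Prod>r\<in>?B. ?g r)" by simp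
  have B: "(\<Prod>r\<in>?B. ?g r) \<noteq> 0"
  proof -
    have "?g r \<noteq> 0" if "r \<in> ?B" for r
      using that by (intro qpoch_power_nonzero[OF x34] norm_power_lt_1[OF x]) auto
    then show ?thesis by (simp del: prod.insert)
  qed
  have qp: "qpair e f 34 1 x = ?g e * ?g f" for e f by (simp add: qpair_def)
  have "chi_quot x = (\<Prod>r\<in>{1, 9, 13, 15, 19, 21, 25, 33}. ?g r) / (\<Prod>r\<in>?B. ?g r)"
    unfolding chi_quot_def quot34_def qp by (simp add: mult_ac)
  then have "L * chi_quot x = (\<Prod>r\<in>?A. qpoch (- (x ^ r)) (x ^ 34)) * (\<Prod>r\<in>{1, 9, 13, 15, 19, 21, 25, 33}. ?g r)"
    unfolding L using B by (simp del: prod.insert)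
  then show ?thesis
    unfolding residue_product_euler[OF x] .
qed

lemma chi_quot_has_fps_expansion: "chi_quot has_fps_expansion partition_fps (\<lambda>a. - chi17 a)"
proof -
  let ?f = "\<lambda>a. - chi17 a"
  define H where "H = (\<lambda>x::complex. \<Prod>n. 1 + - (of_int (?f (Suc n)) * x ^ Suc n))"
  have chi: "\<bar>chi17 n\<bar> \<le> 1" for n by (simp add: chi17_eq)
  have ul: "uniform_limit (cball 0 (1/2)) (\<lambda>N x. \<Prod>n<N. 1 + - (of_int (?f (Suc n)) * x ^ Suc n)) H sequentially"
    unfolding H_def
  proof (rule uniform_limit_prodinf_complex)
    fix n and x :: complex assume "x \<in> cball 0 (1/2)"
    then have "norm x ^ Suc n \<le> (1/2) ^ Suc n" by (intro power_mono) auto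
    moreover have "norm (of_int (?f (Suc n)) :: complex) \<le> 1" using chi[of "Suc n"] by simp
    ultimately show "norm (- (of_int (?f (Suc n)) * x ^ Suc n)) \<le> (1/2) ^ Suc n"
      unfolding norm_minus_cancel norm_mult norm_power
      using mult_mono[of "norm (of_int (?f (Suc n)) :: complex)" 1 "norm x ^ Suc n" "(1/2) ^ Suc n"] by simp
  next
    show "summable (\<lambda>n. (1/2) ^ Suc n :: real)" by (subst summable_Suc_iff) (simp add: summable_geometric)
  qed (auto intro!: continuous_intros)
  have HG: "H x * chi_quot x = 1" if "x \<in> ball 0 (1/2)" for x
  proof (rule chi_quot_mult_product)
    show "norm x < 1" using that by simp
    show "(\<lambda>N. \<Prod>n<N. 1 - of_int (- chi17 (Suc n)) * x ^ Suc n) \<longlonglongrightarrow> H x"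
      using tendsto_uniform_limitI[OF ul, of x] that by simp
  qed
  have G: "chi_quot holomorphic_on ball 0 1"
    unfolding chi_quot_def by (rule holomorphic_quot34) auto
  \<comment> \<open>The product \<open>H\<close> is thereby holomorphic, since near 0 it coincides
    with the reciprocal of a holomorphic function.\<close>
  have "inverse (chi_quot x) = H x" if "x \<in> ball 0 (1/2)" for x
    using HG[OF that] by (metis inverse_unique mult.commute)
  moreover have "(\<lambda>x. inverse (chi_quot x)) holomorphic_on ball 0 (1/2)"
  proof (rule holomorphic_on_inverse)
    show "chi_quot holomorphic_on ball 0 (1/2)"
      by (rule holomorphic_on_subset[OF G]) auto
    show "chi_quot x \<noteq> 0" if "x \<in> ball 0 (1/2)" for x
      using HG[OF that] by auto
  qed
  ultimately have "H holomorphic_on ball 0 (1/2)" using holomorphic_transform by blast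
  then have P: "H has_fps_expansion fps_expansion H 0"
    by (intro has_fps_expansion_fps_expansion[of "ball 0 (1/2)"]) auto
  have E: "chi_quot has_fps_expansion fps_expansion chi_quot 0"
    by (intro has_fps_expansion_fps_expansion[of "ball 0 1"] G) auto
  have "(\<lambda>x. H x * chi_quot x) has_fps_expansion fps_expansion H 0 * fps_expansion chi_quot 0"
    by (intro fps_expansion_intros P E)
  moreover have "\<forall>\<^sub>F x in nhds 0. H x * chi_quot x = 1"
    using HG eventually_nhds_in_open[of "ball 0 (1/2)" 0] by (auto elim: eventually_mono)
  then have "(\<lambda>x. H x * chi_quot x) has_fps_expansion F \<longleftrightarrow> (\<lambda>x. 1) has_fps_expansion F" for F
    by (intro has_fps_expansion_cong) auto
  ultimately have "(\<lambda>x. 1) has_fps_expansion fps_expansion H 0 * fps_expansion chi_quot 0" by simp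
  then have PE: "fps_expansion H 0 * fps_expansion chi_quot 0 = 1"
    using fps_expansion_unique_complex has_fps_expansion_1 by blast
  have "fps_expansion H 0 * partition_fps ?f = 1"
  proof (rule partition_fps_inverse[OF _ _ P])
    have eq: "(\<Prod>m=1..M. 1 - of_int (?f m) * x ^ m) = (\<Prod>n<M. 1 + - (of_int (?f (Suc n)) * x ^ Suc n))" for M and x :: complex
      by (rule prod.reindex_bij_witness[of _ Suc "\<lambda>r. r - 1"]) auto
    have "uniform_limit (ball 0 (1/2)) (\<lambda>N x. \<Prod>n<N. 1 + - (of_int (?f (Suc n)) * x ^ Suc n)) H sequentially"
      by (rule uniform_limit_on_subset[OF ul]) auto
    then show "uniform_limit (ball 0 (1/2)) (\<lambda>M x. \<Prod>m=1..M. 1 - of_int (?f m) * x ^ m) H sequentially"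
      unfolding eq .
  qed simp
  with PE have "fps_expansion chi_quot 0 = partition_fps ?f"
    by (metis mult.left_commute mult_1_right)
  with E show ?thesis by simp
qed

section \<open>Extraction of the residue classes\<close>

lemma chi_quot_sum_eq_0:
  assumes R: "R \<in> {7, 11, 23, 27}" and x: "norm x < 1" "x \<noteq> 0"
  shows "(\<Sum>j<34::nat. ee (of_int (int j * (12 - R)) / 34) * chi_quot (ee (of_nat j / 34) * x)) = 0"
proof -
  \<comment> \<open>A preimage of \<open>x\<close> under \<open>\<tau>\<close> to
    \<open>ee (\<tau> / 34)\<close>; it exists because \<open>x\<close> is nonzero and lies in the
    upper half-plane because \<open>norm x < 1\<close>.\<close>
  define \<tau> where "\<tau> = 34 * Ln x / (2 * of_real pi * \<i>)"
  have "2 * of_real pi * \<i> * (\<tau> / 34) = Ln x" by (simp add: \<tau>_def)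
  then have ex: "ee (\<tau> / 34) = x" using x by (simp add: ee_def)
  have "exp (- 2 * pi * Im (\<tau> / 34)) < exp 0" using x norm_ee[of "\<tau> / 34"] by (simp add: ex)
  then have t: "Im \<tau> > 0" by (simp add: zero_less_mult_iff)
  have summand: "ee (of_int (- int j * R) / 34) * klein_quot 1 (int j) \<tau> =
      ee (12 * \<tau> / 34) * (ee (of_int (int j * (12 - R)) / 34) * chi_quot (ee (of_nat j / 34) * x))" for j
  proof -
    have "klein_quot 1 (int j) \<tau> = klein_quot 1 0 (\<tau> + of_int (int j))" unfolding klein_quot_T_int by simp
    also have "\<dots> = ee (12 * (\<tau> + of_nat j) / 34) * chi_quot (ee ((\<tau> + of_nat j) / 34))"
      unfolding klein_quot_1_0 chi_quot_def by simp
    also have "ee ((\<tau> + of_nat j) / 34) = ee (of_nat j / 34) * x"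
      by (simp add: add_divide_distrib ee_add ex mult.commute)
    finally have klein_quot: "klein_quot 1 (int j) \<tau> = ee (12 * (\<tau> + of_nat j) / 34) * chi_quot (ee (of_nat j / 34) * x)" .
    have "of_int (- int j * R) / 34 + 12 * (\<tau> + of_nat j) / 34 = 12 * \<tau> / 34 + of_int (int j * (12 - R)) / (34 :: complex)"
      by (simp add: field_simps)
    then have "ee (of_int (- int j * R) / 34) * ee (12 * (\<tau> + of_nat j) / 34) =
        ee (12 * \<tau> / 34) * ee (of_int (int j * (12 - R)) / 34)"
      unfolding ee_add[symmetric] by (rule arg_cong)
    then show ?thesis unfolding klein_quot by (simp only: mult.assoc[symmetric])
  qed
  \<comment> \<open>The vectors of this sum are (1, j), translates by \<open>j\<close> of the
    generating function, so the sum is a root-of-unity filter in \<open>x\<close>.\<close>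
  have "twisted_sum R 1 0 0 1 \<tau> = 0" by (rule twisted_sum_eq_0[OF R _ t]) simp
  moreover have "twisted_sum R 1 0 0 1 \<tau> = ee (12 * \<tau> / 34) *
      (\<Sum>j<34::nat. ee (of_int (int j * (12 - R)) / 34) * chi_quot (ee (of_nat j / 34) * x))"
    unfolding twisted_sum_def sum_distrib_left
    by (simp only: mult_zero_right mult_1_right add_0_right add_0_left summand)
  ultimately show ?thesis by simp
qed

lemma signed_partition_number_eq_0:
  assumes n: "n mod 34 \<in> {11, 15, 29, 33}"
  shows "signed_partition_number n (\<lambda>a. - chi17 a) = 0"
proof -
  \<comment> \<open>The factor \<open>x^12\<close> in \<open>klein_quot_1_0\<close> shifts the class
    of \<open>n\<close> by 12; the four classes become 23, 27, 7, 11.\<close>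
  define R where "R = int (n + 12) mod 34"
  have "R = int ((n mod 34 + 12) mod 34)"
    unfolding R_def by (simp only: mod_add_left_eq) (simp add: zmod_int)
  with n have "R \<in> {7, 11, 23, 27}" by auto
  note sum0 = chi_quot_sum_eq_0[OF this]
  let ?A = "partition_fps (\<lambda>a. - chi17 a)"
  let ?\<Psi> = "\<lambda>x. \<Sum>j<34::nat. ee (of_int (int j * (12 - R)) / 34) * chi_quot (ee (of_nat j / 34) * x)"
  let ?P = "\<Sum>j<34::nat. fps_const (ee (of_int (int j * (12 - R)) / 34)) * (?A oo (fps_const (ee (of_nat j / 34)) * fps_X))"
  have "(chi_quot \<circ> (\<lambda>x. ee (of_nat j / 34) * x)) has_fps_expansion (?A oo (fps_const (ee (of_nat j / 34)) * fps_X))" for j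
    by (intro has_fps_expansion_compose chi_quot_has_fps_expansion fps_expansion_intros) simp
  then have \<Psi>: "?\<Psi> has_fps_expansion ?P"
    by (intro has_fps_expansion_sum has_fps_expansion_cmult_left) (simp add: o_def)
  \<comment> \<open>The identity is known only for \<open>x\<close> different from 0; continuity
    extends it to the centre of expansion.\<close>
  have lim: "?\<Psi> \<midarrow>0\<rightarrow> ?\<Psi> 0"
    using has_fps_expansion_imp_continuous[OF \<Psi>, of UNIV] by (simp only: continuous_at)
  have "\<forall>\<^sub>F x in at 0. ?\<Psi> x = 0"
    unfolding eventually_at using sum0 by (intro exI[of _ 1]) auto
  then have "?\<Psi> \<midarrow>0\<rightarrow> 0" by (rule tendsto_eventually)
  then have "?\<Psi> 0 = 0" using lim LIM_unique by blast
  then have "?\<Psi> x = 0" if "x \<in> ball 0 1" for x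
    using sum0[of x] that by (cases "x = 0") (simp_all only: mem_ball dist_0_norm not_False_eq_True)
  then have "\<forall>\<^sub>F x in nhds 0. ?\<Psi> x = 0"
    using eventually_nhds_in_open[of "ball 0 1" "0::complex"] by (auto elim!: eventually_mono)
  then have "?\<Psi> has_fps_expansion F \<longleftrightarrow> (\<lambda>x. 0) has_fps_expansion F" for F
    by (intro has_fps_expansion_cong) auto
  then have "?P = 0"
    using \<Psi> fps_expansion_unique_complex has_fps_expansion_0 by blast
  \<comment> \<open>34 divides \<open>12 - R + n\<close>, so in degree \<open>n\<close> each of the
    34 summands carries the factor 1.\<close>
  moreover have "fps_nth ?P n = 34 * fps_nth ?A n"
  proof -
    obtain q where "int n + 12 = R + 34 * q"
      unfolding R_def by (metis mult_div_mod_eq add.commute of_nat_add of_nat_numeral)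
    then have q: "12 - R + int n = 34 * q" by simp
    have "ee (of_int (int j * (12 - R)) / 34) * ee (of_nat j / 34) ^ n = 1" for j :: nat
    proof -
      have "of_int (int j * (12 - R)) / 34 + of_nat n * (of_nat j / 34) = of_int (int j * (12 - R + int n)) / (34 :: complex)"
        by (simp add: field_simps)
      also have "\<dots> = of_int (int j * q)" unfolding q by simp
      finally show ?thesis unfolding ee_power ee_add[symmetric] by (simp only: ee_of_int)
    qed
    then show ?thesis
      unfolding fps_sum_nth fps_mult_left_const_nth fps_compose_linear fps_nth_Abs_fps mult.assoc[symmetric] by simp
  qed
  ultimately have "fps_nth ?A n = 0" by simp
  moreover have "n \<noteq> 0" using n by (auto intro: Nat.gr0I)
  ultimately show ?thesis by (simp add: partition_fps_def)
qed

theorem theorem1p2: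
  shows "(\<forall>n::nat. n > 0 \<and> n mod 34 \<in> {11, 15, 29, 33} \<longrightarrow>
            signed_partition_number n (\<lambda>a. - chi17 a) = 0) \<and>
         (\<forall>n::nat. n > 0 \<longrightarrow>
            (n mod 34 \<in> {11, 15, 29, 33} \<longleftrightarrow>
             odd n \<and> quadratic_residue 17 (1 - 24 * int n) \<and> \<not> quartic_residue 17 (1 - 24 * int n))) \<and>
         (\<forall>n::nat. n > 0 \<and> odd n \<and> quadratic_residue 17 (1 - 24 * int n) \<and>
            \<not> quartic_residue 17 (1 - 24 * int n) \<longrightarrow>
            signed_partition_number n (\<lambda>a. - chi17 a) = 0)"
  using signed_partition_number_eq_0 residue_classes by blast

end
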